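(* Let $m\ge 2$ and let $h:\mathrm{PConf}_n(\mathbb{C})\to\mathrm{PConf}_m(\mathbb{C})$ be a holomorphic map. Then up to permutation of coordinates in the source and target and affine twisting, $h$ is a composition of one or more of the following maps: (i) a constant map; (ii) the map $RQ_n$; (iii) the map $NI_n$; (iv) the forgetful map $\pi_n^m:(x_1,\dots,x_n)\mapsto(x_1,\dots,x_m)$ (including the case $m=n$, the identity). (In a composition, the indices $n,m$ in (ii)–(iv) are allowed to be whatever is needed for the maps to be composable.)
   Context: $\mathrm{PConf}_n(\mathbb{C})$ is the complex manifold of ordered $n$-tuples of distinct points of $\mathbb{C}$. $\mathrm{Aff}=\{z\mapsto az+b\mid a\in\mathbb{C}^*,b\in\mathbb{C}\}$ acts diagonally on $\mathrm{PConf}_m(\mathbb{C})$. Given holomorphic maps $h:\mathrm{PConf}_n(\mathbb{C})\to\mathrm{PConf}_m(\mathbb{C})$ and $A:\mathrm{PConf}_n(\mathbb{C})\to\mathrm{Aff}$, the affine twist of $h$ by $A$ is $h^A(x)=A(x)(h(x))$. The cross-ratio is $cr(x_i,x_j,x_k,x_l)=\frac{x_l-x_i}{x_l-x_k}\cdot\frac{x_j-x_k}{x_j-x_i}$; as a function of $x_l$ it is the Möbius transformation sending $x_i,x_j,x_k$ to $0,1,\infty$. The map $RQ_n:\mathrm{PConf}_n(\mathbb{C})\to\mathrm{PConf}_{n-1}(\mathbb{C})$ is $$RQ_n(x_1,\dots,x_n)=(0,1,cr(x_1,x_2,x_3,x_4),\dots,cr(x_1,x_2,x_3,x_n)).$$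 The map $NI_n:\mathrm{PConf}_n(\mathbb{C})\to\mathrm{PConf}_n(\mathbb{C})$ is $$NI_n(x_1,\dots,x_n)=\left(0,\frac{1}{x_2-x_1},\dots,\frac{1}{x_n-x_1}\right).$$ *)

theory Defs
  imports Complex_Main "HOL-Library.FuncSet" "HOL-Combinatorics.Permutations"
begin

text \<open>
  Points of \<open>\<complex>\<^sup>n\<close> are lists of length \<open>n\<close>; the coordinates \<open>x\<^sub>1, \<dots>, x\<^sub>n\<close> are
  \<open>x ! 0, \<dots>, x ! (n - 1)\<close>.  Maps out of \<open>PConf n\<close> are total functions on lists whose
  values off \<open>PConf n\<close> are irrelevant.
\<close>

definition PConf :: "nat \<Rightarrow> complex list set" where
  "PConf n = {x. length x = n \<and> distinct x}"

text \<open>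
  Holomorphy of a function on the open subset \<open>PConf n\<close> of \<open>\<complex>\<^sup>n\<close>: at every point there is a
  complex-linear differential \<open>v \<mapsto> \<Sum>i<n. c i * v\<^sub>i\<close>.  The norm on \<open>\<complex>\<^sup>n\<close> is the
  sum norm (all norms on \<open>\<complex>\<^sup>n\<close> are equivalent).  The differential is spelled out because
  \<open>has_derivative\<close> needs a normed space as a type, whereas \<open>n\<close> is a variable here.
\<close>

definition holomorphic_fun :: "nat \<Rightarrow> (complex list \<Rightarrow> complex) \<Rightarrow> bool" where
  "holomorphic_fun n f \<longleftrightarrow>
     (\<forall>x\<in>PConf n. \<exists>c :: nat \<Rightarrow> complex. \<forall>e>0. \<exists>d>0. \<forall>y\<in>PConf n.
        (\<Sum>i<n. cmod (y ! i - x ! i)) < d \<longrightarrow>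
        cmod (f y - f x - (\<Sum>i<n. c i * (y ! i - x ! i))) \<le> e * (\<Sum>i<n. cmod (y ! i - x ! i)))"

definition holomorphic_map :: "nat \<Rightarrow> nat \<Rightarrow> (complex list \<Rightarrow> complex list) \<Rightarrow> bool" where
  "holomorphic_map n m h \<longleftrightarrow>
     h \<in> PConf n \<rightarrow> PConf m \<and> (\<forall>j<m. holomorphic_fun n (\<lambda>x. h x ! j))"

definition Aff :: "(complex \<Rightarrow> complex) set" where
  "Aff = {\<lambda>z. a * z + b | a b. a \<noteq> 0}"

text \<open>\<open>Aff\<close> carries the complex structure of \<open>\<complex>\<^sup>* \<times> \<complex>\<close> via the coordinates \<open>(a, b)\<close>.\<close>

definition holomorphic_Aff :: "nat \<Rightarrow> (complex list \<Rightarrow> complex \<Rightarrow> complex) \<Rightarrow> bool" where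
  "holomorphic_Aff n A \<longleftrightarrow>
     A \<in> PConf n \<rightarrow> Aff \<and>
     (\<exists>a b. holomorphic_fun n a \<and> holomorphic_fun n b \<and>
        (\<forall>x\<in>PConf n. A x = (\<lambda>z. a x * z + b x)))"

definition affine_twist ::
    "(complex list \<Rightarrow> complex \<Rightarrow> complex) \<Rightarrow> (complex list \<Rightarrow> complex list) \<Rightarrow>
     complex list \<Rightarrow> complex list" where
  "affine_twist A h x = map (A x) (h x)"

definition cr :: "complex \<Rightarrow> complex \<Rightarrow> complex \<Rightarrow> complex \<Rightarrow> complex" where
  "cr xi xj xk xl = (xl - xi) / (xl - xk) * ((xj - xk) / (xj - xi))"

definition RQ :: "complex list \<Rightarrow> complex list" where
  "RQ x = [0, 1] @ map (cr (x ! 0) (x ! 1) (x ! 2)) (drop 3 x)"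

definition NI :: "complex list \<Rightarrow> complex list" where
  "NI x = 0 # map (\<lambda>z. 1 / (z - x ! 0)) (drop 1 x)"

text \<open>
  In \<open>basic_map n m f\<close> and \<open>basic_composition n m f\<close>, \<open>f\<close> is a map from \<open>PConf n\<close> to \<open>PConf m\<close>.
  The bounds on \<open>n\<close> are those for which the formulas make sense: \<open>RQ\<close> refers to
  \<open>x\<^sub>1, x\<^sub>2, x\<^sub>3\<close> and \<open>NI\<close> to \<open>x\<^sub>1\<close>.
\<close>

inductive basic_map :: "nat \<Rightarrow> nat \<Rightarrow> (complex list \<Rightarrow> complex list) \<Rightarrow> bool" where
  const: "p \<in> PConf m \<Longrightarrow> basic_map n m (\<lambda>_. p)"
| RQ: "n \<ge> 3 \<Longrightarrow> basic_map n (n - 1) RQ"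
| NI: "n \<ge> 1 \<Longrightarrow> basic_map n n NI"
| forget: "m \<le> n \<Longrightarrow> basic_map n m (take m)"

inductive basic_composition :: "nat \<Rightarrow> nat \<Rightarrow> (complex list \<Rightarrow> complex list) \<Rightarrow> bool" where
  single: "basic_map n m f \<Longrightarrow> basic_composition n m f"
| comp: "basic_composition n k f \<Longrightarrow> basic_map k m g \<Longrightarrow> basic_composition n m (g \<circ> f)"

end

theory Submission
  imports Defs "HOL-Complex_Analysis.Complex_Analysis"
begin

text \<open>
  After an affine twist the first two coordinates of \<open>h\<close> are \<open>0\<close> and \<open>1\<close>. Each further coordinate \<open>f\<close> is then a
  holomorphic function on \<open>PConf n\<close> that omits \<open>0\<close> and \<open>1\<close>, and two of them never take the same value at the same
  configuration. So it suffices to determine these functions, and the families of them without coincidences.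

  Functions. As a function of one coordinate, \<open>f\<close> has no essential singularity by Picard's great theorem, so it is
  a product of integral powers of differences (\<open>omits_0_1_imp_product_of_powers\<close>). Integer exponents cannot vary
  with the other coordinates, hence \<open>f\<close> is a constant times a product of powers of the \<open>x\<^sub>i - x\<^sub>j\<close>
  (\<open>separately_monomial_imp_product\<close>), and so is \<open>1 - f\<close>. Clearing denominators gives a relation
  \<open>F\<^sub>0 + F\<^sub>1 + F\<^sub>2 = 0\<close> between three products of such linear forms without common factor. Colour the edge
  \<open>ij\<close> by the product that \<open>x\<^sub>i - x\<^sub>j\<close> divides. When some of the points are merged and two of the products
  vanish, so does the third. This simple rule leaves two possibilities for a nonconstant \<open>f\<close>: a triangle with
  three colours, or a complete graph on four vertices whose perfect matchings are the three colours
  (\<open>coloured_edges.shape\<close>). All exponents are \<open>1\<close>, and \<open>f\<close> is the cross-ratio of four of the points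
  \<open>x\<^sub>1, \<dots>, x\<^sub>n, \<infinity>\<close> (\<open>holomorphic_omits_0_1_imp_cross_ratio\<close>).

  Families. A cross-ratio takes every value other than \<open>0\<close> and \<open>1\<close>, so a constant coordinate cannot occur beside
  a nonconstant one. Suppose that two cross-ratios never agree and that the first one involves a point \<open>d\<close> that the
  second one does not. Solving for the position of \<open>d\<close> where they agree must lead to a position that is already
  occupied, always by the same point \<open>e\<close>; then the second cross-ratio is the first one with \<open>e\<close> in
  place of \<open>d\<close> (\<open>no_collision_imp_shared_triple\<close>). Hence all coordinates of \<open>h\<close> are of the form \<open>cr(a, b, c, e)\<close>
  with the same \<open>a, b, c\<close> (\<open>cross_ratio_family\<close>).

  So \<open>h\<close> records, up to an affine twist, some of the points \<open>x\<^sub>1, \<dots>, x\<^sub>n, \<infinity>\<close> in a chart in which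
  \<open>c\<close> is at infinity. According to whether \<open>\<infinity>\<close> is \<open>c\<close>, is among the recorded points, or is forgotten, this is a
  forgetful map, or a forgetful map followed by \<open>NI\<close> or by \<open>RQ\<close> (\<open>realize_cross_ratio_family\<close>).
\<close>

section \<open>Functions of one variable that omit two values\<close>

lemma eventually_at_notin_finite:
  fixes s :: complex
  assumes "finite S"
  shows "eventually (\<lambda>w. w \<notin> S) (at s)"
proof -
  have "eventually (\<lambda>w. w \<in> - (S - {s}) - {s}) (at s)"
    using assms by (intro eventually_at_in_open open_Compl finite_imp_closed) auto
  then show ?thesis by eventually_elim auto
qed

text \<open>
  An essential singularity is excluded by Picard's great theorem. The limit \<open>l\<close> of \<open>f\<close> or of
  \<open>1/f\<close> that it provides means a removable singularity, except when \<open>1/f\<close> tends to \<open>0\<close>: a pole.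
\<close>

lemma meromorphic_at_if_omits_0_1:
  assumes "open M" "z \<in> M" "f holomorphic_on M - {z}"
    and omit: "\<And>w. w \<in> M - {z} \<Longrightarrow> f w \<noteq> 0 \<and> f w \<noteq> 1"
  shows "f meromorphic_on {z}"
proof -
  obtain l where l: "(f \<longlongrightarrow> l) (at z) \<or> ((inverse \<circ> f) \<longlongrightarrow> l) (at z)"
    using great_Picard[OF assms(1,2) zero_neq_one assms(3,4)] by blast
  have ev: "eventually (\<lambda>w. w \<in> M - {z}) (at z)"
    using assms by (intro eventually_at_in_open) auto
  have "not_essential f z"
  proof (cases "\<exists>l. (f \<longlongrightarrow> l) (at z)")
    case True
    then show ?thesis
      by (auto simp: not_essential_def)
  next
    case False
    with l have inv: "((inverse \<circ> f) \<longlongrightarrow> l) (at z)" by blast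
    have "l = 0"
    proof (rule ccontr)
      assume "l \<noteq> 0"
      then have "((\<lambda>w. inverse ((inverse \<circ> f) w)) \<longlongrightarrow> inverse l) (at z)"
        using inv by (intro tendsto_inverse)
      then show False using False by auto
    qed
    have "filterlim (\<lambda>w. inverse (f w)) (at 0) (at z)"
      using inv \<open>l = 0\<close> ev omit
      by (auto simp: filterlim_at o_def elim!: eventually_mono)
    then have "filterlim (\<lambda>w. inverse (inverse (f w))) at_infinity (at z)"
      using filterlim_compose filterlim_inverse_at_infinity by blast
    then show ?thesis
      by (simp add: not_essential_def is_pole_def)
  qed
  moreover have "isolated_singularity_at f z"
    using isolated_singularity_at_holomorphic[OF assms(3,1,2)] .
  ultimately show ?thesis
    by (simp add: meromorphic_at_iff)
qed

text \<open>
  At infinity, \<open>f\<close> has a finite limit or a pole; in the second case the entire function \<open>1/f\<close> tends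
  to \<open>0\<close>. Liouville's theorem applies to \<open>f\<close> or to \<open>1/f\<close>.
\<close>

lemma entire_nonvanishing_meromorphic_at_infinity_const:
  assumes hol: "f holomorphic_on UNIV" and nz: "\<And>z. f z \<noteq> 0"
    and mero: "(\<lambda>w. f (inverse w)) meromorphic_on {0}"
  shows "\<exists>c. \<forall>z. f z = c"
proof -
  have ne: "not_essential (\<lambda>w. f (inverse w)) 0"
    using mero by (simp add: meromorphic_at_iff)
  consider l where "((\<lambda>w. f (inverse w)) \<longlongrightarrow> l) (at 0)" | "is_pole (\<lambda>w. f (inverse w)) 0"
    using ne by (auto simp: not_essential_def)
  then show ?thesis
  proof cases
    case (1 l)
    then have "(f \<longlongrightarrow> l) at_infinity"
      by (simp add: lim_at_infinity_0 o_def)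
    then show ?thesis using Liouville_weak[OF hol] by blast
  next
    case 2
    then have "((\<lambda>w. inverse (f (inverse w))) \<longlongrightarrow> 0) (at 0)"
      using filterlim_compose[OF tendsto_inverse_0] by (auto simp: is_pole_def)
    then have "((\<lambda>z. inverse (f z)) \<longlongrightarrow> 0) at_infinity"
      by (simp add: lim_at_infinity_0 o_def)
    moreover have "(\<lambda>z. inverse (f z)) holomorphic_on UNIV"
      using hol nz by (intro holomorphic_intros) auto
    ultimately have "inverse (f 0) = 0"
      using Liouville_weak_0 by blast
    then show ?thesis using nz by simp
  qed
qed

text \<open>
  The singularities of \<open>f\<close> on the sphere are at most poles. Dividing by \<open>(z - s)\<close> to the order of \<open>f\<close>
  at \<open>s\<close>, for each \<open>s \<in> S\<close>, leaves an entire function without zeros that is meromorphic at infinity,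
  hence a constant.
\<close>

lemma omits_0_1_imp_product_of_powers:
  assumes S: "finite S" and hol: "f holomorphic_on - S"
    and omit: "\<And>z. z \<notin> S \<Longrightarrow> f z \<noteq> 0 \<and> f z \<noteq> 1"
  shows "\<exists>c a. c \<noteq> 0 \<and> (\<forall>z. z \<notin> S \<longrightarrow> f z = c * (\<Prod>s\<in>S. (z - s) powi a s))"
proof -
  have clS: "open (- S)"
    using S by (simp add: finite_imp_closed open_Compl)
  have mero: "f meromorphic_on {s}" if "s \<in> S" for s
  proof (rule meromorphic_at_if_omits_0_1[of "- (S - {s})"])
    show "open (- (S - {s}))"
      using S by (intro open_Compl finite_imp_closed) auto
    show "f holomorphic_on - (S - {s}) - {s}"
      by (rule holomorphic_on_subset[OF hol]) (use that in auto)
  qed (use omit that in auto)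
  define k where "k = (\<lambda>s. zorder f s)"
  define G where "G = (\<lambda>z. f z * (\<Prod>s\<in>S. (z - s) powi (- k s)))"
  have Glim: "\<exists>l. l \<noteq> 0 \<and> (G \<longlongrightarrow> l) (at s)" if s: "s \<in> S" for s
  proof -
    have ev: "eventually (\<lambda>w. w \<notin> S) (at s)"
      by (rule eventually_at_notin_finite[OF S])
    have "frequently (\<lambda>w. f w \<noteq> 0) (at s)"
      using ev omit by (intro eventually_frequently) (auto elim: eventually_mono)
    then obtain g r where g: "g s \<noteq> 0" "r > 0" "g holomorphic_on cball s r"
      "\<And>w. w \<in> cball s r - {s} \<Longrightarrow> f w = g w * (w - s) powi (k s)"
      using zorder_exist[of f s] mero[OF s] unfolding k_def meromorphic_at_iff by blast
    define P where "P = (\<lambda>z. \<Prod>t\<in>S - {s}. (z - t) powi (- k t))"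
    have "isCont g s"
    proof -
      have "continuous_on (ball s r) g"
        using g(3) holomorphic_on_imp_continuous_on holomorphic_on_subset ball_subset_cball by blast
      then show ?thesis
        using g(2) by (simp add: continuous_on_eq_continuous_at)
    qed
    moreover have "isCont P s"
      unfolding P_def by (intro continuous_intros) auto
    ultimately have "((\<lambda>z. g z * P z) \<longlongrightarrow> g s * P s) (at s)"
      by (intro tendsto_mult) (auto simp: isCont_def)
    moreover have "eventually (\<lambda>w. g w * P w = G w) (at s)"
    proof -
      have "eventually (\<lambda>w. w \<in> ball s r - {s}) (at s)"
        using g(2) by (intro eventually_at_in_open) auto
      then show ?thesis
      proof eventually_elim
        case (elim w)
        then have "w - s \<noteq> 0" by auto
        moreover have "(\<Prod>t\<in>S. (w - t) powi (- k t)) = (w - s) powi (- k s) * P w"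
          unfolding P_def using S s by (simp add: prod.remove)
        moreover have "f w = g w * (w - s) powi (k s)"
          using elim by (intro g(4)) auto
        ultimately show ?case
          unfolding G_def by (simp add: power_int_minus)
      qed
    qed
    ultimately have "(G \<longlongrightarrow> g s * P s) (at s)"
      using tendsto_cong[of "\<lambda>w. g w * P w" G] by blast
    moreover have "P s \<noteq> 0"
      using S by (auto simp: P_def)
    ultimately show ?thesis using g(1) by (metis mult_eq_0_iff)
  qed
  then obtain L where L: "\<And>s. s \<in> S \<Longrightarrow> L s \<noteq> 0 \<and> (G \<longlongrightarrow> L s) (at s)" by metis
  \<comment> \<open>the extension of \<open>G\<close> across \<open>S\<close>; its values there are the nonzero limits \<open>L\<close>\<close>
  define H where "H = (\<lambda>z. if z \<in> S then L z else G z)"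
  have evH: "eventually (\<lambda>w. H w = G w) (at s)" for s
    using eventually_at_notin_finite[OF S] by eventually_elim (simp add: H_def)
  have Ghol: "G holomorphic_on - S"
    unfolding G_def by (intro holomorphic_intros hol) auto
  have Hhol: "H holomorphic_on UNIV"
  proof (rule no_isolated_singularity'[OF _ _ open_UNIV S])
    show "(H \<longlongrightarrow> H s) (at s within UNIV)" if "s \<in> S" for s
      using tendsto_cong[OF evH[of s]] L[OF that] that by (simp add: H_def)
    show "H holomorphic_on UNIV - S"
      by (rule holomorphic_transform[OF holomorphic_on_subset[OF Ghol]]) (auto simp: H_def)
  qed
  have Hnz: "H z \<noteq> 0" for z
    using L omit S by (auto simp: H_def G_def)
  have Hmero: "(\<lambda>w. H (inverse w)) meromorphic_on {0}"
  proof -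
    define M where "M = - (inverse ` (S - {0}))"
    have fmero: "(\<lambda>w. f (inverse w)) meromorphic_on {0}"
    proof (rule meromorphic_at_if_omits_0_1[of M])
      show "open M" unfolding M_def
        using S by (intro open_Compl finite_imp_closed) auto
      have M: "inverse w \<notin> S" if "w \<in> M - {0}" for w
        using that unfolding M_def
        by (metis ComplD Diff_iff image_eqI inverse_inverse_eq nonzero_imp_inverse_nonzero singletonD
            singletonI)
      show "(\<lambda>w. f (inverse w)) holomorphic_on M - {0}"
      proof -
        have "(\<lambda>w. inverse w) holomorphic_on M - {0}"
          by (intro holomorphic_intros) auto
        then have "f \<circ> (\<lambda>w. inverse w) holomorphic_on M - {0}"
          by (rule holomorphic_on_compose_gen[OF _ hol]) (use M in blast)
        then show ?thesis by (simp add: o_def)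
      qed
      show "\<And>w. w \<in> M - {0} \<Longrightarrow> f (inverse w) \<noteq> 0 \<and> f (inverse w) \<noteq> 1"
        using M omit by blast
    qed (auto simp: M_def)
    have "(\<lambda>w. f (inverse w) * (\<Prod>s\<in>S. (inverse w - s) powi (- k s))) meromorphic_on {0}"
      by (intro meromorphic_intros fmero)
    moreover have "eventually (\<lambda>w. f (inverse w) * (\<Prod>s\<in>S. (inverse w - s) powi (- k s)) = H (inverse w)) (at 0)"
    proof -
      have "eventually (\<lambda>w. w \<notin> inverse ` S) (at (0::complex))"
        using S by (intro eventually_at_notin_finite) auto
      then show ?thesis
        by eventually_elim (auto simp: H_def G_def rev_image_eqI)
    qed
    ultimately show ?thesis
      by (subst (asm) meromorphic_on_cong) auto
  qed
  obtain c where c: "\<And>z. H z = c"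
    using entire_nonvanishing_meromorphic_at_infinity_const[OF Hhol Hnz Hmero] by blast
  have "f z = c * (\<Prod>s\<in>S. (z - s) powi k s)" if "z \<notin> S" for z
  proof -
    have "c = f z * (\<Prod>s\<in>S. (z - s) powi (- k s))"
      using c[of z] that by (simp add: H_def G_def)
    moreover have "(\<Prod>s\<in>S. (z - s) powi (- k s)) * (\<Prod>s\<in>S. (z - s) powi k s) = 1"
      unfolding prod.distrib[symmetric]
    proof (rule prod.neutral, rule ballI)
      fix s assume "s \<in> S"
      then have "z - s \<noteq> 0" using that by auto
      then show "(z - s) powi (- k s) * (z - s) powi k s = 1"
        by (simp add: power_int_minus)
    qed
    ultimately show ?thesis by simp
  qed
  then show ?thesis using c Hnz by metis
qed

section \<open>Functions on configurations that are monomial in every variable\<close>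

text \<open>
  Separating positive from negative exponents turns the hypothesis into an equality of two polynomials
  at infinitely many points. As polynomials they are equal, and at \<open>p j\<close> at most one of them vanishes
  by construction, so neither does.
\<close>

lemma power_product_eq_1_on_infinite:
  fixes p :: "'a \<Rightarrow> complex"
  assumes J: "finite J" and inj: "inj_on p J" and Z: "infinite Z"
    and eq: "\<And>z. z \<in> Z \<Longrightarrow> z \<notin> p ` J \<Longrightarrow> K * (\<Prod>j\<in>J. (z - p j) powi d j) = 1"
  shows "K = 1" "\<And>j. j \<in> J \<Longrightarrow> d j = 0"
proof -
  define N where "N = Polynomial.smult K (\<Prod>j\<in>J. [:- p j, 1:] ^ nat (d j))"
  define M where "M = (\<Prod>j\<in>J. [:- p j, 1:] ^ nat (- d j))"
  have split: "(z - p j) powi d j * (z - p j) ^ nat (- d j) = (z - p j) ^ nat (d j)"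
    if "z \<noteq> p j" for z j
    using that by (auto simp: power_int_def simp flip: power_mult_distrib)
  have NM: "poly N z = K * (\<Prod>j\<in>J. (z - p j) powi d j) * poly M z" if "z \<notin> p ` J" for z
  proof -
    have "(\<Prod>j\<in>J. (z - p j) powi d j) * (\<Prod>j\<in>J. (z - p j) ^ nat (- d j))
        = (\<Prod>j\<in>J. (z - p j) ^ nat (d j))"
      unfolding prod.distrib[symmetric] by (rule prod.cong) (use that split in auto)
    then show ?thesis
      by (simp add: N_def M_def poly_prod mult.assoc)
  qed
  have "N - M = 0"
  proof (rule ccontr)
    assume "N - M \<noteq> 0"
    then have "finite {z. poly (N - M) z = 0}"
      by (rule poly_roots_finite)
    moreover have "Z - p ` J \<subseteq> {z. poly (N - M) z = 0}"
      using NM eq by auto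
    moreover have "infinite (Z - p ` J)"
      using Z J by simp
    ultimately show False
      using finite_subset by blast
  qed
  then have "N = M" by simp
  obtain z0 where "z0 \<in> Z - p ` J"
    using Z J by (metis Diff_infinite_finite finite.emptyI finite_imageI ex_in_conv)
  then have K: "K \<noteq> 0"
    using eq[of z0] by auto
  have d0: "d j = 0" if "j \<in> J" for j
  proof -
    have *: "poly (\<Prod>i\<in>J. [:- p i, 1:] ^ k i) (p j) = 0 \<longleftrightarrow> k j \<noteq> 0" for k
      using that J inj by (auto simp: poly_prod inj_on_def)
    have "poly N (p j) = 0 \<longleftrightarrow> nat (d j) \<noteq> 0" "poly M (p j) = 0 \<longleftrightarrow> nat (- d j) \<noteq> 0"
      using *[of "\<lambda>i. nat (d i)"] *[of "\<lambda>i. nat (- d i)"] K by (simp_all add: N_def M_def)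
    then have "nat (d j) \<noteq> 0 \<longleftrightarrow> nat (- d j) \<noteq> 0"
      using \<open>N = M\<close> by simp
    then show ?thesis by linarith
  qed
  then show "\<And>j. j \<in> J \<Longrightarrow> d j = 0" .
  have "(\<Prod>j\<in>J. (z0 - p j) powi d j) = 1"
    by (rule prod.neutral) (simp add: d0)
  then show "K = 1"
    using eq[of z0] \<open>z0 \<in> Z - p ` J\<close> by simp
qed

lemma power_product_unique:
  fixes p :: "'a \<Rightarrow> complex"
  assumes J: "finite J" and inj: "inj_on p J" and Z: "infinite Z" and "c' \<noteq> 0"
    and eq: "\<And>z. z \<in> Z \<Longrightarrow> z \<notin> p ` J \<Longrightarrow>
      c * (\<Prod>j\<in>J. (z - p j) powi a j) = c' * (\<Prod>j\<in>J. (z - p j) powi b j)"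
  shows "c = c'" "\<And>j. j \<in> J \<Longrightarrow> a j = b j"
proof -
  have *: "c / c' * (\<Prod>j\<in>J. (z - p j) powi (a j - b j)) = 1" if "z \<in> Z" "z \<notin> p ` J" for z
  proof -
    have "(\<Prod>j\<in>J. (z - p j) powi (a j - b j)) =
        (\<Prod>j\<in>J. (z - p j) powi a j) / (\<Prod>j\<in>J. (z - p j) powi b j)"
      unfolding prod_dividef[symmetric]
      by (rule prod.cong[OF refl], rule power_int_diff) (use that in auto)
    moreover have "(\<Prod>j\<in>J. (z - p j) powi b j) \<noteq> 0"
      using J that by auto
    ultimately show ?thesis
      using eq[OF that] \<open>c' \<noteq> 0\<close> by simp
  qed
  note P = power_product_eq_1_on_infinite[OF J inj Z *]
  show "c = c'" using P(1) \<open>c' \<noteq> 0\<close> by simp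
  show "\<And>j. j \<in> J \<Longrightarrow> a j = b j" using P(2) by force
qed

lemma ex_distinct_avoiding:
  assumes "finite (B :: complex set)"
  shows "\<exists>z\<in>PConf n. set z \<inter> B = {}"
proof (induction n)
  case 0
  show ?case by (auto simp: PConf_def)
next
  case (Suc n)
  then obtain z where z: "z \<in> PConf n" "set z \<inter> B = {}" by blast
  obtain w where "w \<notin> set z \<union> B"
    using assms ex_new_if_finite[OF infinite_UNIV_char_0, of "set z \<union> B"] by auto
  then have "w # z \<in> PConf (Suc n)" "set (w # z) \<inter> B = {}"
    using z by (auto simp: PConf_def)
  then show ?case by blast
qed

text \<open>
  A substitute for the connectedness of \<open>PConf n\<close> that only involves paths along which one point moves:
  replace the points of \<open>x\<close> one after the other by points of an auxiliary configuration \<open>z\<close> that is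
  disjoint from \<open>x\<close> and \<open>y\<close>, then those by the points of \<open>y\<close>.
\<close>

lemma PConf_moves_connect:
  assumes move: "\<And>x i z. x \<in> PConf n \<Longrightarrow> i < n \<Longrightarrow> x[i := z] \<in> PConf n \<Longrightarrow> F (x[i := z]) = F x"
    and "x \<in> PConf n" "y \<in> PConf n"
  shows "F x = F y"
proof -
  have disj: "F x = F z" if "x \<in> PConf n" "z \<in> PConf n" "set z \<inter> set x = {}" for x z
  proof -
    have PC: "take k z @ drop k x \<in> PConf n" if "k \<le> n" for k
      using that \<open>x \<in> PConf n\<close> \<open>z \<in> PConf n\<close> \<open>set z \<inter> set x = {}\<close>
        set_take_subset[of k z] set_drop_subset[of k x]
      by (auto simp: PConf_def)
    have "k \<le> n \<Longrightarrow> F (take k z @ drop k x) = F x" for k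
    proof (induction k)
      case (Suc k)
      have "(take k z @ drop k x)[k := z ! k] = take (Suc k) z @ drop (Suc k) x"
        using Suc.prems \<open>x \<in> PConf n\<close> \<open>z \<in> PConf n\<close>
        by (simp add: PConf_def list_update_append take_Suc_conv_app_nth flip: Cons_nth_drop_Suc)
      then show ?case
        using move[of "take k z @ drop k x" k "z ! k"] PC[of k] PC[of "Suc k"] Suc by simp
    qed simp
    from this[of n] show ?thesis
      using that by (simp add: PConf_def)
  qed
  obtain z where "z \<in> PConf n" "set z \<inter> (set x \<union> set y) = {}"
    using ex_distinct_avoiding[of "set x \<union> set y" n] by auto
  then show ?thesis
    using disj[of x z] disj[of y z] assms(2,3) by (simp add: Int_Un_distrib)
qed

lemma PConf_update:
  assumes "x \<in> PConf n" "i < n"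
  shows "x[i := z] \<in> PConf n \<longleftrightarrow> (\<forall>j<n. j \<noteq> i \<longrightarrow> z \<noteq> x ! j)"
  using assms
  by (auto simp: PConf_def distinct_conv_nth nth_list_update split: if_splits)

lemma PConf_snoc: "y @ [z] \<in> PConf (Suc n) \<longleftrightarrow> y \<in> PConf n \<and> z \<notin> set y"
  by (auto simp: PConf_def)

text \<open>
  The one-variable conclusion for holomorphic functions that omit \<open>0\<close> and \<open>1\<close>, in every variable
  separately; a priori the constant and the exponents depend on the other coordinates. Unlike the
  omission of \<open>1\<close>, this property passes to the coefficient that remains in the induction below.
\<close>

definition separately_monomial :: "nat \<Rightarrow> (complex list \<Rightarrow> complex) \<Rightarrow> bool" where
  "separately_monomial n f \<longleftrightarrow> (\<forall>x\<in>PConf n. \<forall>i<n. \<exists>c a. c \<noteq> 0 \<and>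
     (\<forall>z. x[i := z] \<in> PConf n \<longrightarrow> f (x[i := z]) = c * (\<Prod>j\<in>{..<n} - {i}. (z - x ! j) powi a j)))"

lemma power_int_diff_flip:
  fixes u v :: complex
  shows "(u - v) powi k = (-1) powi k * (v - u) powi k"
  by (simp flip: power_int_mult_distrib)

lemma prod_lessThan_Suc_remove:
  fixes g :: "nat \<Rightarrow> complex"
  assumes "i < n"
  shows "(\<Prod>k<Suc n. g k) = g n * (g i * (\<Prod>k\<in>{..<n} - {i}. g k))"
  using assms by (simp add: prod.remove[of "{..<n}" i] mult.commute)

text \<open>
  Induction on \<open>n\<close>. As a function of the last coordinate, \<open>f\<close> is a power product with a coefficient
  \<open>C y\<close> and exponents \<open>A y\<close> that depend on the other coordinates \<open>y\<close>. The exponents are constant: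
  let one coordinate \<open>v\<close> of \<open>y\<close> move. Since there are only countably many integer vectors, some
  exponent vector \<open>\<alpha>\<close> occurs for infinitely many \<open>v\<close>. The identity that expresses this relates power
  products in \<open>v\<close>, so it holds for all \<open>v\<close>. Consequently \<open>C\<close> is again separately monomial, the factor
  \<open>v - u\<close> having been absorbed by the split-off product, and the induction hypothesis applies to it.
\<close>

lemma separately_monomial_imp_product:
  assumes "separately_monomial n f" "\<And>x. x \<in> PConf n \<Longrightarrow> f x \<noteq> 0"
  shows "\<exists>c a. c \<noteq> 0 \<and> (\<forall>x\<in>PConf n. f x = c * (\<Prod>i<n. \<Prod>j<i. (x ! i - x ! j) powi a i j))"
  using assms
proof (induction n arbitrary: f)
  case 0
  have "PConf 0 = {[]}" by (auto simp: PConf_def)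
  then have "f [] \<noteq> 0" "\<forall>x\<in>PConf 0. f x = f [] * (\<Prod>i<0. \<Prod>j<i. (x ! i - x ! j) powi a i j)" for a
    using 0(2) by simp_all
  then show ?case by blast
next
  case (Suc n)
  have "\<exists>c a. c \<noteq> 0 \<and> (\<forall>z. z \<notin> set y \<longrightarrow> f (y @ [z]) = c * (\<Prod>j<n. (z - y ! j) powi a j))"
    if y: "y \<in> PConf n" for y
  proof -
    obtain z0 where z0: "z0 \<notin> set y"
      using ex_new_if_finite[OF infinite_UNIV_char_0, of "set y"] by auto
    with y have "y @ [z0] \<in> PConf (Suc n)" by (simp add: PConf_snoc)
    then obtain c a where ca: "c \<noteq> 0" and
      "\<And>z. (y @ [z0])[n := z] \<in> PConf (Suc n) \<Longrightarrow>
         f ((y @ [z0])[n := z]) = c * (\<Prod>j\<in>{..<Suc n} - {n}. (z - (y @ [z0]) ! j) powi a j)"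
      using Suc.prems(1) unfolding separately_monomial_def by blast
    moreover have "(y @ [z0])[n := z] = y @ [z]" for z
      using y by (simp add: PConf_def list_update_append)
    moreover have "(\<Prod>j\<in>{..<Suc n} - {n}. (z - (y @ [z0]) ! j) powi a j)
        = (\<Prod>j<n. (z - y ! j) powi a j)" for z
      using y by (intro prod.cong) (auto simp: PConf_def nth_append)
    ultimately show ?thesis
      using y by (auto simp: PConf_snoc)
  qed
  then obtain C A where Cnz: "\<And>y. y \<in> PConf n \<Longrightarrow> C y \<noteq> 0"
    and CA: "\<And>y z. y \<in> PConf n \<Longrightarrow> z \<notin> set y \<Longrightarrow>
      f (y @ [z]) = C y * (\<Prod>j<n. (z - y ! j) powi A y j)"
    by metis
  have shape: "\<exists>\<beta> b e. \<beta> \<noteq> 0 \<and> (\<forall>v. y[i := v] \<in> PConf n \<longrightarrow> v \<noteq> u \<longrightarrow>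
      f (y[i := v] @ [u]) = \<beta> * (\<Prod>j\<in>{..<n} - {i}. (v - y ! j) powi b j) * (v - u) powi e)"
    if y: "y \<in> PConf n" and i: "i < n" and u: "\<forall>j<n. j \<noteq> i \<longrightarrow> u \<noteq> y ! j" for y i u
  proof -
    obtain v0 where v0: "v0 \<notin> insert u (set y)"
      using ex_new_if_finite[OF infinite_UNIV_char_0, of "insert u (set y)"] by auto
    define x where "x = y[i := v0] @ [u]"
    have len: "length y = n" using y by (simp add: PConf_def)
    have yv0: "y[i := v0] \<in> PConf n"
      using y i v0 len by (subst PConf_update) auto
    have "u \<notin> set (y[i := v0])"
      using u v0 len i by (auto simp: in_set_conv_nth nth_list_update split: if_splits)
    then have "x \<in> PConf (Suc n)" unfolding x_def
      using yv0 by (simp add: PConf_snoc)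
    then obtain c a where ca: "c \<noteq> 0" and
      f: "\<And>z. x[i := z] \<in> PConf (Suc n) \<Longrightarrow>
         f (x[i := z]) = c * (\<Prod>j\<in>{..<Suc n} - {i}. (z - x ! j) powi a j)"
      using Suc.prems(1) i unfolding separately_monomial_def by (meson less_Suc_eq)
    have "f (y[i := v] @ [u]) = c * (\<Prod>j\<in>{..<n} - {i}. (v - y ! j) powi a j) * (v - u) powi a n"
      if "y[i := v] \<in> PConf n" "v \<noteq> u" for v
    proof -
      have xv: "x[i := v] = y[i := v] @ [u]"
        using i len by (simp add: x_def list_update_append)
      have "u \<notin> set (y[i := v])"
        using u that len i by (auto simp: in_set_conv_nth nth_list_update split: if_splits)
      then have "x[i := v] \<in> PConf (Suc n)"
        using that by (simp add: xv PConf_snoc)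
      moreover have "{..<Suc n} - {i} = insert n ({..<n} - {i})"
        using i by auto
      moreover have "(\<Prod>j\<in>{..<n} - {i}. (v - x ! j) powi a j)
          = (\<Prod>j\<in>{..<n} - {i}. (v - y ! j) powi a j)"
        by (rule prod.cong) (auto simp: x_def nth_append len)
      moreover have "x ! n = u" by (simp add: x_def nth_append len)
      ultimately show ?thesis
        using f[of v] by (simp add: xv mult.assoc)
    qed
    then show ?thesis using ca by blast
  qed
  have A_move: "A (y[i := v]) j = A y j"
    if y: "y \<in> PConf n" and i: "i < n" and yv: "y[i := v] \<in> PConf n" and j: "j < n" for y i v j
  proof -
    define V where "V = {v. y[i := v] \<in> PConf n}"
    have len: "length y = n" using y by (simp add: PConf_def)
    have V: "v \<in> V \<longleftrightarrow> (\<forall>j<n. j \<noteq> i \<longrightarrow> v \<noteq> y ! j)" for v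
      using PConf_update[OF y i] by (simp add: V_def)
    have "uncountable V"
    proof
      assume "countable V"
      moreover have "- V \<subseteq> set y"
        using V len by (auto simp: in_set_conv_nth)
      ultimately have "countable (V \<union> set y)" "UNIV = V \<union> set y"
        by (auto intro: countable_finite)
      then show False
        using uncountable_UNIV_complex by simp
    qed
    define F where "F = (\<lambda>v. map (A (y[i := v])) [0..<n])"
    have "\<exists>l. infinite {v \<in> V. F v = l}"
    proof (rule ccontr)
      assume "\<nexists>l. infinite {v \<in> V. F v = l}"
      then have "countable (\<Union>l. {v \<in> V. F v = l})"
        by (intro countable_UN) (auto intro: countable_finite)
      moreover have "(\<Union>l. {v \<in> V. F v = l}) = V" by auto
      ultimately show False using \<open>uncountable V\<close> by simp
    qed
    then obtain l where l: "infinite {v \<in> V. F v = l}" by blast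
    then obtain v1 where "v1 \<in> V" "F v1 = l"
      by (metis (mono_tags, lifting) Collect_empty_eq finite.emptyI)
    define \<alpha> where "\<alpha> = A (y[i := v1])"
    define Z where "Z = {v \<in> V. F v = l}"
    have Z: "infinite Z" "\<And>v. v \<in> Z \<Longrightarrow> v \<in> V" "\<And>v k. v \<in> Z \<Longrightarrow> k < n \<Longrightarrow> A (y[i := v]) k = \<alpha> k"
    proof -
      show "infinite Z" "\<And>v. v \<in> Z \<Longrightarrow> v \<in> V" using l by (auto simp: Z_def)
      fix v k assume "v \<in> Z" "k < n"
      then have "F v = F v1" using \<open>F v1 = l\<close> by (simp add: Z_def)
      then have "F v ! k = F v1 ! k" by simp
      then show "A (y[i := v]) k = \<alpha> k" using \<open>k < n\<close> by (simp add: F_def \<alpha>_def)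
    qed
    \<comment> \<open>for \<open>v \<in> Z\<close> and \<open>u\<close> distinct from the other points, the value of \<open>f\<close> at \<open>y[i := v] @ [u]\<close> is \<open>C (y[i := v]) * P u v\<close>\<close>
    define P where "P = (\<lambda>u v. (\<Prod>j<n. (u - y[i := v] ! j) powi \<alpha> j))"
    define Q where "Q = (\<lambda>u. (\<Prod>j\<in>{..<n} - {i}. (u - y ! j) powi \<alpha> j))"
    have PQ: "P u v = Q u * (u - v) powi \<alpha> i" for u v
    proof -
      have "P u v = (u - y[i := v] ! i) powi \<alpha> i * (\<Prod>j\<in>{..<n} - {i}. (u - y[i := v] ! j) powi \<alpha> j)"
        unfolding P_def using i by (subst prod.remove[of _ i]) auto
      also have "(\<Prod>j\<in>{..<n} - {i}. (u - y[i := v] ! j) powi \<alpha> j) = Q u"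
        unfolding Q_def by (rule prod.cong) auto
      finally show ?thesis using i len by simp
    qed
    \<comment> \<open>eliminates \<open>C\<close>; true for \<open>v \<in> Z\<close>, and both sides are power products in \<open>v\<close>\<close>
    have ratio: "f (y[i := v] @ [u1]) * P u0 v = f (y[i := v] @ [u0]) * P u1 v"
      if u: "u0 \<in> V" "u1 \<in> V" "u0 \<noteq> u1" and v: "v \<in> V" "v \<noteq> u0" "v \<noteq> u1" for u0 u1 v
    proof -
      have nV: "\<forall>j<n. j \<noteq> i \<longrightarrow> u0 \<noteq> y ! j" "\<forall>j<n. j \<noteq> i \<longrightarrow> u1 \<noteq> y ! j"
        using u V by auto
      obtain \<beta>0 b0 e0 where \<beta>0: "\<beta>0 \<noteq> 0" and fb0: "\<And>v. v \<in> V \<Longrightarrow> v \<noteq> u0 \<Longrightarrow> f (y[i := v] @ [u0]) =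
          \<beta>0 * (\<Prod>j\<in>{..<n} - {i}. (v - y ! j) powi b0 j) * (v - u0) powi e0"
        using shape[OF y i nV(1)] unfolding V_def by blast
      obtain \<beta>1 b1 e1 where fb1: "\<And>v. v \<in> V \<Longrightarrow> v \<noteq> u1 \<Longrightarrow> f (y[i := v] @ [u1]) =
          \<beta>1 * (\<Prod>j\<in>{..<n} - {i}. (v - y ! j) powi b1 j) * (v - u1) powi e1"
        using shape[OF y i nV(2)] unfolding V_def by blast
      define q where "q = y[i := u0] @ [u1]"
      have q: "q ! n = u1" "q ! i = u0" "\<And>k. k < n \<Longrightarrow> k \<noteq> i \<Longrightarrow> q ! k = y ! k" "length q = Suc n"
        using len i by (auto simp: q_def nth_append)
      have "distinct q"
        using u V y i unfolding q_def
        by (auto simp: PConf_def V_def in_set_conv_nth nth_list_update split: if_splits)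
      then have injq: "inj_on ((!) q) {..<Suc n}"
        using q(4) by (simp add: inj_on_nth)
      define s where "s = (-1 :: complex) powi \<alpha> i"
      \<comment> \<open>exponents of the two sides of \<open>ratio\<close> at the points of \<open>q\<close>\<close>
      define x1 where "x1 = (\<lambda>k. if k = n then e1 else if k = i then \<alpha> i else b1 k)"
      define x0 where "x0 = (\<lambda>k. if k = n then \<alpha> i else if k = i then e0 else b0 k)"
      have R: "(\<Prod>k<Suc n. (v - q ! k) powi x k) =
          (v - u1) powi x n * ((v - u0) powi x i * (\<Prod>k\<in>{..<n} - {i}. (v - y ! k) powi x k))" for v x
        unfolding prod_lessThan_Suc_remove[OF i] using q by simp
      have L1: "f (y[i := v] @ [u1]) * P u0 v =
          (\<beta>1 * Q u0 * s) * (\<Prod>k<Suc n. (v - q ! k) powi x1 k)"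
        if "v \<in> V" "v \<noteq> u0" "v \<noteq> u1" for v
      proof -
        have "(\<Prod>k\<in>{..<n} - {i}. (v - y ! k) powi x1 k) = (\<Prod>k\<in>{..<n} - {i}. (v - y ! k) powi b1 k)"
          by (rule prod.cong) (auto simp: x1_def)
        then have R': "(\<Prod>k<Suc n. (v - q ! k) powi x1 k) =
            (v - u1) powi e1 * ((v - u0) powi \<alpha> i * (\<Prod>k\<in>{..<n} - {i}. (v - y ! k) powi b1 k))"
          using i unfolding R by (simp add: x1_def)
        have "f (y[i := v] @ [u1]) = \<beta>1 *
            (\<Prod>j\<in>{..<n} - {i}. (v - y ! j) powi b1 j) * (v - u1) powi e1"
          using fb1[OF that(1,3)] .
        moreover have "(u0 - v) powi \<alpha> i = s * (v - u0) powi \<alpha> i"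
          unfolding s_def by (rule power_int_diff_flip)
        ultimately show ?thesis
          unfolding R' PQ by simp
      qed
      have L0: "f (y[i := v] @ [u0]) * P u1 v =
          (\<beta>0 * Q u1 * s) * (\<Prod>k<Suc n. (v - q ! k) powi x0 k)"
        if "v \<in> V" "v \<noteq> u0" "v \<noteq> u1" for v
      proof -
        have "(\<Prod>k\<in>{..<n} - {i}. (v - y ! k) powi x0 k) = (\<Prod>k\<in>{..<n} - {i}. (v - y ! k) powi b0 k)"
          by (rule prod.cong) (auto simp: x0_def)
        then have R': "(\<Prod>k<Suc n. (v - q ! k) powi x0 k) =
            (v - u1) powi \<alpha> i * ((v - u0) powi e0 * (\<Prod>k\<in>{..<n} - {i}. (v - y ! k) powi b0 k))"
          using i unfolding R by (simp add: x0_def)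
        have "f (y[i := v] @ [u0]) = \<beta>0 *
            (\<Prod>j\<in>{..<n} - {i}. (v - y ! j) powi b0 j) * (v - u0) powi e0"
          using fb0[OF that(1,2)] .
        moreover have "(u1 - v) powi \<alpha> i = s * (v - u1) powi \<alpha> i"
          unfolding s_def by (rule power_int_diff_flip)
        ultimately show ?thesis
          unfolding R' PQ by simp
      qed
      have fresh: "u \<notin> set (y[i := v])" if "u \<in> V" "v \<noteq> u" for u v
        using that V i len by (auto simp: in_set_conv_nth nth_list_update split: if_splits)
      have eqZ: "(\<beta>1 * Q u0 * s) * (\<Prod>k<Suc n. (v - q ! k) powi x1 k) =
          (\<beta>0 * Q u1 * s) * (\<Prod>k<Suc n. (v - q ! k) powi x0 k)"
        if "v \<in> Z" "v \<notin> (!) q ` {..<Suc n}" for v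
      proof -
        have vn: "v \<noteq> u0" "v \<noteq> u1" "v \<in> V"
          using that q i Z(2) by (auto simp: image_iff)
        have "f (y[i := v] @ [u]) = C (y[i := v]) * P u v" if "u \<in> V" "v \<noteq> u" for u
          using CA[of "y[i := v]" u] fresh[OF that] vn Z(3)[OF \<open>v \<in> Z\<close>]
          by (simp add: P_def V_def)
        then have "f (y[i := v] @ [u1]) * P u0 v = f (y[i := v] @ [u0]) * P u1 v"
          using u vn by simp
        then show ?thesis
          unfolding L1[OF vn(3,1,2)] L0[OF vn(3,1,2)] .
      qed
      have ne: "\<beta>0 * Q u1 * s \<noteq> 0"
        using \<beta>0 u V by (auto simp: Q_def s_def)
      note U = power_product_unique[OF finite_lessThan injq Z(1) ne eqZ]
      have c: "\<beta>1 * Q u0 * s = \<beta>0 * Q u1 * s"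
        by (rule U(1))
      have x: "x1 k = x0 k" if "k < Suc n" for k
        by (rule U(2)) (use that in simp_all)
      have "(\<Prod>k<Suc n. (v - q ! k) powi x1 k) = (\<Prod>k<Suc n. (v - q ! k) powi x0 k)"
        by (rule prod.cong) (auto simp: x)
      then show ?thesis
        unfolding L1[OF v] L0[OF v] c by (rule arg_cong)
    qed
    \<comment> \<open>compare both sides of \<open>ratio\<close> as functions of \<open>u\<close>\<close>
    have const: "A (y[i := v]) k = \<alpha> k" if v: "v \<in> V" and k: "k < n" for v k
    proof -
      have yv: "y[i := v] \<in> PConf n" "length (y[i := v]) = n" using v len by (auto simp: V_def)
      obtain u0 where u0: "u0 \<notin> insert v (set y)"
        using ex_new_if_finite[OF infinite_UNIV_char_0, of "insert v (set y)"] by auto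
      then have u0V: "u0 \<in> V" using V len by auto
      have inj: "inj_on ((!) (y[i := v])) {..<n}"
        using yv by (auto simp: PConf_def inj_on_nth)
      have inf: "infinite (V - {u0, v})"
        using \<open>uncountable V\<close> by (metis countable_finite finite.emptyI finite_insert uncountable_minus_countable)
      have P0: "P u0 v \<noteq> 0"
        using u0V u0 V by (auto simp: PQ Q_def)
      have f0: "f (y[i := v] @ [u0]) \<noteq> 0"
        using Suc.prems(2) PConf_snoc yv u0 len i
        by (auto simp: in_set_conv_nth nth_list_update split: if_splits)
      have "C (y[i := v]) * (\<Prod>j<n. (u - y[i := v] ! j) powi A (y[i := v]) j) =
          f (y[i := v] @ [u0]) / P u0 v * (\<Prod>j<n. (u - y[i := v] ! j) powi \<alpha> j)"
        if "u \<in> V - {u0, v}" "u \<notin> (!) (y[i := v]) ` {..<n}" for u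
      proof -
        have "u \<notin> set (y[i := v])"
          using that yv(2) by (auto simp: in_set_conv_nth)
        then have "f (y[i := v] @ [u]) = C (y[i := v]) * (\<Prod>j<n. (u - y[i := v] ! j) powi A (y[i := v]) j)"
          by (rule CA[OF yv(1)])
        then show ?thesis
          using ratio[of u0 u v] that u0V v u0 P0 by (auto simp: P_def field_simps)
      qed
      note eqV = this
      have ne: "f (y[i := v] @ [u0]) / P u0 v \<noteq> 0"
        using f0 P0 by simp
      show ?thesis
        by (rule power_product_unique(2)[OF finite_lessThan inj inf ne eqV]) (use k in simp_all)
    qed
    have "y ! i \<in> V" using y len i by (simp add: V_def)
    then show ?thesis
      using const[of v j] const[of "y ! i" j] j yv by (simp add: V_def)
  qed
  obtain y0 where y0: "y0 \<in> PConf n"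
    using ex_distinct_avoiding[of "{}" n] by auto
  define \<alpha> where "\<alpha> = A y0"
  have A: "A y j = \<alpha> j" if "y \<in> PConf n" "j < n" for y j
    unfolding \<alpha>_def using PConf_moves_connect[of n "\<lambda>y. A y j", OF _ that(1) y0] A_move that(2)
    by blast
  have "separately_monomial n C"
    unfolding separately_monomial_def
  proof (intro ballI allI impI)
    fix y i assume y: "y \<in> PConf n" and i: "i < n"
    have len: "length y = n" using y by (simp add: PConf_def)
    define V where "V = {v. y[i := v] \<in> PConf n}"
    have V: "v \<in> V \<longleftrightarrow> (\<forall>j<n. j \<noteq> i \<longrightarrow> v \<noteq> y ! j)" for v
      using PConf_update[OF y i] by (simp add: V_def)
    obtain u0 where u0: "u0 \<notin> set y"
      using ex_new_if_finite[OF infinite_UNIV_char_0, of "set y"] by auto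
    obtain u1 where u1: "u1 \<notin> insert u0 (set y)"
      using ex_new_if_finite[OF infinite_UNIV_char_0, of "insert u0 (set y)"] by auto
    have uV: "u0 \<in> V" "u1 \<in> V" using V len u0 u1 by auto
    define Q where "Q = (\<lambda>u. (\<Prod>j\<in>{..<n} - {i}. (u - y ! j) powi \<alpha> j))"
    define s where "s = (-1 :: complex) powi \<alpha> i"
    have Q0: "Q u * s \<noteq> 0" if "u \<in> V" for u
      using that V by (auto simp: Q_def s_def)
    have Cshape: "\<exists>\<gamma> b d. \<gamma> \<noteq> 0 \<and> (\<forall>v\<in>V. v \<noteq> u \<longrightarrow>
        C (y[i := v]) = \<gamma> * (\<Prod>j\<in>{..<n} - {i}. (v - y ! j) powi b j) * (v - u) powi d)"
      if u: "u \<in> V" for u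
    proof -
      have nV: "\<forall>j<n. j \<noteq> i \<longrightarrow> u \<noteq> y ! j" using u V by auto
      obtain \<beta> b e where \<beta>: "\<beta> \<noteq> 0" and fb: "\<And>v. v \<in> V \<Longrightarrow> v \<noteq> u \<Longrightarrow> f (y[i := v] @ [u]) =
          \<beta> * (\<Prod>j\<in>{..<n} - {i}. (v - y ! j) powi b j) * (v - u) powi e"
        using shape[OF y i nV] unfolding V_def by blast
      have "C (y[i := v]) = \<beta> / (Q u * s) * (\<Prod>j\<in>{..<n} - {i}. (v - y ! j) powi b j) * (v - u) powi (e - \<alpha> i)"
        if "v \<in> V" "v \<noteq> u" for v
      proof -
        have yv: "y[i := v] \<in> PConf n" using that by (simp add: V_def)
        have "u \<notin> set (y[i := v])"
          using that u V i len by (auto simp: in_set_conv_nth nth_list_update split: if_splits)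
        then have "f (y[i := v] @ [u]) = C (y[i := v]) * (\<Prod>j<n. (u - y[i := v] ! j) powi \<alpha> j)"
          using CA[OF yv] A[OF yv] by simp
        also have "(\<Prod>j<n. (u - y[i := v] ! j) powi \<alpha> j) =
            (u - y[i := v] ! i) powi \<alpha> i * (\<Prod>j\<in>{..<n} - {i}. (u - y[i := v] ! j) powi \<alpha> j)"
          using i by (subst prod.remove[of _ i]) auto
        also have "(\<Prod>j\<in>{..<n} - {i}. (u - y[i := v] ! j) powi \<alpha> j) = Q u"
          unfolding Q_def by (rule prod.cong) auto
        also have "(u - y[i := v] ! i) powi \<alpha> i = s * (v - u) powi \<alpha> i"
          using i len power_int_diff_flip[of u v "\<alpha> i"] by (simp add: s_def)
        finally have 1: "f (y[i := v] @ [u]) = C (y[i := v]) * (s * (v - u) powi \<alpha> i * Q u)" .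
        have 2: "f (y[i := v] @ [u]) = \<beta> *
              (\<Prod>j\<in>{..<n} - {i}. (v - y ! j) powi b j) * (v - u) powi e"
          using fb[OF that] .
        have 3: "(v - u) powi (e - \<alpha> i) = (v - u) powi e / (v - u) powi \<alpha> i"
          using that by (intro power_int_diff) auto
        have "(v - u) powi \<alpha> i \<noteq> 0" using that by simp
        with Q0[OF u] show ?thesis
          using 1 2 that(2) unfolding 3 by (simp add: field_simps)
      qed
      then show ?thesis
        using \<beta> Q0[OF u] by (intro exI[of _ "\<beta> / (Q u * s)"]) auto
    qed
    obtain \<gamma>0 b0 d0 where \<gamma>0: "\<gamma>0 \<noteq> 0" and C0: "\<And>v. v \<in> V \<Longrightarrow> v \<noteq> u0 \<Longrightarrow>
        C (y[i := v]) = \<gamma>0 * (\<Prod>j\<in>{..<n} - {i}. (v - y ! j) powi b0 j) * (v - u0) powi d0"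
      using Cshape[OF uV(1)] by blast
    obtain \<gamma>1 b1 d1 where \<gamma>1: "\<gamma>1 \<noteq> 0" and C1: "\<And>v. v \<in> V \<Longrightarrow> v \<noteq> u1 \<Longrightarrow>
        C (y[i := v]) = \<gamma>1 * (\<Prod>j\<in>{..<n} - {i}. (v - y ! j) powi b1 j) * (v - u1) powi d1"
      using Cshape[OF uV(2)] by blast
    define q where "q = y[i := u0] @ [u1]"
    have q: "q ! n = u1" "q ! i = u0" "\<And>k. k < n \<Longrightarrow> k \<noteq> i \<Longrightarrow> q ! k = y ! k" "length q = Suc n"
      using len i by (auto simp: q_def nth_append)
    have "distinct q"
      using u0 u1 uV V y i unfolding q_def
      by (auto simp: PConf_def V_def in_set_conv_nth nth_list_update split: if_splits)
    then have injq: "inj_on ((!) q) {..<Suc n}"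
      using q(4) by (simp add: inj_on_nth)
    \<comment> \<open>two fixed last coordinates give two formulas for \<open>C\<close>; each shows that the factor in the other is trivial\<close>
    define x0 where "x0 = (\<lambda>k. if k = n then 0 else if k = i then d0 else b0 k)"
    define x1 where "x1 = (\<lambda>k. if k = n then d1 else if k = i then 0 else b1 k)"
    have R: "(\<Prod>k<Suc n. (v - q ! k) powi x k) =
        (v - u1) powi x n * ((v - u0) powi x i * (\<Prod>k\<in>{..<n} - {i}. (v - y ! k) powi x k))" for v x
      unfolding prod_lessThan_Suc_remove[OF i] using q by simp
    have "(\<Prod>k\<in>{..<n} - {i}. (v - y ! k) powi x0 k) = (\<Prod>k\<in>{..<n} - {i}. (v - y ! k) powi b0 k)" for v
      by (rule prod.cong) (auto simp: x0_def)
    then have R0: "(\<Prod>k<Suc n. (v - q ! k) powi x0 k) =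
        (\<Prod>k\<in>{..<n} - {i}. (v - y ! k) powi b0 k) * (v - u0) powi d0" for v
      using i unfolding R by (simp add: x0_def)
    have "(\<Prod>k\<in>{..<n} - {i}. (v - y ! k) powi x1 k) = (\<Prod>k\<in>{..<n} - {i}. (v - y ! k) powi b1 k)" for v
      by (rule prod.cong) (auto simp: x1_def)
    then have R1: "(\<Prod>k<Suc n. (v - q ! k) powi x1 k) =
        (\<Prod>k\<in>{..<n} - {i}. (v - y ! k) powi b1 k) * (v - u1) powi d1" for v
      using i unfolding R by (simp add: x1_def)
    have eqZ: "\<gamma>0 * (\<Prod>k<Suc n. (v - q ! k) powi x0 k) = \<gamma>1 * (\<Prod>k<Suc n. (v - q ! k) powi x1 k)"
      if "v \<in> UNIV" "v \<notin> (!) q ` {..<Suc n}" for v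
    proof -
      have nq: "v \<noteq> q ! k" if "k < Suc n" for k
        using that \<open>v \<notin> _\<close> by blast
      have vn: "v \<noteq> u0" "v \<noteq> u1"
        using nq[of i] nq[of n] q i by auto
      have vV: "v \<in> V"
        unfolding V using nq q by (metis less_SucI)
      show ?thesis
        using C0[OF vV vn(1)] C1[OF vV vn(2)] unfolding R0 R1 by (simp only: mult.assoc)
    qed
   note U = power_product_unique[OF finite_lessThan injq infinite_UNIV_char_0 \<gamma>1 eqZ]
    have g: "\<gamma>0 = \<gamma>1"
      by (rule U(1))
    have x: "x0 k = x1 k" if "k < Suc n" for k
      by (rule U(2)) (use that in simp_all)
    have e0: "d0 = 0" "d1 = 0"
      using x[of i] x[of n] i by (auto simp: x0_def x1_def)
    have bb: "b0 k = b1 k" if "k \<in> {..<n} - {i}" for k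
      using x[of k] that by (auto simp: x0_def x1_def)
    have "C (y[i := v]) = \<gamma>0 * (\<Prod>j\<in>{..<n} - {i}. (v - y ! j) powi b0 j)" if "v \<in> V" for v
    proof (cases "v = u0")
      case True
      then have "v \<noteq> u1" using u1 by auto
      moreover have "(\<Prod>j\<in>{..<n} - {i}. (v - y ! j) powi b0 j) = (\<Prod>j\<in>{..<n} - {i}. (v - y ! j) powi b1 j)"
        by (rule prod.cong) (auto simp: bb)
      ultimately show ?thesis
        using C1[OF that] e0 g by simp
    next
      case False
      then show ?thesis using C0[OF that] e0 by simp
    qed
    then show "\<exists>c a. c \<noteq> 0 \<and>
       (\<forall>v. y[i := v] \<in> PConf n \<longrightarrow> C (y[i := v]) = c * (\<Prod>j\<in>{..<n} - {i}. (v - y ! j) powi a j))"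
      using \<gamma>0 unfolding V_def by blast
  qed
  then obtain c a where c: "c \<noteq> 0"
    and Cprod: "\<And>y. y \<in> PConf n \<Longrightarrow> C y = c * (\<Prod>i<n. \<Prod>j<i. (y ! i - y ! j) powi a i j)"
    using Suc.IH Cnz by blast
  define a' where "a' = (\<lambda>i j. if i = n then \<alpha> j else a i j)"
  have "f x = c * (\<Prod>i<Suc n. \<Prod>j<i. (x ! i - x ! j) powi a' i j)" if x: "x \<in> PConf (Suc n)" for x
  proof -
    obtain y z where yz: "x = y @ [z]"
      using x by (cases x rule: rev_cases) (auto simp: PConf_def)
    then have y: "y \<in> PConf n" "z \<notin> set y" "length y = n"
      using x PConf_snoc by (auto simp: PConf_def)
    have "(\<Prod>i<n. \<Prod>j<i. (x ! i - x ! j) powi a' i j) = (\<Prod>i<n. \<Prod>j<i. (y ! i - y ! j) powi a i j)"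
      by (intro prod.cong refl) (auto simp: yz y nth_append a'_def)
    moreover have "(\<Prod>j<n. (x ! n - x ! j) powi a' n j) = (\<Prod>j<n. (z - y ! j) powi A y j)"
      by (intro prod.cong refl) (auto simp: yz y nth_append a'_def A)
    ultimately show ?thesis
      using CA[OF y(1,2)] Cprod[OF y(1)] by (simp add: yz)
  qed
  then show ?case using c by blast
qed

section \<open>Rules for holomorphic functions on configurations\<close>

text \<open>
  Complex-valued, like the functions that are compared with it in Landau symbols.
\<close>

definition coord_dist :: "nat \<Rightarrow> complex list \<Rightarrow> complex list \<Rightarrow> complex" where
  "coord_dist n x y = complex_of_real (\<Sum>i<n. cmod (y ! i - x ! i))"

text \<open>
  With this filter the definition of holomorphy becomes a statement about little-o, and the algebra of
  Landau symbols proves the product and quotient rules.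
\<close>

definition at_conf :: "nat \<Rightarrow> complex list \<Rightarrow> complex list filter" where
  "at_conf n x = inf (filtercomap (coord_dist n x) (nhds 0)) (principal (PConf n))"

lemma cmod_coord_dist [simp]: "cmod (coord_dist n x y) = (\<Sum>i<n. cmod (y ! i - x ! i))"
  unfolding coord_dist_def norm_of_real by (simp add: sum_nonneg)

lemma eventually_at_conf:
  "eventually P (at_conf n x) \<longleftrightarrow>
     (\<exists>d>0. \<forall>y\<in>PConf n. (\<Sum>i<n. cmod (y ! i - x ! i)) < d \<longrightarrow> P y)"
proof -
  have "eventually P (at_conf n x) \<longleftrightarrow>
      (\<exists>Q. eventually Q (nhds 0) \<and> (\<forall>y. Q (coord_dist n x y) \<longrightarrow> y \<in> PConf n \<longrightarrow> P y))"
    by (simp add: at_conf_def eventually_inf_principal eventually_filtercomap)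
  also have "\<dots> \<longleftrightarrow> (\<exists>d>0. \<forall>y\<in>PConf n. (\<Sum>i<n. cmod (y ! i - x ! i)) < d \<longrightarrow> P y)"
  proof safe
    fix Q assume "eventually Q (nhds (0::complex))" and Q: "\<forall>y. Q (coord_dist n x y) \<longrightarrow> y \<in> PConf n \<longrightarrow> P y"
    then obtain d where "d > 0" "\<And>z. cmod z < d \<Longrightarrow> Q z"
      by (auto simp: eventually_nhds_metric)
    then show "\<exists>d>0. \<forall>y\<in>PConf n. (\<Sum>i<n. cmod (y ! i - x ! i)) < d \<longrightarrow> P y"
      using Q by (metis cmod_coord_dist)
  next
    fix d :: real assume d: "d > 0" "\<forall>y\<in>PConf n. (\<Sum>i<n. cmod (y ! i - x ! i)) < d \<longrightarrow> P y"
    then have "eventually (\<lambda>z. cmod z < d) (nhds (0::complex))"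
      by (auto simp: eventually_nhds_metric)
    then show "\<exists>Q. eventually Q (nhds 0) \<and> (\<forall>y. Q (coord_dist n x y) \<longrightarrow> y \<in> PConf n \<longrightarrow> P y)"
      using d by (intro exI[of _ "\<lambda>z. cmod z < d"]) auto
  qed
  finally show ?thesis .
qed

lemma holomorphic_fun_iff_smallo:
  "holomorphic_fun n f \<longleftrightarrow> (\<forall>x\<in>PConf n. \<exists>c.
     (\<lambda>y. f y - f x - (\<Sum>i<n. c i * (y ! i - x ! i))) \<in> o[at_conf n x](coord_dist n x))"
  by (simp add: holomorphic_fun_def smallo_def eventually_at_conf)

lemma linear_bigo: "(\<lambda>y. \<Sum>i<n. c i * (y ! i - x ! i)) \<in> O[at_conf n x](coord_dist n x)"
proof (rule bigoI[of _ "\<Sum>i<n. cmod (c i)"], rule always_eventually, rule allI)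
  fix y
  have "cmod (\<Sum>i<n. c i * (y ! i - x ! i)) \<le> (\<Sum>i<n. cmod (c i) * cmod (y ! i - x ! i))"
    by (rule order_trans[OF norm_sum]) (simp add: norm_mult)
  also have "\<dots> \<le> (\<Sum>i<n. cmod (c i) * (\<Sum>i<n. cmod (y ! i - x ! i)))"
    by (intro sum_mono mult_left_mono member_le_sum) auto
  finally show "cmod (\<Sum>i<n. c i * (y ! i - x ! i)) \<le> (\<Sum>i<n. cmod (c i)) * cmod (coord_dist n x y)"
    by (simp add: sum_distrib_right)
qed

lemma coord_dist_tendsto_0: "(coord_dist n x \<longlongrightarrow> 0) (at_conf n x)"
  unfolding at_conf_def by (rule tendsto_mono[OF inf_le1]) (rule filterlim_filtercomap)

lemma increment_bigo:
  assumes "(\<lambda>y. f y - f x - (\<Sum>i<n. c i * (y ! i - x ! i))) \<in> o[at_conf n x](coord_dist n x)"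
  shows "(\<lambda>y. f y - f x) \<in> O[at_conf n x](coord_dist n x)"
    and "(\<lambda>y. f y - f x) \<in> o[at_conf n x](\<lambda>_. 1)"
proof -
  have "(\<lambda>y. (f y - f x - (\<Sum>i<n. c i * (y ! i - x ! i))) + (\<Sum>i<n. c i * (y ! i - x ! i)))
      \<in> O[at_conf n x](coord_dist n x)"
    by (intro sum_in_bigo linear_bigo landau_o.small_imp_big assms)
  then show *: "(\<lambda>y. f y - f x) \<in> O[at_conf n x](coord_dist n x)" by simp
  have "coord_dist n x \<in> o[at_conf n x](\<lambda>_. 1)"
    using coord_dist_tendsto_0 by (intro smalloI_tendsto) auto
  with * show "(\<lambda>y. f y - f x) \<in> o[at_conf n x](\<lambda>_. 1)"
    by (rule landau_o.big_small_trans)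
qed

lemma holomorphic_fun_const: "holomorphic_fun n (\<lambda>_. k)"
  unfolding holomorphic_fun_iff_smallo by (intro ballI exI[of _ "\<lambda>_. 0"]) simp

lemma holomorphic_fun_nth:
  assumes "i < n"
  shows "holomorphic_fun n (\<lambda>x. x ! i)"
  unfolding holomorphic_fun_iff_smallo
proof (intro ballI exI[of _ "\<lambda>j. if j = i then 1 else 0"])
  fix x
  have "(\<Sum>j<n. (if j = i then 1 else 0) * (y ! j - x ! j)) = y ! i - x ! i" for y :: "complex list"
    using assms by (simp add: if_distrib[of "\<lambda>c. c * _"] sum.delta cong: if_cong)
  then show "(\<lambda>y. y ! i - x ! i - (\<Sum>j<n. (if j = i then 1 else 0) * (y ! j - x ! j)))
      \<in> o[at_conf n x](coord_dist n x)"
    by simp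
qed

lemma holomorphic_fun_add:
  assumes "holomorphic_fun n f" "holomorphic_fun n g"
  shows "holomorphic_fun n (\<lambda>x. f x + g x)"
  unfolding holomorphic_fun_iff_smallo
proof
  fix x assume x: "x \<in> PConf n"
  obtain c where c: "(\<lambda>y. f y - f x - (\<Sum>i<n. c i * (y ! i - x ! i))) \<in> o[at_conf n x](coord_dist n x)"
    using assms(1) x unfolding holomorphic_fun_iff_smallo by blast
  obtain d where d: "(\<lambda>y. g y - g x - (\<Sum>i<n. d i * (y ! i - x ! i))) \<in> o[at_conf n x](coord_dist n x)"
    using assms(2) x unfolding holomorphic_fun_iff_smallo by blast
  have "(\<lambda>y. (f y + g y) - (f x + g x) - (\<Sum>i<n. (c i + d i) * (y ! i - x ! i)))
      \<in> o[at_conf n x](coord_dist n x)"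
  proof -
    have "(\<Sum>i<n. (c i + d i) * (y ! i - x ! i)) =
        (\<Sum>i<n. c i * (y ! i - x ! i)) + (\<Sum>i<n. d i * (y ! i - x ! i))" for y
      by (simp add: sum.distrib distrib_right)
    then show ?thesis
      using sum_in_smallo(1)[OF c d] by (simp add: add_ac diff_diff_eq diff_add_eq add_diff_eq)
  qed
  then show "\<exists>c. (\<lambda>y. (f y + g y) - (f x + g x) - (\<Sum>i<n. c i * (y ! i - x ! i)))
      \<in> o[at_conf n x](coord_dist n x)" by (rule exI[of _ "\<lambda>i. c i + d i"])
qed

lemma holomorphic_fun_mult:
  assumes "holomorphic_fun n f" "holomorphic_fun n g"
  shows "holomorphic_fun n (\<lambda>x. f x * g x)"
  unfolding holomorphic_fun_iff_smallo
proof
  fix x assume x: "x \<in> PConf n"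
  obtain c where c: "(\<lambda>y. f y - f x - (\<Sum>i<n. c i * (y ! i - x ! i))) \<in> o[at_conf n x](coord_dist n x)"
    using assms(1) x unfolding holomorphic_fun_iff_smallo by blast
  obtain d where d: "(\<lambda>y. g y - g x - (\<Sum>i<n. d i * (y ! i - x ! i))) \<in> o[at_conf n x](coord_dist n x)"
    using assms(2) x unfolding holomorphic_fun_iff_smallo by blast
  let ?L = "\<lambda>c y. \<Sum>i<n. c i * (y ! i - x ! i)"
  have "(\<lambda>y. g x * (f y - f x - ?L c y)) \<in> o[at_conf n x](coord_dist n x)"
    using c by (cases "g x = 0") simp_all
  moreover have "(\<lambda>y. f x * (g y - g x - ?L d y)) \<in> o[at_conf n x](coord_dist n x)"
    using d by (cases "f x = 0") simp_all
  moreover have "(\<lambda>y. (f y - f x) * (g y - g x)) \<in> o[at_conf n x](coord_dist n x)"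
    using landau_o.big_small_mult[OF increment_bigo(1)[of f, OF c] increment_bigo(2)[of g, OF d]] by simp
  ultimately have "(\<lambda>y. g x * (f y - f x - ?L c y) + f x * (g y - g x - ?L d y) + (f y - f x) * (g y - g x))
      \<in> o[at_conf n x](coord_dist n x)"
    by (intro sum_in_smallo)
  moreover have "g x * (f y - f x - ?L c y) + f x * (g y - g x - ?L d y) + (f y - f x) * (g y - g x) =
      f y * g y - f x * g x - ?L (\<lambda>i. g x * c i + f x * d i) y" for y
  proof -
    have "?L (\<lambda>i. g x * c i + f x * d i) y = g x * ?L c y + f x * ?L d y"
      by (simp add: sum_distrib_left sum.distrib[symmetric] algebra_simps)
    then show ?thesis by (simp add: algebra_simps)
  qed
  ultimately show "\<exists>c. (\<lambda>y. f y * g y - f x * g x - ?L c y) \<in> o[at_conf n x](coord_dist n x)"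
    by (intro exI[of _ "\<lambda>i. g x * c i + f x * d i"]) simp
qed

lemma holomorphic_fun_inverse:
  assumes "holomorphic_fun n f" and nz: "\<And>x. x \<in> PConf n \<Longrightarrow> f x \<noteq> 0"
  shows "holomorphic_fun n (\<lambda>x. inverse (f x))"
  unfolding holomorphic_fun_iff_smallo
proof
  fix x assume x: "x \<in> PConf n"
  obtain c where c: "(\<lambda>y. f y - f x - (\<Sum>i<n. c i * (y ! i - x ! i))) \<in> o[at_conf n x](coord_dist n x)"
    using assms(1) x unfolding holomorphic_fun_iff_smallo by blast
  let ?L = "\<lambda>c y. \<Sum>i<n. c i * (y ! i - x ! i)"
  have fx: "f x \<noteq> 0" using nz x by blast
  have small: "(\<lambda>y. f y - f x) \<in> o[at_conf n x](\<lambda>_. 1)"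
    by (rule increment_bigo(2)[OF c])
  then have "((\<lambda>y. f y - f x) \<longlongrightarrow> 0) (at_conf n x)"
    using smalloD_tendsto by fastforce
  then have "((\<lambda>y. f y - f x + f x) \<longlongrightarrow> 0 + f x) (at_conf n x)"
    by (intro tendsto_add tendsto_const)
  then have "((\<lambda>y. inverse (f y)) \<longlongrightarrow> inverse (f x)) (at_conf n x)"
    using fx by (intro tendsto_inverse) auto
  then have big: "(\<lambda>y. inverse (f y)) \<in> O[at_conf n x](\<lambda>_. 1)"
    by (intro bigoI_tendsto[of _ _ "inverse (f x)"]) auto
  have "(\<lambda>y. ?L c y * (f y - f x)) \<in> o[at_conf n x](\<lambda>y. coord_dist n x y * 1)"
    by (intro landau_o.big_small_mult linear_bigo small)
  moreover have "(\<lambda>y. f x * (f y - f x - ?L c y)) \<in> o[at_conf n x](\<lambda>y. coord_dist n x y * 1)"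
    using c fx by simp
  ultimately have "(\<lambda>y. ?L c y * (f y - f x) - f x * (f y - f x - ?L c y)) \<in> o[at_conf n x](coord_dist n x)"
    using sum_in_smallo(2) by fastforce
  then have "(\<lambda>y. (?L c y * (f y - f x) - f x * (f y - f x - ?L c y)) * inverse (f y)) \<in> o[at_conf n x](\<lambda>y. coord_dist n x y * 1)"
    using big by (rule landau_o.small_big_mult)
  then have "(\<lambda>y. inverse (f x ^ 2) * ((?L c y * (f y - f x) - f x * (f y - f x - ?L c y)) * inverse (f y)))
      \<in> o[at_conf n x](coord_dist n x)"
    using fx by simp
  moreover have "eventually (\<lambda>y. inverse (f x ^ 2) * ((?L c y * (f y - f x) - f x * (f y - f x - ?L c y)) * inverse (f y))
      = inverse (f y) - inverse (f x) - ?L (\<lambda>i. - c i / f x ^ 2) y) (at_conf n x)"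
    unfolding eventually_at_conf
  proof (intro exI[of _ 1] conjI ballI impI)
    fix y assume "y \<in> PConf n"
    then have fy: "f y \<noteq> 0" using nz by blast
    have e: "?L (\<lambda>i. - c i / f x ^ 2) y = - ?L c y / f x ^ 2"
      by (simp add: sum_divide_distrib sum_negf)
    have "inverse (a ^ 2) * ((l * (b - a) - a * (b - a - l)) * inverse b) =
        inverse b - inverse a - (- l / a ^ 2)" if "a \<noteq> 0" "b \<noteq> 0" for a b l :: complex
      using that by (simp add: field_simps power2_eq_square)
    from this[OF fx fy] show "inverse (f x ^ 2) * ((?L c y * (f y - f x) - f x * (f y - f x - ?L c y)) * inverse (f y))
      = inverse (f y) - inverse (f x) - ?L (\<lambda>i. - c i / f x ^ 2) y"
      unfolding e .
  qed simp
  ultimately have "(\<lambda>y. inverse (f y) - inverse (f x) - ?L (\<lambda>i. - c i / f x ^ 2) y) \<in> o[at_conf n x](coord_dist n x)"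
    by (subst (asm) landau_o.small.in_cong) auto
  then show "\<exists>c. (\<lambda>y. inverse (f y) - inverse (f x) - ?L c y) \<in> o[at_conf n x](coord_dist n x)"
    by (rule exI[of _ "\<lambda>i. - c i / f x ^ 2"])
qed

lemma holomorphic_fun_diff:
  assumes "holomorphic_fun n f" "holomorphic_fun n g"
  shows "holomorphic_fun n (\<lambda>x. f x - g x)"
  using holomorphic_fun_add[OF assms(1) holomorphic_fun_mult[OF holomorphic_fun_const assms(2)], of "-1"]
  by simp

lemma holomorphic_fun_divide:
  assumes "holomorphic_fun n f" "holomorphic_fun n g" "\<And>x. x \<in> PConf n \<Longrightarrow> g x \<noteq> 0"
  shows "holomorphic_fun n (\<lambda>x. f x / g x)"
  using holomorphic_fun_mult[OF assms(1) holomorphic_fun_inverse[OF assms(2,3)]]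
  by (simp add: divide_inverse)

lemma holomorphic_fun_cong:
  assumes "\<And>x. x \<in> PConf n \<Longrightarrow> f x = g x"
  shows "holomorphic_fun n f \<longleftrightarrow> holomorphic_fun n g"
  using assms by (simp add: holomorphic_fun_def)

lemma holomorphic_fun_one_variable:
  assumes f: "holomorphic_fun n f" and x: "x \<in> PConf n" and i: "i < n"
  shows "(\<lambda>z. f (x[i := z])) holomorphic_on - ((!) x ` ({..<n} - {i}))"
proof -
  define U where "U = - ((!) x ` ({..<n} - {i}))"
  have opU: "open U"
    unfolding U_def by (intro open_Compl finite_imp_closed) auto
  have U: "z \<in> U \<longleftrightarrow> x[i := z] \<in> PConf n" for z
    unfolding PConf_update[OF x i] U_def by blast
  have len: "length x = n" using x by (simp add: PConf_def)
  have "\<exists>D. ((\<lambda>z. f (x[i := z])) has_field_derivative D) (at w)" if w: "w \<in> U" for w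
  proof -
    define x' where "x' = x[i := w]"
    have "x' \<in> PConf n" using w U by (simp add: x'_def)
    then obtain c where c: "\<And>e. e > 0 \<Longrightarrow> \<exists>d>0. \<forall>y\<in>PConf n.
        (\<Sum>i<n. cmod (y ! i - x' ! i)) < d \<longrightarrow>
        cmod (f y - f x' - (\<Sum>i<n. c i * (y ! i - x' ! i))) \<le> e * (\<Sum>i<n. cmod (y ! i - x' ! i))"
      using f unfolding holomorphic_fun_def by blast
    have ynth: "x[i := z] ! j - x' ! j = (if j = i then z - w else 0)" if "j < n" for z j
      using that len i by (auto simp: x'_def nth_list_update)
    have S1: "(\<Sum>j<n. cmod (x[i := z] ! j - x' ! j)) = cmod (z - w)" for z
    proof -
      have "(\<Sum>j<n. cmod (x[i := z] ! j - x' ! j)) = (\<Sum>j<n. if j = i then cmod (z - w) else 0)"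
        by (rule sum.cong) (auto simp: ynth)
      then show ?thesis using i by simp
    qed
    have S2: "(\<Sum>j<n. c j * (x[i := z] ! j - x' ! j)) = c i * (z - w)" for z
    proof -
      have "(\<Sum>j<n. c j * (x[i := z] ! j - x' ! j)) = (\<Sum>j<n. if j = i then c i * (z - w) else 0)"
        by (rule sum.cong) (auto simp: ynth)
      then show ?thesis using i by simp
    qed
    have "((\<lambda>z. (f (x[i := z]) - f x') / (z - w)) \<longlongrightarrow> c i) (at w)"
    proof (rule tendstoI)
      fix e :: real assume "e > 0"
      then obtain d where d: "d > 0" "\<And>z. z \<in> U \<Longrightarrow> cmod (z - w) < d \<Longrightarrow>
          cmod (f (x[i := z]) - f x' - c i * (z - w)) \<le> e / 2 * cmod (z - w)"
        using c[of "e / 2"] U S1 S2 by fastforce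
      have "eventually (\<lambda>z. z \<in> U \<inter> ball w d - {w}) (at w)"
        using opU w d by (intro eventually_at_in_open) auto
      then show "eventually (\<lambda>z. dist ((f (x[i := z]) - f x') / (z - w)) (c i) < e) (at w)"
      proof eventually_elim
        case (elim z)
        then have "z \<noteq> w" by auto
        then have "(f (x[i := z]) - f x') / (z - w) - c i = (f (x[i := z]) - f x' - c i * (z - w)) / (z - w)"
          by (simp add: field_simps)
        moreover have "cmod (f (x[i := z]) - f x' - c i * (z - w)) \<le> e / 2 * cmod (z - w)"
          using elim by (intro d) (auto simp: dist_norm norm_minus_commute)
        ultimately have "dist ((f (x[i := z]) - f x') / (z - w)) (c i) \<le> e / 2"
          using \<open>z \<noteq> w\<close> by (simp add: dist_norm norm_divide divide_le_eq)
        then show ?case using \<open>e > 0\<close> by simp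
      qed
    qed
    then show ?thesis
      unfolding has_field_derivative_iff x'_def by blast
  qed
  then show ?thesis
    using opU unfolding U_def[symmetric] holomorphic_on_open[OF opU] by blast
qed

section \<open>Polynomial identities and coloured graphs\<close>

text \<open>
  A substitute for polynomials in several variables: the functions whose restriction to every complex line
  is a polynomial. Restricting two nonzero such functions to a line through a point where the first and a point where
  the second does not vanish shows that their product is not identically zero.
\<close>

definition line_poly :: "((nat \<Rightarrow> complex) \<Rightarrow> complex) \<Rightarrow> bool" where
  "line_poly P \<longleftrightarrow> (\<forall>u v. \<exists>p. \<forall>t. P (\<lambda>i. u i + t * v i) = poly p t)"

lemma line_poly_const [intro]: "line_poly (\<lambda>_. c)"
  unfolding line_poly_def by (intro allI exI[of _ "[:c:]"]) simp

lemma line_poly_coord [intro]: "line_poly (\<lambda>x. x i)"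
  unfolding line_poly_def
proof (intro allI)
  fix u v :: "nat \<Rightarrow> complex"
  show "\<exists>p. \<forall>t. u i + t * v i = poly p t"
    by (rule exI[of _ "[:u i, v i:]"]) simp
qed

lemma line_poly_add [intro]: "line_poly P \<Longrightarrow> line_poly Q \<Longrightarrow> line_poly (\<lambda>x. P x + Q x)"
  unfolding line_poly_def by (metis poly_add)

lemma line_poly_diff [intro]: "line_poly P \<Longrightarrow> line_poly Q \<Longrightarrow> line_poly (\<lambda>x. P x - Q x)"
  unfolding line_poly_def by (metis poly_diff)

lemma line_poly_mult [intro]: "line_poly P \<Longrightarrow> line_poly Q \<Longrightarrow> line_poly (\<lambda>x. P x * Q x)"
  unfolding line_poly_def by (metis poly_mult)

lemma line_poly_power [intro]: "line_poly P \<Longrightarrow> line_poly (\<lambda>x. P x ^ k)"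
  by (induction k) auto

lemma line_poly_prod [intro]: "(\<And>e. e \<in> E \<Longrightarrow> line_poly (P e)) \<Longrightarrow> line_poly (\<lambda>x. \<Prod>e\<in>E. P e x)"
  by (induction E rule: infinite_finite_induct) auto

lemma line_poly_common_nonzero:
  assumes "line_poly P" "line_poly Q" "P u \<noteq> 0" "Q v \<noteq> 0"
  shows "\<exists>w. P w \<noteq> 0 \<and> Q w \<noteq> 0"
proof -
  obtain p where p: "\<And>t. P (\<lambda>i. u i + t * (v i - u i)) = poly p t"
    using assms(1) unfolding line_poly_def by (metis (no_types))
  obtain q where q: "\<And>t. Q (\<lambda>i. u i + t * (v i - u i)) = poly q t"
    using assms(2) unfolding line_poly_def by (metis (no_types))
  have "poly p 0 \<noteq> 0" "poly q 1 \<noteq> 0"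
    using p[of 0] q[of 1] assms by simp_all
  then have "p * q \<noteq> 0" by auto
  then have "finite {t. poly (p * q) t = 0}" by (rule poly_roots_finite)
  then obtain t where "poly (p * q) t \<noteq> 0"
    using ex_new_if_finite[OF infinite_UNIV_char_0] by blast
  then show ?thesis using p[of t] q[of t] by (metis mult_eq_0_iff poly_mult)
qed

lemma line_poly_family_common_nonzero:
  assumes "finite E" "\<And>e. e \<in> E \<Longrightarrow> line_poly (P e)" "\<And>e. e \<in> E \<Longrightarrow> \<exists>w. P e w \<noteq> 0"
  shows "\<exists>w. \<forall>e\<in>E. P e w \<noteq> 0"
proof -
  have "\<exists>w. (\<Prod>e\<in>E. P e w) \<noteq> 0"
    using assms
  proof (induction E rule: finite_induct)
    case (insert e E)
    obtain u where u: "P e u \<noteq> 0" using insert.prems by auto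
    obtain v where v: "(\<Prod>e\<in>E. P e v) \<noteq> 0" using insert.IH insert.prems by auto
    obtain w where "P e w \<noteq> 0" "(\<Prod>e\<in>E. P e w) \<noteq> 0"
      using line_poly_common_nonzero[of "P e" "\<lambda>x. \<Prod>e\<in>E. P e x" u v] insert.prems u v by blast
    then show ?case using insert.hyps by auto
  qed simp
  then show ?thesis using assms(1) by simp
qed

definition vandermonde :: "nat \<Rightarrow> (nat \<Rightarrow> complex) \<Rightarrow> complex" where
  "vandermonde n x = (\<Prod>i<n. \<Prod>j<i. x i - x j)"

lemma line_poly_vandermonde: "line_poly (vandermonde n)"
  unfolding vandermonde_def by (intro line_poly_prod line_poly_diff line_poly_coord)

lemma vandermonde_nonzero: "vandermonde n x \<noteq> 0 \<longleftrightarrow> inj_on x {..<n}"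
proof
  assume V: "vandermonde n x \<noteq> 0"
  have V': "x j \<noteq> x i" if "i < n" "j < i" for i j
  proof
    assume "x j = x i"
    then have "(\<Prod>j<i. x i - x j) = 0" using that by (intro prod_zero bexI[of _ j]) auto
    then have "\<exists>i\<in>{..<n}. (\<Prod>j<i. x i - x j) = 0"
      using that(1) by (intro bexI[of _ i]) simp_all
    then have "vandermonde n x = 0"
      unfolding vandermonde_def by (rule prod_zero[OF finite_lessThan])
    then show False using V by simp
  qed
  show "inj_on x {..<n}"
    using V' by (auto simp: inj_on_def) (metis linorder_neqE_nat)
next
  assume inj: "inj_on x {..<n}"
  have "x i \<noteq> x j" if "i < n" "j < i" for i j
    using inj_on_eq_iff[OF inj, of i j] that by auto
  then show "vandermonde n x \<noteq> 0"
    by (auto simp: vandermonde_def)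
qed

lemma vandermonde_of_nat: "vandermonde n of_nat \<noteq> 0"
  by (simp add: vandermonde_nonzero inj_on_def)

text \<open>
  Configurations of distinct points are dense: they are the non-zeros of the Vandermonde product.
\<close>

lemma line_poly_eq_0:
  assumes "line_poly P" "\<And>x. inj_on x {..<n} \<Longrightarrow> P x = 0"
  shows "P x = 0"
proof (rule ccontr)
  assume "P x \<noteq> 0"
  then obtain w where "P w \<noteq> 0" "vandermonde n w \<noteq> 0"
    using line_poly_common_nonzero[OF assms(1) line_poly_vandermonde _ vandermonde_of_nat] by blast
  then show False using assms(2) vandermonde_nonzero by blast
qed

lemma line_poly_disjunction:
  assumes "finite E" "\<And>e. e \<in> E \<Longrightarrow> line_poly (P e)"
    and "\<And>x. inj_on x {..<n} \<Longrightarrow> \<exists>e\<in>E. P e x = 0"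
  shows "\<exists>e\<in>E. \<forall>x. P e x = 0"
proof (rule ccontr)
  assume "\<not> ?thesis"
  then have "\<And>e. e \<in> E \<Longrightarrow> \<exists>w. P e w \<noteq> 0" by blast
  then obtain v where v: "(\<Prod>e\<in>E. P e v) \<noteq> 0"
    using line_poly_family_common_nonzero[of E P] assms(1,2) by auto
  obtain w where "(\<Prod>e\<in>E. P e w) \<noteq> 0" "vandermonde n w \<noteq> 0"
    using line_poly_common_nonzero[of "\<lambda>x. \<Prod>e\<in>E. P e x" "vandermonde n" v of_nat]
      line_poly_prod[of E P] line_poly_vandermonde v vandermonde_of_nat assms(2) by blast
  then show False using assms(1,3) vandermonde_nonzero by fastforce
qed

lemma third_colour:
  fixes c c' :: nat
  assumes "c < 3" "c' < 3" "c \<noteq> c'"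
  shows "3 - c - c' < 3 \<and> 3 - c - c' \<noteq> c \<and> 3 - c - c' \<noteq> c'"
  using assms by presburger

text \<open>
  \<open>E c i j\<close> says that the linear form \<open>x\<^sub>i - x\<^sub>j\<close> divides the \<open>c\<close>-th of three products of such forms
  with sum zero and without common factor. The axiom \<open>merge\<close> evaluates that relation at a point where exactly
  the coordinates with equal \<open>\<phi>\<close>-value coincide: if two of the products vanish there, so does the third,
  whose colour is \<open>3 - c - c'\<close>.
\<close>

locale coloured_edges =
  fixes E :: "nat \<Rightarrow> nat \<Rightarrow> nat \<Rightarrow> bool"
  assumes sym: "E c i j \<Longrightarrow> E c j i"
    and irrefl: "\<not> E c i i"
    and not_all: "\<exists>c<3. \<not> E c i j"
    and merge: "c < 3 \<Longrightarrow> c' < 3 \<Longrightarrow> c \<noteq> c' \<Longrightarrow>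
      E c i j \<Longrightarrow> \<phi> i = \<phi> j \<Longrightarrow> E c' k l \<Longrightarrow> \<phi> k = \<phi> l \<Longrightarrow>
      \<exists>u v. E (3 - c - c') u v \<and> \<phi> u = (\<phi> v :: nat)"
begin

lemma unique_colour:
  assumes "c < 3" "c' < 3" "E c i j" "E c' i j"
  shows "c = c'"
proof (rule ccontr)
  assume ne: "c \<noteq> c'"
  define \<phi> where "\<phi> = (\<lambda>v. if v = j then i else v)"
  have "\<phi> i = \<phi> j" by (simp add: \<phi>_def)
  then obtain u v where "E (3 - c - c') u v" "\<phi> u = \<phi> v"
    using merge assms ne by blast
  then have "E (3 - c - c') i j"
    using sym irrefl by (auto simp: \<phi>_def split: if_splits)
  moreover have "\<forall>d<3. d = c \<or> d = c' \<or> d = 3 - c - c'"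
    using assms ne by auto
  ultimately show False
    using not_all[of i j] assms by metis
qed

lemma disjoint_edges:
  assumes "c < 3" "c' < 3" "E c i j" "E c' k l" "i \<noteq> k" "i \<noteq> l" "j \<noteq> k" "j \<noteq> l"
  shows "c = c'"
proof (rule ccontr)
  assume ne: "c \<noteq> c'"
  define \<phi> where "\<phi> = (\<lambda>v. if v = j then i else if v = l then k else v)"
  have "\<phi> i = \<phi> j" "\<phi> k = \<phi> l" using assms by (auto simp: \<phi>_def)
  then obtain u v where "E (3 - c - c') u v" "\<phi> u = \<phi> v"
    using merge assms(1-4) ne by blast
  then have "E (3 - c - c') i j \<or> E (3 - c - c') k l"
    using sym irrefl assms by (auto simp: \<phi>_def split: if_splits)
  moreover have "3 - c - c' < 3" "3 - c - c' \<noteq> c" "3 - c - c' \<noteq> c'"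
    using third_colour[OF assms(1,2) ne] by auto
  ultimately show False
    using unique_colour assms by metis
qed

lemma triangle:
  assumes "c < 3" "c' < 3" "c \<noteq> c'" "E c i j" "E c' j k"
  shows "E (3 - c - c') i k"
proof -
  define \<phi> where "\<phi> = (\<lambda>v. if v = j \<or> v = k then i else v)"
  have "\<phi> i = \<phi> j" "\<phi> j = \<phi> k" by (auto simp: \<phi>_def)
  then obtain u v where uv: "E (3 - c - c') u v" "\<phi> u = \<phi> v"
    using merge assms by blast
  then have "E (3 - c - c') i j \<or> E (3 - c - c') j k \<or> E (3 - c - c') i k"
    using sym irrefl by (auto simp: \<phi>_def split: if_splits)
  moreover have "3 - c - c' < 3" "3 - c - c' \<noteq> c" "3 - c - c' \<noteq> c'"
    using third_colour[OF assms(1-3)] by auto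
  ultimately show ?thesis
    using unique_colour assms by metis
qed

lemma obtain_triangle:
  assumes "c < 3" "c' < 3" "c \<noteq> c'" "E c p q" "E c' r s"
  shows "\<exists>i j k. E 0 i j \<and> E 1 j k \<and> E 2 i k"
proof -
  have "\<exists>i j k. E c i j \<and> E c' j k"
    using assms disjoint_edges sym by metis
  then obtain i j k where e: "E c i j" "E c' j k" by blast
  then have "E (3 - c - c') i k" using triangle assms by blast
  moreover have "(c = 0 \<or> c = 1 \<or> c = 2) \<and> (c' = 0 \<or> c' = 1 \<or> c' = 2)"
    using assms by auto
  ultimately show ?thesis
    using e assms(3) sym by (elim conjE disjE) (simp_all, blast+)
qed

text \<open>
  A further vertex \<open>l\<close> is joined to \<open>i\<close>, \<open>j\<close>, \<open>k\<close> by edges whose colours are forced by the opposite edges of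
  the triangle, and if one of them is present then all are. Two such vertices would give disjoint edges of
  different colours, and an edge outside of the triangle is disjoint from two sides of different colours.
\<close>

lemma shape:
  assumes ij: "E 0 i j" and jk: "E 1 j k" and ik: "E 2 i k"
  shows "(\<forall>u v. (E 0 u v \<longleftrightarrow> {u, v} = {i, j}) \<and> (E 1 u v \<longleftrightarrow> {u, v} = {j, k}) \<and>
            (E 2 u v \<longleftrightarrow> {u, v} = {i, k})) \<or>
         (\<exists>l. l \<notin> {i, j, k} \<and> (\<forall>u v.
            (E 0 u v \<longleftrightarrow> {u, v} = {i, j} \<or> {u, v} = {k, l}) \<and>
            (E 1 u v \<longleftrightarrow> {u, v} = {j, k} \<or> {u, v} = {i, l}) \<and>
            (E 2 u v \<longleftrightarrow> {u, v} = {i, k} \<or> {u, v} = {j, l})))"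
proof -
  have d: "i \<noteq> j" "j \<noteq> k" "i \<noteq> k"
    using ij jk ik irrefl by auto
  have il: "c = 1" if "E c i l" "c < 3" "l \<notin> {i, j, k}" for c l
    using disjoint_edges[of c 1 i l j k] that jk d by auto
  have jl: "c = 2" if "E c j l" "c < 3" "l \<notin> {i, j, k}" for c l
    using disjoint_edges[of c 2 j l i k] that ik d by auto
  have kl: "c = 0" if "E c k l" "c < 3" "l \<notin> {i, j, k}" for c l
    using disjoint_edges[of c 0 k l i j] that ij d by auto
  have "E 1 i l \<Longrightarrow> E 2 j l" "E 2 j l \<Longrightarrow> E 1 i l" "E 1 i l \<Longrightarrow> E 0 k l" "E 0 k l \<Longrightarrow> E 1 i l" for l
    using triangle[of 0 1 j i l] triangle[of 0 2 i j l] triangle[of 2 1 k i l] triangle[of 2 0 i k l]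
      ij sym[OF ij] ik sym[OF ik] by simp_all
  then have act: "E 1 i l \<longleftrightarrow> E 2 j l" "E 1 i l \<longleftrightarrow> E 0 k l" for l
    by blast+
  have outer: "E 1 i l \<and> m \<in> {i, j, k}" if "E c l m" "c < 3" "l \<notin> {i, j, k}" for c l m
  proof -
    have "m \<in> {i, j, k}"
    proof (rule ccontr)
      assume "m \<notin> {i, j, k}"
      then have "c = 0" "c = 1"
        using disjoint_edges[of c 0 l m i j] disjoint_edges[of c 1 l m j k] that ij jk by auto
      then show False by simp
    qed
    moreover have "E 1 i l"
    proof -
      have "E c m l" using sym that(1) by blast
      then consider "E c i l" | "E c j l" | "E c k l"
        using \<open>m \<in> {i, j, k}\<close> by auto
      then show ?thesis
        by cases (use il[of c l] jl[of c l] kl[of c l] act that in auto)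
    qed
    ultimately show ?thesis by blast
  qed
  have one: "l = m" if "E 1 i l" "l \<notin> {i, j, k}" "E 1 i m" "m \<notin> {i, j, k}" for l m
    using disjoint_edges[of 1 2 i l j m] that act(1)[of m] d by auto
  have inner: "(E 0 i m \<longleftrightarrow> m = j) \<and> (E 0 j m \<longleftrightarrow> m = i) \<and> \<not> E 0 k m \<and>
      \<not> E 1 i m \<and> (E 1 j m \<longleftrightarrow> m = k) \<and> (E 1 k m \<longleftrightarrow> m = j) \<and>
      (E 2 i m \<longleftrightarrow> m = k) \<and> \<not> E 2 j m \<and> (E 2 k m \<longleftrightarrow> m = i)" if "m \<in> {i, j, k}" for m
  proof -
    note S = sym[OF ij] sym[OF jk] sym[OF ik]
    have U: "\<not> E 1 i j" "\<not> E 2 i j" "\<not> E 0 j k" "\<not> E 2 j k" "\<not> E 0 i k" "\<not> E 1 i k"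
      "\<not> E 1 j i" "\<not> E 2 j i" "\<not> E 0 k j" "\<not> E 2 k j" "\<not> E 0 k i" "\<not> E 1 k i"
      using unique_colour[of 0 1 i j] unique_colour[of 0 2 i j] unique_colour[of 0 1 j k]
        unique_colour[of 1 2 j k] unique_colour[of 0 2 i k] unique_colour[of 1 2 i k]
        ij jk ik sym by auto
    show ?thesis using that U S ij jk ik irrefl d by auto
  qed
  show ?thesis
  proof (cases "\<exists>l. l \<notin> {i, j, k} \<and> E 1 i l")
    case False
    then have in3: "u \<in> {i, j, k} \<and> v \<in> {i, j, k}" if "E c u v" "c < 3" for c u v
      using outer[of c u v] outer[of c v u] that sym by blast
    have "(E 0 u v \<longleftrightarrow> {u, v} = {i, j}) \<and> (E 1 u v \<longleftrightarrow> {u, v} = {j, k}) \<and>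
            (E 2 u v \<longleftrightarrow> {u, v} = {i, k})" for u v
    proof (cases "u \<in> {i, j, k} \<and> v \<in> {i, j, k}")
      case True
      then show ?thesis using inner[of v] d by (auto simp: doubleton_eq_iff)
    next
      case False
      then show ?thesis using in3[of 0 u v] in3[of 1 u v] in3[of 2 u v] by (auto simp: doubleton_eq_iff)
    qed
    then show ?thesis by blast
  next
    case True
    then obtain l where l: "l \<notin> {i, j, k}" "E 1 i l" by blast
    then have l': "E 2 j l" "E 0 k l" using act by blast+
    have U: "m = l" if "E c m v" "c < 3" "m \<notin> {i, j, k}" for c m v
      using outer[OF that] one l that by blast
    have il': "E c i l \<longleftrightarrow> c = 1" "E c j l \<longleftrightarrow> c = 2" "E c k l \<longleftrightarrow> c = 0" if "c < 3" for c
      using il jl kl l l' that by blast+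
    have sl: "E c l m \<longleftrightarrow> E c m l" for c m using sym by blast
    have "(E 0 u v \<longleftrightarrow> {u, v} = {i, j} \<or> {u, v} = {k, l}) \<and>
            (E 1 u v \<longleftrightarrow> {u, v} = {j, k} \<or> {u, v} = {i, l}) \<and>
            (E 2 u v \<longleftrightarrow> {u, v} = {i, k} \<or> {u, v} = {j, l})" for u v
    proof (cases "u \<in> {i, j, k, l} \<and> v \<in> {i, j, k, l}")
      case True
      consider "u \<in> {i, j, k}" "v \<in> {i, j, k}" | "u \<in> {i, j, k}" "v = l" | "u = l" "v \<in> {i, j, k}" | "u = l" "v = l"
        using True by blast
      then show ?thesis
      proof cases
        case 1
        then show ?thesis using inner[of v] d l(1) by (auto simp: doubleton_eq_iff)
      next
        case 2
        then show ?thesis using il'[of 0] il'[of 1] il'[of 2] d l(1) by (auto simp: doubleton_eq_iff)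
      next
        case 3
        then show ?thesis using il'[of 0] il'[of 1] il'[of 2] d l(1) by (auto simp: doubleton_eq_iff sl)
      next
        case 4
        then show ?thesis using irrefl d l(1) by (auto simp: doubleton_eq_iff)
      qed
    next
      case False
      then have "\<not> E c u v" if "c < 3" for c
        using U[of c u v] U[of c v u] that sym by blast
      from this[of 0] this[of 1] this[of 2] show ?thesis using False by (auto simp: doubleton_eq_iff)
    qed
    then show ?thesis using l by blast
  qed
qed

end

section \<open>Relations between products of differences\<close>

text \<open>
  Only the exponents \<open>e i j\<close> with \<open>j < i < n\<close> matter; \<open>edge\<close> is their support as a symmetric relation.
\<close>

definition diff_product :: "nat \<Rightarrow> (nat \<Rightarrow> nat \<Rightarrow> nat) \<Rightarrow> (nat \<Rightarrow> complex) \<Rightarrow> complex" where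
  "diff_product n e x = (\<Prod>i<n. \<Prod>j<i. (x i - x j) ^ e i j)"

definition edge :: "nat \<Rightarrow> (nat \<Rightarrow> nat \<Rightarrow> nat) \<Rightarrow> nat \<Rightarrow> nat \<Rightarrow> bool" where
  "edge n e i j \<longleftrightarrow> i < n \<and> j < n \<and> i \<noteq> j \<and> e (max i j) (min i j) > 0"

lemma edge_sym: "edge n e i j \<Longrightarrow> edge n e j i"
  by (auto simp: edge_def max.commute min.commute)

lemma line_poly_diff_product: "line_poly (diff_product n e)"
  unfolding diff_product_def by (intro line_poly_prod line_poly_power line_poly_diff line_poly_coord)

lemma diff_product_eq_0_iff:
  "diff_product n e x = 0 \<longleftrightarrow> (\<exists>i j. edge n e i j \<and> x i = x j)"
proof -
  have "diff_product n e x = 0 \<longleftrightarrow> (\<exists>i<n. \<exists>j<i. x i = x j \<and> e i j > 0)"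
    by (auto simp: diff_product_def)
  also have "\<dots> \<longleftrightarrow> (\<exists>i j. edge n e i j \<and> x i = x j)"
  proof safe
    fix i j assume "i < n" "j < i" "x i = x j" "0 < e i j"
    then show "\<exists>i j. edge n e i j \<and> x i = x j"
      by (intro exI[of _ i] exI[of _ j]) (auto simp: edge_def max_def min_def)
  next
    fix i j assume e: "edge n e i j" "x i = x j"
    then show "\<exists>i<n. \<exists>j<i. x i = x j \<and> 0 < e i j"
      by (intro exI[of _ "max i j"] conjI exI[of _ "min i j"])
         (auto simp: edge_def max_def min_def split: if_splits)
  qed
  finally show ?thesis .
qed

lemma diff_product_as_pairs:
  assumes P: "\<And>i j. j < i \<Longrightarrow> i < n \<Longrightarrow> e i j > 0 \<longleftrightarrow> (i, j) \<in> P"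
    and "P \<subseteq> (SIGMA i:{..<n}. {..<i})"
  shows "diff_product n e x = (\<Prod>(i, j)\<in>P. (x i - x j) ^ e i j)"
proof -
  have "diff_product n e x = (\<Prod>(i, j)\<in>(SIGMA i:{..<n}. {..<i}). (x i - x j) ^ e i j)"
    unfolding diff_product_def by (rule prod.Sigma) auto
  also have "\<dots> = (\<Prod>(i, j)\<in>P. (x i - x j) ^ e i j)"
  proof (rule prod.mono_neutral_right)
    show "\<forall>ij\<in>(SIGMA i:{..<n}. {..<i}) - P. (case ij of (i, j) \<Rightarrow> (x i - x j) ^ e i j) = 1"
      using P by fastforce
  qed (use assms(2) in auto)
  finally show ?thesis .
qed

lemma power_max_min:
  shows "\<exists>s. s \<noteq> 0 \<and> (\<forall>x :: nat \<Rightarrow> complex. (x (max i j) - x (min i j)) ^ p = s * (x i - x j) ^ p)"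
proof (cases "j \<le> i")
  case True
  then show ?thesis by (intro exI[of _ 1]) (auto simp: max_def min_def)
next
  case False
  have "(x j - x i) ^ p = (-1) ^ p * (x i - x j) ^ p" for x :: "nat \<Rightarrow> complex"
    by (simp flip: power_mult_distrib)
  then show ?thesis using False by (intro exI[of _ "(-1) ^ p"]) (auto simp: max_def min_def)
qed

lemma diff_product_one_edge:
  assumes E: "\<And>u v. edge n e u v \<longleftrightarrow> {u, v} = {i, j}"
  shows "\<exists>s p. s \<noteq> 0 \<and> p > 0 \<and> (\<forall>x. diff_product n e x = s * (x i - x j) ^ p)"
proof -
  have ij: "edge n e i j" using E by blast
  define p where "p = e (max i j) (min i j)"
  have "diff_product n e x = (x (max i j) - x (min i j)) ^ p" for x
  proof -
    have "diff_product n e x = (\<Prod>(i, j)\<in>{(max i j, min i j)}. (x i - x j) ^ e i j)"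
    proof (rule diff_product_as_pairs)
      fix u v :: nat assume "v < u" "u < n"
      then have "e u v > 0 \<longleftrightarrow> edge n e u v" by (auto simp: edge_def max_def min_def)
      then show "e u v > 0 \<longleftrightarrow> (u, v) \<in> {(max i j, min i j)}"
        using E[of u v] \<open>v < u\<close> by (auto simp: doubleton_eq_iff max_def min_def)
    qed (use ij in \<open>auto simp: edge_def\<close>)
    then show ?thesis by (simp add: p_def)
  qed
  moreover have "p > 0" using ij by (simp add: p_def edge_def)
  ultimately show ?thesis using power_max_min[of i j p] by auto
qed

lemma diff_product_two_edges:
  assumes E: "\<And>u v. edge n e u v \<longleftrightarrow> {u, v} = {i, j} \<or> {u, v} = {k, l}" and ne: "{i, j} \<noteq> {k, l}"
  shows "\<exists>s p q. s \<noteq> 0 \<and> p > 0 \<and> q > 0 \<and>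
    (\<forall>x. diff_product n e x = s * (x i - x j) ^ p * (x k - x l) ^ q)"
proof -
  have ij: "edge n e i j" "edge n e k l" using E by blast+
  define p where "p = e (max i j) (min i j)"
  define q where "q = e (max k l) (min k l)"
  have "diff_product n e x = (x (max i j) - x (min i j)) ^ p * (x (max k l) - x (min k l)) ^ q" for x
  proof -
    have "diff_product n e x =
        (\<Prod>(i, j)\<in>{(max i j, min i j), (max k l, min k l)}. (x i - x j) ^ e i j)"
    proof (rule diff_product_as_pairs)
      fix u v :: nat assume "v < u" "u < n"
      then have "e u v > 0 \<longleftrightarrow> edge n e u v" by (auto simp: edge_def max_def min_def)
      then show "e u v > 0 \<longleftrightarrow> (u, v) \<in> {(max i j, min i j), (max k l, min k l)}"
        using E[of u v] \<open>v < u\<close> by (auto simp: doubleton_eq_iff max_def min_def)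
    qed (use ij in \<open>auto simp: edge_def\<close>)
    moreover have "(max i j, min i j) \<noteq> (max k l, min k l)"
      using ne by (auto simp: max_def min_def split: if_splits)
    ultimately show ?thesis by (simp add: p_def q_def)
  qed
  moreover have "p > 0" "q > 0" using ij by (auto simp: p_def q_def edge_def)
  moreover obtain s where "s \<noteq> 0" "\<And>x :: nat \<Rightarrow> complex. (x (max i j) - x (min i j)) ^ p = s * (x i - x j) ^ p"
    using power_max_min by blast
  moreover obtain t where "t \<noteq> 0" "\<And>x :: nat \<Rightarrow> complex. (x (max k l) - x (min k l)) ^ q = t * (x k - x l) ^ q"
    using power_max_min by blast
  ultimately show ?thesis
    by (intro exI[of _ "s * t"] exI[of _ p] exI[of _ q]) (simp add: mult_ac)
qed

lemma proportional_powers: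
  fixes c d :: complex
  assumes "\<And>z. c * z ^ p = d * z ^ q" "c \<noteq> 0"
  shows "c = d" "p = q"
proof -
  show "c = d" using assms(1)[of 1] by simp
  then have "(2::complex) ^ p = 2 ^ q" using assms(1)[of 2] assms(2) by simp
  then have "(of_nat (2 ^ p) :: complex) = of_nat (2 ^ q)" by simp
  then have "(2::nat) ^ p = 2 ^ q" by (simp only: of_nat_eq_iff)
  then show "p = q" by simp
qed

text \<open>
  Setting two of the variables equal kills one term and compares the other two. The remaining relation
  \<open>(a - b)^p + (b - c)^p = (a - c)^p\<close> forces \<open>2 = 2^p\<close> at \<open>(2, 1, 0)\<close>.
\<close>

lemma triangle_exponents:
  fixes c0 c1 c2 :: complex
  assumes eq: "\<And>a b c. c0 * (a - b) ^ p + c1 * (b - c) ^ q + c2 * (a - c) ^ r = 0"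
    and "c0 \<noteq> 0" "c1 \<noteq> 0" "c2 \<noteq> 0" "p > 0" "q > 0" "r > 0"
  shows "c0 = - c2" "p = 1" "r = 1"
proof -
  have "c1 * z ^ q = (- c2) * z ^ r" for z
    using eq[of 0 0 "- z"] assms by (simp add: eq_neg_iff_add_eq_0 zero_power)
  note 1 = proportional_powers[OF this \<open>c1 \<noteq> 0\<close>]
  have "c0 * z ^ p = (- c2) * z ^ r" for z
    using eq[of z 0 0] assms by (simp add: eq_neg_iff_add_eq_0 zero_power)
  note 2 = proportional_powers[OF this \<open>c0 \<noteq> 0\<close>]
  show "c0 = - c2" by (rule 2)
  have "(2 :: complex) ^ p = 2 ^ 1"
    using eq[of 2 1 0] 1 2 \<open>c2 \<noteq> 0\<close> by (simp add: algebra_simps)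
  then have "(of_nat (2 ^ p) :: complex) = of_nat (2 ^ 1)" by simp
  then have "(2::nat) ^ p = 2 ^ 1" by (simp only: of_nat_eq_iff)
  then show "p = 1" by (simp only: power_inject_exp)
  then show "r = 1" using 2 by simp
qed

text \<open>
  As for the triangle; setting \<open>a = d\<close> in addition shows that opposite edges have the same exponent.
\<close>

lemma quadrangle_exponents:
  fixes c0 c1 c2 :: complex
  assumes eq: "\<And>a b c d. c0 * (a - b) ^ p * (c - d) ^ p' + c1 * (b - c) ^ q * (a - d) ^ q'
      + c2 * (a - c) ^ r * (b - d) ^ r' = 0"
    and nz: "c0 \<noteq> 0" "c1 \<noteq> 0" "c2 \<noteq> 0" and pos: "p > 0" "p' > 0" "q > 0" "q' > 0" "r > 0" "r' > 0"
  shows "c0 = - c2" "p = 1" "p' = 1" "r = 1" "r' = 1"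
proof -
  have a: "c1 * z ^ q * w ^ q' = (- c2) * z ^ r * w ^ r'" for z w
    using eq[of 0 0 "- z" "- w"] pos by (simp add: eq_neg_iff_add_eq_0 zero_power)
  have b: "c0 * z ^ p * w ^ p' = (- c2) * z ^ r * w ^ r'" for z w
    using eq[of z 0 0 "- w"] pos by (simp add: eq_neg_iff_add_eq_0 zero_power)
  have c: "c0 * w ^ p * z ^ p' = (- c2 * (- 1) ^ r * (- 1) ^ r') * (z ^ r * w ^ r')" for z w
  proof -
    have "(- z) ^ r = (- 1) ^ r * z ^ r" "(- w) ^ r' = (- 1) ^ r' * w ^ r'"
      by (simp_all flip: power_mult_distrib)
    then show ?thesis
      using eq[of 0 "- w" z 0] pos by (simp add: eq_neg_iff_add_eq_0 zero_power mult_ac)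
  qed
  have "c1 * z ^ q = (- c2) * z ^ r" "c1 * z ^ q' = (- c2) * z ^ r'" for z
    using a[of z 1] a[of 1 z] by simp_all
  note 1 = proportional_powers[OF this(1) \<open>c1 \<noteq> 0\<close>] proportional_powers[OF this(2) \<open>c1 \<noteq> 0\<close>]
  have "c0 * z ^ p = (- c2) * z ^ r" "c0 * z ^ p' = (- c2) * z ^ r'" for z
    using b[of z 1] b[of 1 z] by simp_all
  note 2 = proportional_powers[OF this(1) \<open>c0 \<noteq> 0\<close>] proportional_powers[OF this(2) \<open>c0 \<noteq> 0\<close>]
  show "c0 = - c2" by (rule 2)
  have "c0 * z ^ p = (- c2 * (- 1) ^ r * (- 1) ^ r') * z ^ r'" for z
    using c[of z 1] by simp
  note 3 = proportional_powers[OF this \<open>c0 \<noteq> 0\<close>]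
  have eqs: "p = r" "p' = r" "q = r" "q' = r" "r' = r"
    using 1 2 3 by simp_all
  \<comment> \<open>a harmonic quadruple: both products are \<open>2/3\<close> and their sum is \<open>4/3\<close>\<close>
  have "(2/3 :: complex) ^ r + (2/3) ^ r = (4/3) ^ r"
    using eq[of 0 1 "4/3" 2] eqs 1 2 \<open>c2 \<noteq> 0\<close>
    by (simp add: mult.assoc flip: power_mult_distrib)
  moreover have "(4/3 :: complex) ^ r = 2 ^ r * (2/3) ^ r"
    by (simp flip: power_mult_distrib)
  ultimately have "(2 :: complex) ^ r = 2 ^ 1"
    by (simp flip: mult_2)
  then have "(of_nat (2 ^ r) :: complex) = of_nat (2 ^ 1)" by simp
  then have "(2::nat) ^ r = 2 ^ 1" by (simp only: of_nat_eq_iff)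
  then have "r = 1" by (simp only: power_inject_exp)
  then show "p = 1" "p' = 1" "r = 1" "r' = 1" using eqs by simp_all
qed

section \<open>Holomorphic functions on configurations that omit two values\<close>

text \<open>
  Homogeneous coordinates: label \<open>i < n\<close> stands for the point \<open>(x\<^sub>i : 1)\<close> and label \<open>n = length x\<close> for
  infinity, \<open>(1 : 0)\<close>.
\<close>

definition num :: "complex list \<Rightarrow> nat \<Rightarrow> complex" where
  "num x i = (if i < length x then x ! i else 1)"

definition den :: "complex list \<Rightarrow> nat \<Rightarrow> complex" where
  "den x i = (if i < length x then 1 else 0)"

definition bracket :: "complex list \<Rightarrow> nat \<Rightarrow> nat \<Rightarrow> complex" where
  "bracket x i j = num x i * den x j - num x j * den x i"

text \<open>
  The cross-ratio \<open>cr\<close> of four of the \<open>n + 1\<close> labelled points, in a form that remains valid when one of them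
  is infinity.
\<close>

definition gcr :: "complex list \<Rightarrow> nat \<Rightarrow> nat \<Rightarrow> nat \<Rightarrow> nat \<Rightarrow> complex" where
  "gcr x a b c d = bracket x d a * bracket x b c / (bracket x d c * bracket x b a)"

lemma bracket_nonzero:
  assumes "x \<in> PConf n" "i \<le> n" "j \<le> n" "i \<noteq> j"
  shows "bracket x i j \<noteq> 0"
  using assms by (auto simp: bracket_def num_def den_def PConf_def nth_eq_iff_index_eq)

lemma holomorphic_omits_0_1_separately_monomial:
  assumes f: "holomorphic_fun n f" and omit: "\<And>x. x \<in> PConf n \<Longrightarrow> f x \<noteq> 0 \<and> f x \<noteq> 1"
  shows "separately_monomial n f"
  unfolding separately_monomial_def
proof (intro ballI allI impI)
  fix x i assume x: "x \<in> PConf n" and i: "i < n"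
  define S where "S = (!) x ` ({..<n} - {i})"
  have S: "x[i := z] \<in> PConf n \<longleftrightarrow> z \<notin> S" for z
    unfolding PConf_update[OF x i] S_def by blast
  have inj: "inj_on ((!) x) ({..<n} - {i})"
    using x by (auto simp: PConf_def inj_on_def nth_eq_iff_index_eq)
  obtain c a where c: "c \<noteq> 0" and ca: "\<And>z. z \<notin> S \<Longrightarrow> f (x[i := z]) = c * (\<Prod>s\<in>S. (z - s) powi a s)"
    using omits_0_1_imp_product_of_powers[of S "\<lambda>z. f (x[i := z])"] omit S
      holomorphic_fun_one_variable[OF f x i] unfolding S_def[symmetric] by (auto simp: S_def)
  have "(\<Prod>s\<in>S. (z - s) powi a s) = (\<Prod>j\<in>{..<n} - {i}. (z - x ! j) powi a (x ! j))" for z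
    unfolding S_def by (rule prod.reindex_cong[OF inj]) auto
  then show "\<exists>c a. c \<noteq> 0 \<and> (\<forall>z. x[i := z] \<in> PConf n \<longrightarrow>
      f (x[i := z]) = c * (\<Prod>j\<in>{..<n} - {i}. (z - x ! j) powi a j))"
    using c ca S by (intro exI[of _ c] exI[of _ "\<lambda>j. a (x ! j)"]) simp
qed

lemma diff_product_no_edge:
  assumes "\<And>i j. \<not> edge n e i j"
  shows "diff_product n e x = 1"
proof -
  have "e i j = 0" if "j < i" "i < n" for i j
    using assms[of i j] that by (simp add: edge_def max_def min_def)
  then show ?thesis by (auto simp: diff_product_def intro!: prod.neutral)
qed

text \<open>
  If only one of the three products had a linear factor \<open>x\<^sub>i - x\<^sub>j\<close>, then it would equal a constant, which is
  zero because it vanishes for \<open>x\<^sub>i = x\<^sub>j\<close>. So there are edges of two colours, hence a triangle with all three.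
\<close>

lemma three_products_shape:
  fixes K :: "nat \<Rightarrow> complex" and e :: "nat \<Rightarrow> nat \<Rightarrow> nat \<Rightarrow> nat"
  assumes K: "\<And>c. c < 3 \<Longrightarrow> K c \<noteq> 0"
    and sum: "\<And>x. K 0 * diff_product n (e 0) x + K 1 * diff_product n (e 1) x + K 2 * diff_product n (e 2) x = 0"
    and disj: "\<And>i j. \<exists>c<3. e c i j = 0"
  shows "(\<forall>c<3. \<forall>i j. \<not> edge n (e c) i j) \<or>
    (coloured_edges (\<lambda>c. edge n (e c)) \<and> (\<exists>i j k. edge n (e 0) i j \<and> edge n (e 1) j k \<and> edge n (e 2) i k))"
proof -
  define F where "F = (\<lambda>c x. K c * diff_product n (e c) x)"
  have F0: "F c x = 0 \<longleftrightarrow> (\<exists>i j. edge n (e c) i j \<and> x i = x j)" if "c < 3" for c x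
    using K[OF that] by (simp add: F_def diff_product_eq_0_iff)
  have Fsum: "F c x + F c' x + F (3 - c - c') x = 0" if "c < 3" "c' < 3" "c \<noteq> c'" for c c' x
  proof -
    have "(c = 0 \<or> c = 1 \<or> c = 2) \<and> (c' = 0 \<or> c' = 1 \<or> c' = 2)"
      using that by auto
    then show ?thesis
      using sum[of x] that(3) by (elim conjE disjE) (simp_all add: F_def algebra_simps numeral_2_eq_2 numeral_3_eq_3)
  qed
  interpret coloured_edges "\<lambda>c. edge n (e c)"
  proof
    show "\<exists>c<3. \<not> edge n (e c) i j" for i j
      using disj[of "max i j" "min i j"] by (auto simp: edge_def)
    show "edge n (e c) i j \<Longrightarrow> edge n (e c) j i" for c i j by (rule edge_sym)
    show "\<not> edge n (e c) i i" for c i by (simp add: edge_def)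
    fix c c' i j k l and \<phi> :: "nat \<Rightarrow> nat"
    assume a: "c < 3" "c' < 3" "c \<noteq> c'" "edge n (e c) i j" "\<phi> i = \<phi> j" "edge n (e c') k l" "\<phi> k = \<phi> l"
    define x where "x = (\<lambda>v. of_nat (\<phi> v) :: complex)"
    have "F c x = 0" "F c' x = 0"
      using a F0 by (auto simp: x_def)
    then have "F (3 - c - c') x = 0" using Fsum[OF a(1-3), of x] by simp
    then show "\<exists>u v. edge n (e (3 - c - c')) u v \<and> \<phi> u = \<phi> v"
      using F0 third_colour[OF a(1-3)] by (auto simp: x_def)
  qed
  show ?thesis
  proof (cases "\<exists>c<3. \<exists>i j. edge n (e c) i j")
    case False
    then show ?thesis by blast
  next
    case True
    then obtain c i j where c: "c < 3" "edge n (e c) i j" by blast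
    have "\<exists>c'<3. c' \<noteq> c \<and> (\<exists>k l. edge n (e c') k l)"
    proof (rule ccontr)
      assume none: "\<not> ?thesis"
      define c' where "c' = (if c = 0 then 1 else 0 :: nat)"
      have c': "c' < 3" "c \<noteq> c'" by (auto simp: c'_def)
      note c'' = third_colour[OF c(1) c']
      have const: "F d x = K d" if "d < 3" "d \<noteq> c" for d x
        using diff_product_no_edge none that unfolding F_def by (metis mult.right_neutral)
      have eq: "F c x + K c' + K (3 - c - c') = 0" for x
        using Fsum[OF c(1) c', of x] const[of c' x] const[of "3 - c - c'" x] c' c'' by simp
      define x where "x = (\<lambda>v. if v = j then of_nat i else of_nat v :: complex)"
      have "x i = x j" by (simp add: x_def)
      then have "F c x = 0" using c F0 by blast
      moreover have "F c of_nat \<noteq> 0" using c F0 by (auto simp: edge_def)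
      ultimately show False using eq[of x] eq[of of_nat] by (simp add: add.assoc)
    qed
    then show ?thesis
      using obtain_triangle c coloured_edges_axioms by blast
  qed
qed

text \<open>
  Clearing denominators in \<open>f + (1 - f) = 1\<close> gives a relation between three products of linear forms, and the
  shape of their supports together with the exponents determines \<open>f\<close>: the triangle gives a cross-ratio with
  one point at infinity, the coloured complete graph on four vertices one of four finite points.
\<close>

theorem holomorphic_omits_0_1_imp_cross_ratio:
  assumes f: "holomorphic_fun n f" and omit: "\<And>x. x \<in> PConf n \<Longrightarrow> f x \<noteq> 0 \<and> f x \<noteq> 1"
  shows "(\<exists>k. \<forall>x\<in>PConf n. f x = k) \<or>
    (\<exists>a b c d. distinct [a, b, c, d] \<and> {a, b, c, d} \<subseteq> {..n} \<and> (\<forall>x\<in>PConf n. f x = gcr x a b c d))"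
proof -
  have f': "holomorphic_fun n (\<lambda>x. 1 - f x)"
    by (intro holomorphic_fun_diff holomorphic_fun_const f)
  obtain c a where c: "c \<noteq> 0"
    and fa: "\<And>x. x \<in> PConf n \<Longrightarrow> f x = c * (\<Prod>i<n. \<Prod>j<i. (x ! i - x ! j) powi a i j)"
    using separately_monomial_imp_product[OF holomorphic_omits_0_1_separately_monomial[OF f omit]] omit by blast
  have "separately_monomial n (\<lambda>x. 1 - f x)"
    using omit by (intro holomorphic_omits_0_1_separately_monomial f') auto
  then obtain c' b where c': "c' \<noteq> 0"
    and fb: "\<And>x. x \<in> PConf n \<Longrightarrow> 1 - f x = c' * (\<Prod>i<n. \<Prod>j<i. (x ! i - x ! j) powi b i j)"
    using separately_monomial_imp_product[of n "\<lambda>x. 1 - f x"] omit by auto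
  \<comment> \<open>the common denominator; it is chosen so that no linear form divides all three products\<close>
  define m where "m = (\<lambda>i j. min 0 (min (a i j) (b i j)))"
  define K where "K = (\<lambda>l::nat. if l = 0 then c else if l = 1 then c' else - 1)"
  define e where "e = (\<lambda>(l::nat) i j. if l = 0 then nat (a i j - m i j)
      else if l = 1 then nat (b i j - m i j) else nat (- m i j))"
  have clear: "(\<Prod>i<n. \<Prod>j<i. (x i - x j) powi g i j) * diff_product n (e 2) x =
      diff_product n (\<lambda>i j. nat (g i j - m i j)) x"
    if inj: "inj_on x {..<n}" and g: "\<And>i j. g i j \<ge> m i j" for g and x :: "nat \<Rightarrow> complex"
  proof -
    have "(x i - x j) powi g i j * (x i - x j) ^ e 2 i j = (x i - x j) ^ nat (g i j - m i j)"
      if "i < n" "j < i" for i j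
    proof -
      have "x i - x j \<noteq> 0" using inj_on_eq_iff[OF inj, of i j] that by auto
      moreover have "m i j \<le> 0" by (simp add: m_def)
      ultimately have "(x i - x j) powi g i j * (x i - x j) powi (- m i j) = (x i - x j) powi (g i j - m i j)"
        by (simp flip: power_int_add)
      then show ?thesis using g[of i j] \<open>m i j \<le> 0\<close> by (simp add: power_int_def e_def)
    qed
    then show ?thesis
      unfolding diff_product_def prod.distrib[symmetric] by (intro prod.cong refl) auto
  qed
  have list: "map x [0..<n] \<in> PConf n" if "inj_on x {..<n}" for x :: "nat \<Rightarrow> complex"
    using that by (auto simp: PConf_def distinct_map lessThan_atLeast0)
  have D: "c * diff_product n (e 0) x = f (map x [0..<n]) * diff_product n (e 2) x"
      "c' * diff_product n (e 1) x = (1 - f (map x [0..<n])) * diff_product n (e 2) x"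
    if inj: "inj_on x {..<n}" for x
  proof -
    have "f (map x [0..<n]) = c * (\<Prod>i<n. \<Prod>j<i. (x i - x j) powi a i j)"
      unfolding fa[OF list[OF inj]] by (intro arg_cong[of _ _ "(*) c"] prod.cong refl) auto
    moreover have "1 - f (map x [0..<n]) = c' * (\<Prod>i<n. \<Prod>j<i. (x i - x j) powi b i j)"
      unfolding fb[OF list[OF inj]] by (intro arg_cong[of _ _ "(*) c'"] prod.cong refl) auto
    moreover have "e 0 = (\<lambda>i j. nat (a i j - m i j))" "e 1 = (\<lambda>i j. nat (b i j - m i j))"
      by (auto simp: e_def)
    ultimately show "c * diff_product n (e 0) x = f (map x [0..<n]) * diff_product n (e 2) x"
      "c' * diff_product n (e 1) x = (1 - f (map x [0..<n])) * diff_product n (e 2) x"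
      using clear[OF inj, of a] clear[OF inj, of b] by (simp_all add: m_def mult.assoc)
  qed
  have sum: "K 0 * diff_product n (e 0) x + K 1 * diff_product n (e 1) x + K 2 * diff_product n (e 2) x = 0" for x
  proof (rule line_poly_eq_0[of "\<lambda>x. K 0 * diff_product n (e 0) x + K 1 * diff_product n (e 1) x
      + K 2 * diff_product n (e 2) x" n])
    show "line_poly (\<lambda>x. K 0 * diff_product n (e 0) x + K 1 * diff_product n (e 1) x + K 2 * diff_product n (e 2) x)"
      by (intro line_poly_add line_poly_mult line_poly_const line_poly_diff_product)
  next
    fix x :: "nat \<Rightarrow> complex" assume "inj_on x {..<n}"
    then show "K 0 * diff_product n (e 0) x + K 1 * diff_product n (e 1) x + K 2 * diff_product n (e 2) x = 0"
      using D[of x] by (simp add: K_def algebra_simps)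
  qed
  have f_eq: "f x = c * diff_product n (e 0) ((!) x) / diff_product n (e 2) ((!) x)" if x: "x \<in> PConf n" for x
  proof -
    have inj: "inj_on ((!) x) {..<n}" using x by (auto simp: PConf_def inj_on_nth)
    have "map ((!) x) [0..<n] = x" using x map_nth[of x] by (simp add: PConf_def)
    moreover have "diff_product n (e 2) ((!) x) \<noteq> 0"
      using inj by (auto simp: diff_product_eq_0_iff edge_def inj_on_def)
    ultimately show ?thesis using D(1)[OF inj] by (simp add: field_simps)
  qed
  have K: "K l \<noteq> 0" for l using c c' by (simp add: K_def)
  have "\<exists>l<3. e l i j = 0" for i j
  proof -
    have "m i j = 0 \<or> m i j = a i j \<or> m i j = b i j" by (auto simp: m_def min_def)
    then have "e 0 i j = 0 \<or> e 1 i j = 0 \<or> e 2 i j = 0" by (auto simp: e_def)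
    then show ?thesis by (metis Suc_1 lessI less_SucI numeral_3_eq_3 zero_less_Suc One_nat_def)
  qed
  from three_products_shape[OF K sum this] show ?thesis
  proof (elim disjE conjE exE)
    assume "\<forall>l<3. \<forall>i j. \<not> edge n (e l) i j"
    then have "f x = c" if "x \<in> PConf n" for x
      using f_eq[OF that] diff_product_no_edge[of n "e 0"] diff_product_no_edge[of n "e 2"] by simp
    then show ?thesis by blast
  next
    fix i j k
    assume "coloured_edges (\<lambda>l. edge n (e l))"
      and E: "edge n (e 0) i j" "edge n (e 1) j k" "edge n (e 2) i k"
    then interpret coloured_edges "\<lambda>l. edge n (e l)" by blast
    have ijk: "i < n" "j < n" "k < n" "i \<noteq> j" "j \<noteq> k" "i \<noteq> k"
      using E by (auto simp: edge_def)
    from shape[OF E] show ?thesis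
    proof (elim disjE exE conjE)
      assume tri: "\<forall>u v. (edge n (e 0) u v \<longleftrightarrow> {u, v} = {i, j}) \<and> (edge n (e 1) u v \<longleftrightarrow> {u, v} = {j, k}) \<and>
            (edge n (e 2) u v \<longleftrightarrow> {u, v} = {i, k})"
      have tri0: "edge n (e 0) u v \<longleftrightarrow> {u, v} = {i, j}"
        and tri1: "edge n (e 1) u v \<longleftrightarrow> {u, v} = {j, k}"
        and tri2: "edge n (e 2) u v \<longleftrightarrow> {u, v} = {i, k}" for u v
        using tri by simp_all
      obtain s0 p where F0: "s0 \<noteq> 0" "p > 0" "\<And>x. diff_product n (e 0) x = s0 * (x i - x j) ^ p"
        using diff_product_one_edge[OF tri0] by metis
      obtain s1 q where F1: "s1 \<noteq> 0" "q > 0" "\<And>x. diff_product n (e 1) x = s1 * (x j - x k) ^ q"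
        using diff_product_one_edge[OF tri1] by metis
      obtain s2 r where F2: "s2 \<noteq> 0" "r > 0" "\<And>x. diff_product n (e 2) x = s2 * (x i - x k) ^ r"
        using diff_product_one_edge[OF tri2] by metis
      have "(K 0 * s0) * (A - B) ^ p + (K 1 * s1) * (B - C) ^ q + (K 2 * s2) * (A - C) ^ r = 0" for A B C
        using sum[of "\<lambda>v. if v = i then A else if v = j then B else C"] ijk
        unfolding F0(3) F1(3) F2(3) by (simp add: mult.assoc)
      then have R: "K 0 * s0 = - (K 2 * s2)" "p = 1" "r = 1"
        using triangle_exponents[of "K 0 * s0" p "K 1 * s1" q "K 2 * s2" r] K F0 F1 F2 by auto
      have "f x = gcr x k i j n" if x: "x \<in> PConf n" for x
      proof -
        have len: "length x = n" using x by (simp add: PConf_def)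
        have "c * s0 = s2" using R by (simp add: K_def)
        then have "f x = (x ! i - x ! j) / (x ! i - x ! k)"
          using f_eq[OF x] R F2(1) unfolding F0(3) F2(3) by (simp flip: mult.assoc)
        then show ?thesis
          using ijk by (simp add: gcr_def bracket_def num_def den_def len)
      qed
      then show ?thesis
        using ijk by (intro disjI2 exI[of _ k] exI[of _ i] exI[of _ j] exI[of _ n]) auto
    next
      fix l
      assume quad: "l \<notin> {i, j, k}" "\<forall>u v.
            (edge n (e 0) u v \<longleftrightarrow> {u, v} = {i, j} \<or> {u, v} = {k, l}) \<and>
            (edge n (e 1) u v \<longleftrightarrow> {u, v} = {j, k} \<or> {u, v} = {i, l}) \<and>
            (edge n (e 2) u v \<longleftrightarrow> {u, v} = {i, k} \<or> {u, v} = {j, l})"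
      have l: "l < n" "l \<noteq> i" "l \<noteq> j" "l \<noteq> k"
        using quad(1) quad(2)[rule_format, of k l] by (auto simp: edge_def)
      have quad0: "edge n (e 0) u v \<longleftrightarrow> {u, v} = {i, j} \<or> {u, v} = {k, l}"
        and quad1: "edge n (e 1) u v \<longleftrightarrow> {u, v} = {j, k} \<or> {u, v} = {i, l}"
        and quad2: "edge n (e 2) u v \<longleftrightarrow> {u, v} = {i, k} \<or> {u, v} = {j, l}" for u v
        using quad(2) by simp_all
      have ne: "{i, j} \<noteq> {k, l}" "{j, k} \<noteq> {i, l}" "{i, k} \<noteq> {j, l}"
        using ijk by (auto simp: doubleton_eq_iff)
      obtain s0 p p' where F0: "s0 \<noteq> 0" "p > 0" "p' > 0" "\<And>x. diff_product n (e 0) x = s0 * (x i - x j) ^ p * (x k - x l) ^ p'"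
        using diff_product_two_edges[OF quad0] ne by metis
      obtain s1 q q' where F1: "s1 \<noteq> 0" "q > 0" "q' > 0" "\<And>x. diff_product n (e 1) x = s1 * (x j - x k) ^ q * (x i - x l) ^ q'"
        using diff_product_two_edges[OF quad1] ne by metis
      obtain s2 r r' where F2: "s2 \<noteq> 0" "r > 0" "r' > 0" "\<And>x. diff_product n (e 2) x = s2 * (x i - x k) ^ r * (x j - x l) ^ r'"
        using diff_product_two_edges[OF quad2] ne by metis
      have "(K 0 * s0) * (A - B) ^ p * (C - D) ^ p' + (K 1 * s1) * (B - C) ^ q * (A - D) ^ q'
          + (K 2 * s2) * (A - C) ^ r * (B - D) ^ r' = 0" for A B C D
        using sum[of "\<lambda>v. if v = i then A else if v = j then B else if v = k then C else D"] ijk l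
        unfolding F0(4) F1(4) F2(4) by (simp add: mult.assoc)
      then have R: "K 0 * s0 = - (K 2 * s2)" "p = 1" "p' = 1" "r = 1" "r' = 1"
        using quadrangle_exponents[of "K 0 * s0" p p' "K 1 * s1" q q' "K 2 * s2" r r'] K F0 F1 F2 by auto
      have "f x = gcr x k i j l" if x: "x \<in> PConf n" for x
      proof -
        have len: "length x = n" using x by (simp add: PConf_def)
        have "c * s0 = s2" using R by (simp add: K_def)
        then have "f x = (x ! i - x ! j) * (x ! k - x ! l) / ((x ! i - x ! k) * (x ! j - x ! l))"
          using f_eq[OF x] R F2(1) unfolding F0(4) F2(4) by (simp flip: mult.assoc)
        also have "\<dots> = (x ! l - x ! k) * (x ! i - x ! j) / ((x ! l - x ! j) * (x ! i - x ! k))"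
        proof -
          have "P * (- A) / (Q * (- B)) = A * P / (B * Q)" for P A Q B :: complex
            by (simp add: mult.commute)
          from this[of "x ! i - x ! j" "x ! l - x ! k" "x ! i - x ! k" "x ! l - x ! j"]
          show ?thesis by simp
        qed
        finally show ?thesis
          using ijk l by (simp add: gcr_def bracket_def num_def den_def len)
      qed
      then show ?thesis
        using ijk l by (intro disjI2 exI[of _ k] exI[of _ i] exI[of _ j] exI[of _ l]) auto
    qed
  qed
qed

section \<open>Cross-ratios that never agree\<close>

text \<open>
  By a Moebius transformation, \<open>n\<close> points and infinity may be replaced by \<open>n + 1\<close> finite points \<open>w\<close>,
  which puts all labels on the same footing.
\<close>

definition crw :: "(nat \<Rightarrow> complex) \<Rightarrow> nat \<Rightarrow> nat \<Rightarrow> nat \<Rightarrow> nat \<Rightarrow> complex" where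
  "crw w a b c d = cr (w a) (w b) (w c) (w d)"

lemma cr_double_swap:
  "cr j i l k = cr i j k l" "cr k l i j = cr i j k l" "cr l k j i = cr i j k l"
proof -
  have eq: "(P * (- A) / (Q * (- B))) = A * P / (B * Q)" for P A Q B :: complex
    by (simp add: mult.commute)
  show "cr j i l k = cr i j k l"
    using eq[of "k - j" "l - i" "k - l" "j - i"] unfolding cr_def
    by (simp add: divide_simps; simp add: algebra_simps)
  show "cr k l i j = cr i j k l"
    unfolding cr_def by (simp add: divide_simps; simp add: algebra_simps)
  show "cr l k j i = cr i j k l"
    unfolding cr_def by (simp add: divide_simps; simp add: algebra_simps)
qed

lemma cr_perms:
  assumes "distinct [i, j, k, l]"
  shows "cr i j k l \<noteq> 0" "cr i j k l \<noteq> 1"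
    and "cr j i k l = 1 - cr i j k l"
    and "cr k j i l = 1 / cr i j k l"
    and "cr i k j l = cr i j k l / (cr i j k l - 1)"
    and "cr j k i l = 1 - 1 / cr i j k l"
    and "cr k i j l = 1 / (1 - cr i j k l)"
proof -
  have ne: "i \<noteq> j" "i \<noteq> k" "i \<noteq> l" "j \<noteq> k" "j \<noteq> l" "k \<noteq> l" "l \<noteq> i" "l \<noteq> j" "l \<noteq> k" "j \<noteq> i" "k \<noteq> i" "k \<noteq> j"
    using assms by auto
  have swap12: "cr q p r s = 1 - cr p q r s" if "p \<noteq> q" "s \<noteq> r" for p q r s
    using that unfolding cr_def by (simp add: divide_simps; simp add: algebra_simps)
  have swap13: "cr r q p s = 1 / cr p q r s" for p q r s
    unfolding cr_def by (simp add: divide_simps; simp add: algebra_simps)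
  show nz: "cr i j k l \<noteq> 0" using ne by (simp add: cr_def)
  show 12: "cr j i k l = 1 - cr i j k l" by (rule swap12) (use ne in auto)
  have "cr j i k l \<noteq> 0" using ne by (simp add: cr_def)
  then show n1: "cr i j k l \<noteq> 1" using 12 by simp
  show "cr k j i l = 1 / cr i j k l" by (rule swap13)
  have "cr j k i l = 1 - cr k j i l"
    by (rule swap12) (use ne in auto)
  then show "cr j k i l = 1 - 1 / cr i j k l"
    unfolding swap13[of k j i l] .
  have 312: "cr k i j l = 1 / (1 - cr i j k l)"
    unfolding swap13[of k i j l] 12 ..
  then show "cr k i j l = 1 / (1 - cr i j k l)" .
  have "cr i k j l = 1 - cr k i j l" by (rule swap12) (use ne in auto)
  then show "cr i k j l = cr i j k l / (cr i j k l - 1)"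
    using 312 n1 by (simp add: field_simps)
qed

text \<open>
  The excluded value \<open>v = (B - C)/(B - A)\<close> is the one that the Moebius transformation
  \<open>cr A B C\<close> takes at infinity.
\<close>

lemma cr_solve:
  assumes "distinct [A, B, C]" "v \<noteq> 0" "v \<noteq> 1" "v * (B - A) \<noteq> B - C"
  shows "\<exists>z. z \<notin> {A, B, C} \<and> cr A B C z = v"
proof -
  define q where "q = (B - C) - v * (B - A)"
  define z where "z = (A * (B - C) - v * C * (B - A)) / q"
  have ne: "A \<noteq> B" "A \<noteq> C" "B \<noteq> C" using assms(1) by auto
  have q: "q \<noteq> 0" using assms(4) by (simp add: q_def)
  have zq: "z * q = A * (B - C) - v * C * (B - A)" using q by (simp add: z_def)
  have zA: "(z - A) * q = v * (B - A) * (A - C)"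
    unfolding left_diff_distrib zq by (simp add: q_def algebra_simps)
  have zC: "(z - C) * q = (B - C) * (A - C)"
    unfolding left_diff_distrib zq by (simp add: q_def algebra_simps)
  have zB: "(z - B) * q = (B - A) * (B - C) * (v - 1)"
    unfolding left_diff_distrib zq by (simp add: q_def algebra_simps)
  have nA: "z \<noteq> A" using zA assms(2) ne by auto
  have nB: "z \<noteq> B" using zB assms(3) ne by auto
  have nC: "z \<noteq> C" using zC ne by auto
  have "(z - A) * (B - C) * q = v * ((z - C) * (B - A)) * q"
    using zA zC by (metis (no_types, lifting) mult.assoc mult.commute)
  then have "(z - A) * (B - C) = v * ((z - C) * (B - A))" using q by simp
  then have "cr A B C z = v"
    using nC ne by (simp add: cr_def divide_simps)
  then show ?thesis using nA nB nC by blast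
qed

text \<open>
  Let \<open>N/M\<close> be a function that does not depend on the point with label \<open>d\<close>. If it never equals the cross-ratio,
  then the position \<open>z\<close> of \<open>d\<close> at which they would be equal is never available: it is infinity, or
  occupied by another point \<open>e\<close>. This is a disjunction of polynomial equations on all configurations, so one of
  them is an identity.
\<close>

lemma no_collision_dichotomy:
  assumes abcd: "distinct [a, b, c, d]" "{a, b, c, d} \<subseteq> {..n}"
    and NM: "line_poly N" "line_poly M"
    and nz: "\<And>w. inj_on w {..n} \<Longrightarrow> N w \<noteq> 0 \<and> M w \<noteq> 0 \<and> N w \<noteq> M w"
    and indep: "\<And>w z. N (w(d := z)) = N w" "\<And>w z. M (w(d := z)) = M w"
    and avoid: "\<And>w. inj_on w {..n} \<Longrightarrow> crw w a b c d \<noteq> N w / M w"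
  shows "(\<forall>w. N w * (w b - w a) = M w * (w b - w c)) \<or>
    (\<exists>e\<in>{..n} - {a, b, c, d}. \<forall>w.
       N w * ((w e - w c) * (w b - w a)) = M w * ((w e - w a) * (w b - w c)))"
proof -
  define P where "P = (\<lambda>e w. if e = d then N w * (w b - w a) - M w * (w b - w c)
      else N w * ((w e - w c) * (w b - w a)) - M w * ((w e - w a) * (w b - w c)))"
  have "\<exists>e\<in>{..n} - {a, b, c}. \<forall>w. P e w = 0"
  proof (rule line_poly_disjunction[where n = "Suc n"])
    show "line_poly (P e)" for e
      unfolding P_def
      by (cases "e = d", simp_all)
        (intro line_poly_diff line_poly_mult NM line_poly_coord)+
  next
    fix w :: "nat \<Rightarrow> complex" assume "inj_on w {..<Suc n}"
    then have w: "inj_on w {..n}" by (simp add: lessThan_Suc_atMost)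
    show "\<exists>e\<in>{..n} - {a, b, c}. P e w = 0"
    proof (rule ccontr)
      assume "\<not> ?thesis"
      then have none: "\<And>e. e \<in> {..n} - {a, b, c} \<Longrightarrow> P e w \<noteq> 0" by blast
      define v where "v = N w / M w"
      have v: "v \<noteq> 0" "v \<noteq> 1" using nz[OF w] by (auto simp: v_def)
      have dis: "distinct [w a, w b, w c]"
        using w abcd by (auto simp: inj_on_eq_iff)
      have "P d w \<noteq> 0" using none[of d] abcd by auto
      then have "v * (w b - w a) \<noteq> w b - w c"
        using nz[OF w] by (auto simp: v_def P_def field_simps)
      then obtain z where z: "z \<notin> {w a, w b, w c}" "cr (w a) (w b) (w c) z = v"
        using cr_solve[OF dis v] by blast
      have fresh: "z \<noteq> w e" if e: "e \<le> n" "e \<noteq> d" for e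
      proof
        assume zw: "z = w e"
        then have e': "e \<in> {..n} - {a, b, c}" using z(1) e by auto
        have "(w e - w a) * (w b - w c) / ((w e - w c) * (w b - w a)) = N w / M w"
          using z(2) unfolding zw by (simp add: cr_def v_def)
        moreover have "(w e - w c) * (w b - w a) \<noteq> 0"
          using z(1) dis unfolding zw by auto
        ultimately have "P e w = 0"
          using nz[OF w] e by (simp add: P_def frac_eq_eq mult.commute)
        then show False using none[OF e'] by simp
      qed
      then have "inj_on (w(d := z)) {..n}"
        using w by (auto simp: inj_on_def)
      moreover have "crw (w(d := z)) a b c d = N (w(d := z)) / M (w(d := z))"
        using z abcd(1) by (simp add: crw_def indep v_def)
      ultimately show False using avoid by blast
    qed
  qed simp
  then obtain e where e: "e \<in> {..n} - {a, b, c}" "\<And>w. P e w = 0" by blast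
  show ?thesis
  proof (cases "e = d")
    case True
    then show ?thesis using e by (auto simp: P_def)
  next
    case False
    then have "N w * ((w e - w c) * (w b - w a)) = M w * ((w e - w a) * (w b - w c))" for w
      using e(2)[of w] by (simp add: P_def)
    then show ?thesis using e False by blast
  qed
qed

text \<open>
  The case of a constant function in \<open>no_collision_dichotomy\<close>: neither of the two identities holds at all
  points with coordinates \<open>0\<close> and \<open>1\<close>.
\<close>

lemma cross_ratio_takes_all_values:
  assumes abcd: "distinct [a, b, c, d]" "{a, b, c, d} \<subseteq> {..n}" and t: "t \<noteq> 0" "t \<noteq> 1"
  shows "\<exists>w. inj_on w {..n} \<and> crw w a b c d = t"
proof (rule ccontr)
  assume "\<not> ?thesis"
  then have "\<And>w. inj_on w {..n} \<Longrightarrow> crw w a b c d \<noteq> t / 1" by auto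
  from no_collision_dichotomy[OF abcd line_poly_const line_poly_const _ _ _ this] t
  consider "\<forall>w :: nat \<Rightarrow> complex. t * (w b - w a) = 1 * (w b - w c)"
    | e where "e \<in> {..n} - {a, b, c, d}" "\<forall>w. t * ((w e - w c) * (w b - w a)) = 1 * ((w e - w a) * (w b - w c))"
    by auto
  then show False
  proof cases
    case 1
    from this[rule_format, of "\<lambda>v. if v = c then 1 else 0"] show False
      using abcd by (auto split: if_splits)
  next
    case 2
    from this(2)[rule_format, of "\<lambda>v. if v = a \<or> v = c then 1 else 0"] show False
      using abcd 2(1) t by (auto split: if_splits)
  qed
qed

lemma merge_two:
  assumes "p \<noteq> q"
  obtains w :: "nat \<Rightarrow> complex" where "w p = w q" "\<And>u v. u \<noteq> v \<Longrightarrow> w u = w v \<Longrightarrow> {u, v} = {p, q}"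
proof
  define w :: "nat \<Rightarrow> complex" where "w = (\<lambda>v. of_nat (if v = q then p else v))"
  show "w p = w q" by (simp add: w_def)
  show "u \<noteq> v \<Longrightarrow> w u = w v \<Longrightarrow> {u, v} = {p, q}" for u v
    by (auto simp: w_def split: if_splits)
qed

text \<open>
  In the identity provided by \<open>no_collision_dichotomy\<close>, merging two points whose difference divides \<open>N\<close> must
  annihilate the other side as well. This identifies the unordered pairs of labels that occur on both sides.
\<close>

lemma no_collision_imp_shared_triple:
  assumes abcd: "distinct [a, b, c, d]" "{a, b, c, d} \<subseteq> {..n}"
    and T: "distinct [p, q, r, s]" "{p, q, r, s} \<subseteq> {..n}" and d: "d \<notin> {p, q, r, s}"
    and avoid: "\<And>w. inj_on w {..n} \<Longrightarrow> crw w a b c d \<noteq> crw w p q r s"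
  shows "\<exists>e. distinct [a, b, c, e] \<and> e \<noteq> d \<and> {p, q, r, s} = {a, b, c, e} \<and>
    (\<forall>w. inj_on w {..n} \<longrightarrow> crw w p q r s = crw w a b c e)"
proof -
  define N where "N = (\<lambda>w :: nat \<Rightarrow> complex. (w s - w p) * (w q - w r))"
  define M where "M = (\<lambda>w :: nat \<Rightarrow> complex. (w s - w r) * (w q - w p))"
  have crNM: "crw w p q r s = N w / M w" for w
    by (simp add: crw_def cr_def N_def M_def)
  have lp: "line_poly N" "line_poly M"
    unfolding N_def M_def by (intro line_poly_diff line_poly_mult line_poly_coord)+
  have nz: "N w \<noteq> 0 \<and> M w \<noteq> 0 \<and> N w \<noteq> M w" if w: "inj_on w {..n}" for w
  proof -
    have dis: "distinct [w p, w q, w r, w s]"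
      using w T by (auto simp: inj_on_eq_iff)
    then have "N w \<noteq> 0" "M w \<noteq> 0" by (auto simp: N_def M_def)
    moreover have "crw w p q r s \<noteq> 1" using cr_perms(2)[OF dis] by (simp add: crw_def)
    ultimately show ?thesis unfolding crNM by auto
  qed
  have ind: "N (w(d := z)) = N w" "M (w(d := z)) = M w" for w z
    using d by (auto simp: N_def M_def)
  have pairs: "{s, p} \<noteq> {q, r}" "{s, p} \<noteq> {s, r}" "{s, p} \<noteq> {q, p}" "{q, r} \<noteq> {s, r}" "{q, r} \<noteq> {q, p}"
    using T by (auto simp: doubleton_eq_iff)
  obtain w1 :: "nat \<Rightarrow> complex" where w1: "w1 s = w1 p" "\<And>u v. u \<noteq> v \<Longrightarrow> w1 u = w1 v \<Longrightarrow> {u, v} = {s, p}"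
    using merge_two[of s p] T by auto
  have N1: "N w1 = 0" "M w1 \<noteq> 0"
    using w1(1) w1(2)[of s r] w1(2)[of q p] pairs T by (auto simp: N_def M_def)
  obtain w2 :: "nat \<Rightarrow> complex" where w2: "w2 q = w2 r" "\<And>u v. u \<noteq> v \<Longrightarrow> w2 u = w2 v \<Longrightarrow> {u, v} = {q, r}"
    using merge_two[of q r] T by auto
  have N2: "N w2 = 0" "M w2 \<noteq> 0"
    using w2(1) w2(2)[of s r] w2(2)[of q p] pairs T by (auto simp: N_def M_def)
  from no_collision_dichotomy[OF abcd lp nz ind] avoid crNM
  consider "\<forall>w. N w * (w b - w a) = M w * (w b - w c)"
    | e where "e \<in> {..n} - {a, b, c, d}"
      "\<forall>w. N w * ((w e - w c) * (w b - w a)) = M w * ((w e - w a) * (w b - w c))"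
    by auto
  then show ?thesis
  proof cases
    case 1
    then have "w1 b = w1 c" "w2 b = w2 c"
      using N1 N2 1[rule_format, of w1] 1[rule_format, of w2] by simp_all
    then have "{b, c} = {s, p}" "{b, c} = {q, r}"
      using w1(2)[of b c] w2(2)[of b c] abcd by auto
    then show ?thesis using pairs by auto
  next
    case 2
    have "w1 e = w1 a \<or> w1 b = w1 c" "w2 e = w2 a \<or> w2 b = w2 c"
      using N1 N2 2(2)[rule_format, of w1] 2(2)[rule_format, of w2] by simp_all
    then have "({e, a} = {s, p} \<or> {b, c} = {s, p}) \<and> ({e, a} = {q, r} \<or> {b, c} = {q, r})"
      using w1(2)[of e a] w1(2)[of b c] w2(2)[of e a] w2(2)[of b c] abcd 2(1) by auto
    then have "({e, a} = {s, p} \<and> {b, c} = {q, r}) \<or>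
      ({b, c} = {s, p} \<and> {e, a} = {q, r})"
      using pairs by metis
    note split = this
    have set: "{p, q, r, s} = {a, b, c, e}"
    proof -
      have "{p, q, r, s} = {s, p} \<union> {q, r}" by auto
      also have "\<dots> = {e, a} \<union> {b, c}"
        using split by (elim disjE conjE) (simp_all only: Un_commute)
      also have "\<dots> = {a, b, c, e}" by auto
      finally show ?thesis .
    qed
    have "crw w p q r s = crw w a b c e" if w: "inj_on w {..n}" for w
    proof -
      have "w e \<noteq> w c" "w b \<noteq> w a"
        using w abcd 2(1) by (auto simp: inj_on_eq_iff)
      then have "N w / M w = (w e - w a) * (w b - w c) / ((w e - w c) * (w b - w a))"
        using 2(2)[rule_format, of w] nz[OF w] by (subst frac_eq_eq) (auto simp: mult.commute)
      then show ?thesis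
        unfolding crNM by (simp add: crw_def cr_def)
    qed
    then show ?thesis using set 2(1) abcd by (intro exI[of _ e]) auto
  qed
qed

lemma crw_move_last:
  assumes T: "distinct [p, q, r, s]" and d: "d \<in> {p, q, r, s}"
  shows "\<exists>a b c. distinct [a, b, c, d] \<and> {a, b, c, d} = {p, q, r, s} \<and> (\<forall>w. crw w a b c d = crw w p q r s)"
proof -
  consider "d = p" | "d = q" | "d = r" | "d = s" using d by auto
  then show ?thesis
  proof cases
    case 1
    moreover have "crw w s r q d = crw w p q r s" for w
      unfolding 1 crw_def by (rule cr_double_swap(3))
    ultimately show ?thesis using T
      by (intro exI[of _ s] exI[of _ r] exI[of _ q]) auto
  next
    case 2
    moreover have "crw w r s p d = crw w p q r s" for w
      unfolding 2 crw_def by (rule cr_double_swap(2))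
    ultimately show ?thesis using T
      by (intro exI[of _ r] exI[of _ s] exI[of _ p]) auto
  next
    case 3
    moreover have "crw w q p s d = crw w p q r s" for w
      unfolding 3 crw_def by (rule cr_double_swap(1))
    ultimately show ?thesis using T
      by (intro exI[of _ q] exI[of _ p] exI[of _ s]) auto
  next
    case 4
    then show ?thesis using T
      by (intro exI[of _ p] exI[of _ q] exI[of _ r]) auto
  qed
qed

text \<open>
  The two functions differ by one of the six Moebius transformations that permute \<open>0, 1, \<infinity>\<close>, and each of
  these has a fixed point \<open>t\<close> other than \<open>0\<close>, \<open>1\<close> and \<open>\<infinity>\<close>.
\<close>

lemma same_labels_collide:
  assumes abcd: "distinct [a, b, c, d]" "{a, b, c, d} \<subseteq> {..n}"
    and T: "distinct [p, q, r, s]" "{p, q, r, s} = {a, b, c, d}"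
  shows "\<exists>w. inj_on w {..n} \<and> crw w p q r s = crw w a b c d"
proof -
  obtain x y z where xyz: "distinct [x, y, z, d]" "{x, y, z, d} = {p, q, r, s}"
    and eq: "\<And>w. crw w x y z d = crw w p q r s"
    using crw_move_last[OF T(1), of d] T(2) by auto
  have "{x, y, z} = {a, b, c}"
  proof -
    have "{x, y, z} = {x, y, z, d} - {d}" "{a, b, c} = {a, b, c, d} - {d}"
      using xyz abcd by auto
    then show ?thesis using xyz T by simp
  qed
  have "Complex (1/2) (sqrt 3 / 2) * (1 - Complex (1/2) (sqrt 3 / 2)) = 1"
    by (simp add: complex_eq_iff)
  then obtain \<omega> :: complex where om: "\<omega> * (1 - \<omega>) = 1" by blast
  have om0: "\<omega> \<noteq> 0" "\<omega> \<noteq> 1" using om by auto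
  have om1: "1 / \<omega> = 1 - \<omega>" "1 / (1 - \<omega>) = \<omega>"
    using om om0 by (auto simp: divide_eq_eq mult.commute)
  \<comment> \<open>the fixed points of \<open>1 - t\<close>, \<open>t/(t - 1)\<close>, \<open>1/t\<close> and of the two rotations; \<open>3\<close> is arbitrary\<close>
  define t where "t = (if x = a \<and> y = b then 3 else if x = b \<and> y = a then 1/2 else
    if x = a then 2 else if y = b then -1 else \<omega>)"
  have "t \<noteq> 0" "t \<noteq> 1" using om0 unfolding t_def by (simp_all split: if_split)
  then obtain w where w: "inj_on w {..n}" "crw w a b c d = t"
    using cross_ratio_takes_all_values[OF abcd] by blast
  have dis: "distinct [w a, w b, w c, w d]"
    using w(1) abcd by (auto simp: inj_on_eq_iff)
  have t: "cr (w a) (w b) (w c) (w d) = t" using w(2) by (simp only: crw_def)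
  have P: "crw w b a c d = 1 - t" "crw w c b a d = 1 / t" "crw w a c b d = t / (t - 1)"
    "crw w b c a d = 1 - 1 / t" "crw w c a b d = 1 / (1 - t)"
    using cr_perms(3-)[OF dis] unfolding t by (simp_all only: crw_def)
  have mem: "x \<in> {a, b, c}" "y \<in> {a, b, c}" "z \<in> {a, b, c}"
    using \<open>{x, y, z} = {a, b, c}\<close> by blast+
  consider "x = a" "y = b" "z = c" | "x = b" "y = a" "z = c" | "x = a" "y = c" "z = b" | "x = c" "y = b" "z = a"
    | "x = b" "y = c" "z = a" | "x = c" "y = a" "z = b"
    using mem xyz(1) by auto
  then have "crw w x y z d = t"
  proof cases
    case 1 then show ?thesis using w by simp
  next
    case 2 then show ?thesis using P(1) abcd by (simp add: t_def)
  next
    case 3 then show ?thesis using P(3) abcd by (simp add: t_def)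
  next
    case 4 then show ?thesis using P(2) abcd by (simp add: t_def)
  next
    case 5
    then have "t = \<omega>" using abcd by (auto simp: t_def)
    then show ?thesis using P(4) om1 5 by simp
  next
    case 6
    then have "t = \<omega>" using abcd by (auto simp: t_def)
    then show ?thesis using P(5) om1 6 by simp
  qed
  then show ?thesis using w eq by metis
qed

text \<open>
  At a configuration with cross-ratio \<open>3\<close>, the swapped ones are \<open>-2\<close>, \<open>3/2\<close> and \<open>1/3\<close>.
\<close>

lemma crw_swaps_differ:
  assumes "distinct [a, b, c, d]" "{a, b, c, d} \<subseteq> {..n}"
  shows "\<exists>w. inj_on w {..n} \<and> crw w a b c d \<noteq> crw w a b d c"
    "\<exists>w. inj_on w {..n} \<and> crw w a b c d \<noteq> crw w d b c a"
    "\<exists>w. inj_on w {..n} \<and> crw w a b c d \<noteq> crw w a d c b"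
proof -
  obtain w where w: "inj_on w {..n}" "crw w a b c d = 3"
    using cross_ratio_takes_all_values[OF assms, of 3] by auto
  have dis: "distinct [w a, w b, w c, w d]"
    using w(1) assms by (auto simp: inj_on_eq_iff)
  have t: "cr (w a) (w b) (w c) (w d) = 3" using w(2) by (simp only: crw_def)
  have "crw w a b d c = 1 - 3"
    using cr_perms(3)[OF dis] cr_double_swap(1)[of "w b" "w a" "w c" "w d"] unfolding t by (simp add: crw_def)
  moreover have "crw w d b c a = 3 / (3 - 1)"
    using cr_perms(5)[OF dis] cr_double_swap(3)[of "w a" "w c" "w b" "w d"] unfolding t by (simp add: crw_def)
  moreover have "crw w a d c b = 1 / 3"
    using cr_perms(4)[OF dis] cr_double_swap(2)[of "w c" "w b" "w a" "w d"] unfolding t by (simp add: crw_def)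
  ultimately show "\<exists>w. inj_on w {..n} \<and> crw w a b c d \<noteq> crw w a b d c"
    "\<exists>w. inj_on w {..n} \<and> crw w a b c d \<noteq> crw w d b c a"
    "\<exists>w. inj_on w {..n} \<and> crw w a b c d \<noteq> crw w a d c b"
    using w by (auto intro!: exI[of _ w])
qed

text \<open>
  If the labels of the third function include both \<open>d\<close> and \<open>e\<close>, they omit one of \<open>a, b, c\<close>. Comparing the
  function with the first and with the second one through that label expresses it by \<open>d\<close>, \<open>e\<close> and the two
  remaining labels in two ways, which differ by the exchange of \<open>d\<close> and \<open>e\<close>.
\<close>

lemma third_cross_ratio:
  assumes D: "distinct [a, b, c, d]" "{a, b, c, d} \<subseteq> {..n}"
    and E: "distinct [a, b, c, e]" "{a, b, c, e} \<subseteq> {..n}" and "d \<noteq> e"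
    and T: "distinct [p, q, r, s]" "{p, q, r, s} \<subseteq> {..n}"
    and av: "\<And>w. inj_on w {..n} \<Longrightarrow> crw w a b c d \<noteq> crw w p q r s"
      "\<And>w. inj_on w {..n} \<Longrightarrow> crw w a b c e \<noteq> crw w p q r s"
  shows "\<exists>g. distinct [a, b, c, g] \<and> {a, b, c, g} \<subseteq> {..n} \<and>
    (\<forall>w. inj_on w {..n} \<longrightarrow> crw w p q r s = crw w a b c g)"
proof -
  consider "d \<notin> {p, q, r, s}" | "e \<notin> {p, q, r, s}" | "d \<in> {p, q, r, s}" "e \<in> {p, q, r, s}" by blast
  then show ?thesis
  proof cases
    case 1
    from no_collision_imp_shared_triple[OF D T 1 av(1)] T show ?thesis by metis
  next
    case 2
    from no_collision_imp_shared_triple[OF E T 2 av(2)] T show ?thesis by metis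
  next
    case 3
    have "{p, q, r, s} \<noteq> {a, b, c, d}"
      using same_labels_collide[OF D T(1)] av(1) by metis
    moreover have "card {p, q, r, s} = card {a, b, c, d}" using T D by simp
    ultimately have "\<not> {a, b, c, d} \<subseteq> {p, q, r, s}"
      by (metis card_subset_eq finite.emptyI finite_insert)
    then consider "a \<notin> {p, q, r, s}" | "b \<notin> {p, q, r, s}" | "c \<notin> {p, q, r, s}"
      using 3 by auto
    then show ?thesis
    proof cases
      case 1
      have D': "distinct [d, c, b, a]" "{d, c, b, a} \<subseteq> {..n}" using D by auto
      have E': "distinct [e, c, b, a]" "{e, c, b, a} \<subseteq> {..n}" using E by auto
      have sw: "crw w d c b a = crw w a b c d" "crw w e c b a = crw w a b c e" for w
        unfolding crw_def by (rule cr_double_swap(3))+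
      obtain g where g: "{p, q, r, s} = {d, c, b, g}" "\<And>w. inj_on w {..n} \<Longrightarrow> crw w p q r s = crw w d c b g"
        using no_collision_imp_shared_triple[OF D' T 1] av(1) sw by metis
      obtain g' where g': "{p, q, r, s} = {e, c, b, g'}" "\<And>w. inj_on w {..n} \<Longrightarrow> crw w p q r s = crw w e c b g'"
        using no_collision_imp_shared_triple[OF E' T 1] av(2) sw by metis
      have "g = e" using g(1) 3 E \<open>d \<noteq> e\<close> by auto
      moreover have "g' = d" using g'(1) 3 D \<open>d \<noteq> e\<close> by auto
      moreover have "distinct [d, c, b, e]" "{d, c, b, e} \<subseteq> {..n}" using D E \<open>d \<noteq> e\<close> by auto
      ultimately show ?thesis
        using crw_swaps_differ(2)[of d c b e n] g(2) g'(2) by metis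
    next
      case 2
      have D': "distinct [c, d, a, b]" "{c, d, a, b} \<subseteq> {..n}" using D by auto
      have E': "distinct [c, e, a, b]" "{c, e, a, b} \<subseteq> {..n}" using E by auto
      have sw: "crw w c d a b = crw w a b c d" "crw w c e a b = crw w a b c e" for w
        unfolding crw_def by (rule cr_double_swap(2))+
      obtain g where g: "{p, q, r, s} = {c, d, a, g}" "\<And>w. inj_on w {..n} \<Longrightarrow> crw w p q r s = crw w c d a g"
        using no_collision_imp_shared_triple[OF D' T 2] av(1) sw by metis
      obtain g' where g': "{p, q, r, s} = {c, e, a, g'}" "\<And>w. inj_on w {..n} \<Longrightarrow> crw w p q r s = crw w c e a g'"
        using no_collision_imp_shared_triple[OF E' T 2] av(2) sw by metis
      have "g = e" using g(1) 3 E \<open>d \<noteq> e\<close> by auto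
      moreover have "g' = d" using g'(1) 3 D \<open>d \<noteq> e\<close> by auto
      moreover have "distinct [c, d, a, e]" "{c, d, a, e} \<subseteq> {..n}" using D E \<open>d \<noteq> e\<close> by auto
      ultimately show ?thesis
        using crw_swaps_differ(3)[of c d a e n] g(2) g'(2) by metis
    next
      case 3
      have D': "distinct [b, a, d, c]" "{b, a, d, c} \<subseteq> {..n}" using D by auto
      have E': "distinct [b, a, e, c]" "{b, a, e, c} \<subseteq> {..n}" using E by auto
      have sw: "crw w b a d c = crw w a b c d" "crw w b a e c = crw w a b c e" for w
        unfolding crw_def by (rule cr_double_swap(1))+
      obtain g where g: "{p, q, r, s} = {b, a, d, g}" "\<And>w. inj_on w {..n} \<Longrightarrow> crw w p q r s = crw w b a d g"
        using no_collision_imp_shared_triple[OF D' T 3] av(1) sw by metis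
      obtain g' where g': "{p, q, r, s} = {b, a, e, g'}" "\<And>w. inj_on w {..n} \<Longrightarrow> crw w p q r s = crw w b a e g'"
        using no_collision_imp_shared_triple[OF E' T 3] av(2) sw by metis
      have "g = e" using g(1) \<open>e \<in> _\<close> E \<open>d \<noteq> e\<close> by auto
      moreover have "g' = d" using g'(1) \<open>d \<in> _\<close> D \<open>d \<noteq> e\<close> by auto
      moreover have "distinct [b, a, d, e]" "{b, a, d, e} \<subseteq> {..n}" using D E \<open>d \<noteq> e\<close> by auto
      ultimately show ?thesis
        using crw_swaps_differ(1)[of b a d e n] g(2) g'(2) by metis
    qed
  qed
qed

text \<open>
  Two of the functions cannot have the same four labels, so one of them has a label \<open>d\<close> that the other lacks. This
  brings the two into the form \<open>(a, b, c, d)\<close> and \<open>(a, b, c, e)\<close>, and every other function follows by comparison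
  with both.
\<close>

lemma cross_ratio_family:
  fixes p q r s :: "'j \<Rightarrow> nat"
  assumes T: "\<And>j. j \<in> J \<Longrightarrow> distinct [p j, q j, r j, s j] \<and> {p j, q j, r j, s j} \<subseteq> {..n}"
    and av: "\<And>j k w. j \<in> J \<Longrightarrow> k \<in> J \<Longrightarrow> j \<noteq> k \<Longrightarrow> inj_on w {..n} \<Longrightarrow>
      crw w (p j) (q j) (r j) (s j) \<noteq> crw w (p k) (q k) (r k) (s k)"
    and "j0 \<in> J"
  shows "\<exists>a b c e. \<forall>j\<in>J. distinct [a, b, c, e j] \<and> {a, b, c, e j} \<subseteq> {..n} \<and>
    (\<forall>w. inj_on w {..n} \<longrightarrow> crw w (p j) (q j) (r j) (s j) = crw w a b c (e j))"
proof (cases "J = {j0}")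
  case True
  then show ?thesis
    using T by (intro exI[of _ "p j0"] exI[of _ "q j0"] exI[of _ "r j0"] exI[of _ s]) auto
next
  case False
  then obtain j1 where j1: "j1 \<in> J" "j1 \<noteq> j0" using \<open>j0 \<in> J\<close> by blast
  note T0 = T[OF \<open>j0 \<in> J\<close>] and T1 = T[OF j1(1)]
  have "{p j1, q j1, r j1, s j1} \<noteq> {p j0, q j0, r j0, s j0}"
    using same_labels_collide[of "p j0" "q j0" "r j0" "s j0" n "p j1" "q j1" "r j1" "s j1"]
      T0 T1 av[OF j1(1) \<open>j0 \<in> J\<close> j1(2)] by metis
  moreover have "card {p j1, q j1, r j1, s j1} = card {p j0, q j0, r j0, s j0}"
    using T0 T1 by simp
  ultimately have "\<not> {p j0, q j0, r j0, s j0} \<subseteq> {p j1, q j1, r j1, s j1}"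
    by (metis card_subset_eq finite.emptyI finite_insert)
  then obtain d where d: "d \<in> {p j0, q j0, r j0, s j0}" "d \<notin> {p j1, q j1, r j1, s j1}" by blast
  obtain a b c where D: "distinct [a, b, c, d]" "{a, b, c, d} = {p j0, q j0, r j0, s j0}"
    and f0: "\<And>w. crw w a b c d = crw w (p j0) (q j0) (r j0) (s j0)"
    using crw_move_last[OF _ d(1)] T0 by metis
  have Dn: "{a, b, c, d} \<subseteq> {..n}" using D T0 by simp
  obtain e where e: "distinct [a, b, c, e]" "e \<noteq> d" "{p j1, q j1, r j1, s j1} = {a, b, c, e}"
    and f1: "\<And>w. inj_on w {..n} \<Longrightarrow> crw w (p j1) (q j1) (r j1) (s j1) = crw w a b c e"
    using no_collision_imp_shared_triple[OF D(1) Dn, of "p j1" "q j1" "r j1" "s j1"] T1 d(2)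
      av[OF \<open>j0 \<in> J\<close> j1(1)] j1(2) f0 by metis
  have En: "{a, b, c, e} \<subseteq> {..n}" using e(3) T1 by simp
  have "\<exists>g. distinct [a, b, c, g] \<and> {a, b, c, g} \<subseteq> {..n} \<and>
    (\<forall>w. inj_on w {..n} \<longrightarrow> crw w (p k) (q k) (r k) (s k) = crw w a b c g)" if k: "k \<in> J" for k
  proof -
    consider "k = j0" | "k = j1" | "k \<noteq> j0" "k \<noteq> j1" by blast
    then show ?thesis
    proof cases
      case 1
      then show ?thesis using D(1) Dn f0 by metis
    next
      case 2
      then show ?thesis using e(1) En f1 by metis
    next
      case 3
      show ?thesis
        by (rule third_cross_ratio[OF D(1) Dn e(1) En e(2)[symmetric]])
          (use T[OF k] av[OF \<open>j0 \<in> J\<close> k] av[OF j1(1) k] 3 f0 f1 in auto)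
    qed
  qed
  then show ?thesis by metis
qed

section \<open>Charts of the projective line and the basic maps\<close>

text \<open>
  \<open>w\<close> arises from the homogeneous coordinates by a linear map of determinant \<open>- 1\<close> and the choice of
  representatives \<open>\<mu>\<close>; both cancel in a cross-ratio.
\<close>

lemma crw_eq_gcr:
  assumes \<mu>: "\<And>i. i \<le> n \<Longrightarrow> \<mu> i \<noteq> 0"
    and w: "\<And>i j. i \<le> n \<Longrightarrow> j \<le> n \<Longrightarrow> w i - w j = - (\<mu> i * \<mu> j * bracket x i j)"
    and "a \<le> n" "b \<le> n" "c \<le> n" "d \<le> n"
  shows "crw w a b c d = gcr x a b c d"
proof -
  have "crw w a b c d = (\<mu> d * \<mu> a * bracket x d a) / (\<mu> d * \<mu> c * bracket x d c) *
      ((\<mu> b * \<mu> c * bracket x b c) / (\<mu> b * \<mu> a * bracket x b a))"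
    using assms(3-) by (simp add: crw_def cr_def w)
  also have "\<dots> = gcr x a b c d"
    using \<mu>[of a] \<mu>[of b] \<mu>[of c] \<mu>[of d] assms(3-) by (simp add: gcr_def mult_ac)
  finally show ?thesis .
qed

text \<open>
  The Moebius transformation \<open>z \<mapsto> 1 / (z - w n)\<close> sends the point with label \<open>n\<close> to infinity.
\<close>

lemma PConf_of_finite_points:
  assumes w: "inj_on w {..n}"
  shows "\<exists>x\<in>PConf n. \<forall>a\<le>n. \<forall>b\<le>n. \<forall>c\<le>n. \<forall>d\<le>n. gcr x a b c d = crw w a b c d"
proof -
  define x where "x = map (\<lambda>i. 1 / (w i - w n)) [0..<n]"
  have ne: "w i - w n \<noteq> 0" if "i < n" for i
    using inj_on_eq_iff[OF w, of i n] that by simp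
  have "inj_on (\<lambda>i. 1 / (w i - w n)) {..<n}"
  proof (rule inj_onI)
    fix i j assume ij: "i \<in> {..<n}" "j \<in> {..<n}" "1 / (w i - w n) = 1 / (w j - w n)"
    then have "w i = w j" by simp
    then show "i = j" using inj_on_eq_iff[OF w, of i j] ij by simp
  qed
  then have x: "x \<in> PConf n"
    by (simp add: x_def PConf_def distinct_map lessThan_atLeast0)
  define \<mu> where "\<mu> = (\<lambda>i. if i < n then w i - w n else 1)"
  have "\<mu> i \<noteq> 0" if "i \<le> n" for i using ne that by (auto simp: \<mu>_def)
  moreover have "w i - w j = - (\<mu> i * \<mu> j * bracket x i j)" if "i \<le> n" "j \<le> n" for i j
  proof -
    have "u - v = - ((u - z) * (v - z) * (1 / (u - z) - 1 / (v - z)))" if "u - z \<noteq> 0" "v - z \<noteq> 0" for u v z :: complex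
    proof -
      have "1 / (u - z) - 1 / (v - z) = ((v - z) - (u - z)) / ((u - z) * (v - z))"
        using that by (simp add: diff_frac_eq)
      then show ?thesis using that by simp
    qed
    then show ?thesis
      using that ne[of i] ne[of j] by (auto simp: \<mu>_def bracket_def num_def den_def x_def)
  qed
  ultimately show ?thesis using crw_eq_gcr[of n \<mu> w x] x by metis
qed

text \<open>
  Conversely, \<open>z \<mapsto> 1 / (z + t)\<close> makes all points finite and sends infinity to \<open>0\<close>.
\<close>

lemma finite_points_of_PConf:
  assumes x: "x \<in> PConf n"
  shows "\<exists>w. inj_on w {..n} \<and> (\<forall>a\<le>n. \<forall>b\<le>n. \<forall>c\<le>n. \<forall>d\<le>n. gcr x a b c d = crw w a b c d)"
proof -
  obtain t where "t \<notin> (\<lambda>z. - z) ` set x"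
    using ex_new_if_finite[OF infinite_UNIV_char_0, of "(\<lambda>z. - z) ` set x"] by auto
  then have t: "x ! i + t \<noteq> 0" if "i < n" for i
    using that x nth_mem[of i x] by (auto simp: PConf_def image_iff add_eq_0_iff)
  have len: "length x = n" using x by (simp add: PConf_def)
  define w where "w = (\<lambda>i. if i < n then 1 / (x ! i + t) else 0)"
  define \<mu> where "\<mu> = (\<lambda>i. if i < n then 1 / (x ! i + t) else 1)"
  have \<mu>: "\<mu> i \<noteq> 0" for i using t by (auto simp: \<mu>_def)
  have eq: "w i - w j = - (\<mu> i * \<mu> j * bracket x i j)" if "i \<le> n" "j \<le> n" for i j
  proof -
    have fr: "1 / (u + t) - 1 / (v + t) = - (1 / (u + t) * (1 / (v + t)) * (u - v))"
      if "u + t \<noteq> 0" "v + t \<noteq> 0" for u v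
    proof -
      have "1 / (u + t) - 1 / (v + t) = ((v + t) - (u + t)) / ((u + t) * (v + t))"
        using that by (simp add: diff_frac_eq)
      then show ?thesis by (simp add: minus_divide_left)
    qed
    consider "i < n" "j < n" | "i < n" "j = n" | "i = n" "j < n" | "i = n" "j = n"
      using \<open>i \<le> n\<close> \<open>j \<le> n\<close> by linarith
    then show ?thesis
    proof cases
      case 1
      then show ?thesis
        using fr[OF t[of i] t[of j]] by (simp add: w_def \<mu>_def bracket_def num_def den_def len)
    qed (simp_all add: w_def \<mu>_def bracket_def num_def den_def len)
  qed
  have "inj_on w {..n}"
  proof (rule inj_onI, rule ccontr)
    fix i j assume ij: "i \<in> {..n}" "j \<in> {..n}" "w i = w j" "i \<noteq> j"
    then show False using eq[of i j] \<mu> bracket_nonzero[OF x, of i j] by auto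
  qed
  then show ?thesis using crw_eq_gcr[of n \<mu> w x, OF \<mu> eq] by metis
qed

lemma gcr_eq_via_finite_points:
  assumes eq: "\<And>w. inj_on w {..n} \<Longrightarrow> crw w p q r s = crw w a b c d"
    and "{p, q, r, s} \<subseteq> {..n}" "{a, b, c, d} \<subseteq> {..n}" "x \<in> PConf n"
  shows "gcr x p q r s = gcr x a b c d"
proof -
  obtain w where w: "inj_on w {..n}"
    and g: "\<And>a b c d. a \<le> n \<Longrightarrow> b \<le> n \<Longrightarrow> c \<le> n \<Longrightarrow> d \<le> n \<Longrightarrow> gcr x a b c d = crw w a b c d"
    using finite_points_of_PConf[OF assms(4)] by blast
  have "gcr x p q r s = crw w p q r s" "gcr x a b c d = crw w a b c d"
    using assms(2,3) by (auto intro!: g)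
  then show ?thesis using eq[OF w] by simp
qed

lemma permutation_extending_list:
  assumes "distinct L" "set L \<subseteq> {..<n}"
  shows "\<exists>\<sigma>. \<sigma> permutes {..<n} \<and>
    (\<forall>x :: 'a list. length x = n \<longrightarrow> take (length L) (permute_list \<sigma> x) = map ((!) x) L)"
proof -
  define L' where "L' = L @ sorted_list_of_set ({..<n} - set L)"
  have set: "set L' = {..<n}" and dis: "distinct L'"
    using assms by (auto simp: L'_def)
  have len: "length L' = n"
    using distinct_card[OF dis] set by simp
  define \<sigma> where "\<sigma> = (\<lambda>i. if i < n then L' ! i else i)"
  have "bij_betw ((!) L') {..<n} {..<n}"
    by (rule bij_betw_nth[OF dis]) (simp_all only: len set)
  then have "bij_betw \<sigma> {..<n} {..<n}"
    by (rule bij_betw_cong[THEN iffD1, rotated]) (simp add: \<sigma>_def)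
  then have "\<sigma> permutes {..<n}"
    by (rule bij_imp_permutes) (simp add: \<sigma>_def)
  moreover have "take (length L) (permute_list \<sigma> x) = map ((!) x) L" if "length x = n" for x :: "'a list"
  proof (rule nth_equalityI)
    have "length L \<le> n" using len by (simp add: L'_def)
    then show "length (take (length L) (permute_list \<sigma> x)) = length (map ((!) x) L)"
      using that by simp
    fix i assume "i < length (take (length L) (permute_list \<sigma> x))"
    then show "take (length L) (permute_list \<sigma> x) ! i = map ((!) x) L ! i"
      using that by (simp add: permute_list_def \<sigma>_def L'_def nth_append)
  qed
  ultimately show ?thesis by blast
qed

text \<open>
  An affine map is determined by its values at two points, so the twist is read off from the first two
  coordinates of \<open>h\<close> and \<open>q\<close>.
\<close>

lemma holomorphic_twist_exists:
  assumes m: "m \<ge> 2" and h: "holomorphic_map n m h"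
    and len: "\<And>x. x \<in> PConf n \<Longrightarrow> length (q x) = m"
    and hol: "\<And>i. i < m \<Longrightarrow> holomorphic_fun n (\<lambda>x. q x ! i)"
    and ne: "\<And>x. x \<in> PConf n \<Longrightarrow> q x ! 1 \<noteq> q x ! 0"
    and ratio: "\<And>x i. x \<in> PConf n \<Longrightarrow> i < m \<Longrightarrow>
      (h x ! i - h x ! 0) / (h x ! 1 - h x ! 0) = (q x ! i - q x ! 0) / (q x ! 1 - q x ! 0)"
  shows "\<exists>A. holomorphic_Aff n A \<and> (\<forall>x\<in>PConf n. h x = map (A x) (q x))"
proof -
  define \<alpha> where "\<alpha> = (\<lambda>x. (h x ! 1 - h x ! 0) / (q x ! 1 - q x ! 0))"
  define \<beta> where "\<beta> = (\<lambda>x. h x ! 0 - \<alpha> x * q x ! 0)"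
  define A where "A = (\<lambda>x z. \<alpha> x * z + \<beta> x)"
  have hx: "length (h x) = m" "distinct (h x)" if "x \<in> PConf n" for x
    using h that by (auto simp: holomorphic_map_def PConf_def Pi_iff)
  have hne: "h x ! 1 \<noteq> h x ! 0" if "x \<in> PConf n" for x
    using hx[OF that] m by (simp add: nth_eq_iff_index_eq)
  have hh: "holomorphic_fun n (\<lambda>x. h x ! i)" if "i < m" for i
    using h that by (simp add: holomorphic_map_def)
  have \<alpha>: "holomorphic_fun n \<alpha>"
    unfolding \<alpha>_def using m ne by (intro holomorphic_fun_divide holomorphic_fun_diff hh hol) auto
  then have \<beta>: "holomorphic_fun n \<beta>"
    unfolding \<beta>_def using m by (intro holomorphic_fun_diff holomorphic_fun_mult hh hol) auto
  have "\<alpha> x \<noteq> 0" if "x \<in> PConf n" for x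
    using ne[OF that] hne[OF that] by (simp add: \<alpha>_def)
  then have "A \<in> PConf n \<rightarrow> Aff"
    by (auto simp: A_def Aff_def)
  then have "holomorphic_Aff n A"
    using \<alpha> \<beta> by (auto simp: holomorphic_Aff_def A_def)
  moreover have "h x = map (A x) (q x)" if x: "x \<in> PConf n" for x
  proof (rule nth_equalityI)
    show "length (h x) = length (map (A x) (q x))" using hx len x by simp
    fix i assume "i < length (h x)"
    then have i: "i < m" using hx x by simp
    have "h x ! 1 - h x ! 0 \<noteq> 0" "q x ! 1 - q x ! 0 \<noteq> 0" using hne[OF x] ne[OF x] by auto
    then have "h x ! i - h x ! 0 = \<alpha> x * (q x ! i - q x ! 0)"
      using ratio[OF x i] by (simp add: \<alpha>_def divide_eq_eq)
    then show "h x ! i = map (A x) (q x) ! i"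
      using i len[OF x] by (simp add: A_def \<beta>_def algebra_simps)
  qed
  ultimately show ?thesis by blast
qed

text \<open>
  The chart \<open>\<Psi>\<close> sends label \<open>c\<close> to infinity, as does \<open>gcr x a b c\<close>, so they differ by an affine map. In this
  chart the label \<open>n\<close>, which is infinity, sits at \<open>0\<close>; this is the first coordinate of \<open>NI\<close>.
\<close>

lemma gcr_reciprocal:
  assumes x: "x \<in> PConf n" and "distinct [a, b, c]" "c < n" "a \<le> n" "b \<le> n" "l \<le> n" "l \<noteq> c"
  defines "\<Psi> \<equiv> \<lambda>l. if l = n then 0 else 1 / (x ! l - x ! c)"
  shows "gcr x a b c l = (\<Psi> l - \<Psi> a) / (\<Psi> b - \<Psi> a)" "\<Psi> b \<noteq> \<Psi> a"
proof -
  have len: "length x = n" using x by (simp add: PConf_def)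
  have \<Psi>: "\<Psi> i = den x i / bracket x i c" if "i \<le> n" for i
    using that assms(3) by (auto simp: \<Psi>_def den_def bracket_def num_def len)
  have dc: "den x c = 1" using assms(3) by (simp add: den_def len)
  have diff: "\<Psi> i - \<Psi> a = - bracket x i a / (bracket x i c * bracket x a c)" if "i \<le> n" "i \<noteq> c" for i
  proof -
    have nz: "bracket x i c \<noteq> 0" "bracket x a c \<noteq> 0"
      using bracket_nonzero[OF x] that assms by auto
    have "den x i * bracket x a c - den x a * bracket x i c = - bracket x i a"
      by (simp add: bracket_def dc algebra_simps)
    then show ?thesis
      using nz that \<open>a \<le> n\<close> by (simp add: \<Psi> diff_frac_eq)
  qed
  have nz: "bracket x b a \<noteq> 0" "bracket x b c \<noteq> 0" "bracket x a c \<noteq> 0" "bracket x l c \<noteq> 0"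
    using bracket_nonzero[OF x] assms by auto
  have "\<Psi> b - \<Psi> a \<noteq> 0" using diff[of b] assms nz by simp
  then show "\<Psi> b \<noteq> \<Psi> a" by simp
  show "gcr x a b c l = (\<Psi> l - \<Psi> a) / (\<Psi> b - \<Psi> a)"
    using diff[of b] diff[of l] assms nz by (simp add: gcr_def)
qed

lemma gcr_infinity:
  assumes "x \<in> PConf n" "a < n" "b < n" "l < n"
  shows "gcr x a b n l = (x ! l - x ! a) / (x ! b - x ! a)"
proof -
  have "gcr x a b n l = - (x ! l - x ! a) / - (x ! b - x ! a)"
    using assms by (simp add: gcr_def bracket_def num_def den_def PConf_def)
  then show ?thesis by (simp only: minus_divide_divide)
qed

lemma gcr_finite:
  assumes "x \<in> PConf n" "a < n" "b < n" "c < n" "l < n"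
  shows "gcr x a b c l = cr (x ! a) (x ! b) (x ! c) (x ! l)"
proof -
  have br: "bracket x i j = x ! i - x ! j" if "i < n" "j < n" for i j
    using that assms(1) by (simp add: bracket_def num_def den_def PConf_def)
  show ?thesis
    unfolding gcr_def cr_def times_divide_times_eq using assms(2-) by (simp only: br)
qed

text \<open>
  The coordinates of \<open>h\<close> are, up to an affine twist, those of the points \<open>a, b, M\<close> in a chart that sends \<open>c\<close> to
  infinity. If \<open>c\<close> is infinity itself, no change of chart is needed; if infinity is one of the listed labels, the chart
  is that of \<open>NI\<close>; and if it is not, the chart is that of \<open>RQ\<close>, with \<open>c\<close> in third place.
\<close>

lemma realize_cross_ratio_family:
  assumes m: "m \<ge> 2" and h: "holomorphic_map n m h"
    and Lab: "distinct (c # a # b # M)" "set (c # a # b # M) \<subseteq> {..n}" "length M = m - 2"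
    and ratio: "\<And>x i. x \<in> PConf n \<Longrightarrow> i < m \<Longrightarrow>
      (h x ! i - h x ! 0) / (h x ! 1 - h x ! 0) = gcr x a b c ((a # b # M) ! i)"
  shows "\<exists>\<sigma> \<tau> A g.
           \<sigma> permutes {..<n} \<and> \<tau> permutes {..<m} \<and>
           holomorphic_Aff n A \<and> basic_composition n m g \<and>
           (\<forall>x\<in>PConf n. h x = affine_twist A (permute_list \<tau> \<circ> g \<circ> permute_list \<sigma>) x)"
proof -
  define L where "L = a # b # M"
  have L: "length L = m" "distinct L" "c \<notin> set L" "set L \<subseteq> {..n}" "c \<le> n" "a \<noteq> b" "a \<noteq> c" "b \<noteq> c" "a \<le> n" "b \<le> n"
    using Lab m by (auto simp: L_def)
  have L01: "L ! 0 = a" "L ! 1 = b" by (simp_all add: L_def)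
  have Lle: "L ! i \<le> n" "L ! i \<noteq> c" if "i < m" for i
    using L that nth_mem[of i L] by (metis atMost_iff subsetD)+
  have hx: "length (h x) = m" "distinct (h x)" if "x \<in> PConf n" for x
    using h that by (auto simp: holomorphic_map_def PConf_def Pi_iff)
  have finish: ?thesis
    if \<sigma>: "\<sigma> permutes {..<n}" and \<tau>: "\<tau> permutes {..<m}" and g: "basic_composition n m g"
      and Q: "\<And>x i. x \<in> PConf n \<Longrightarrow> i < m \<Longrightarrow> (permute_list \<tau> \<circ> g \<circ> permute_list \<sigma>) x ! i = Q x i"
      and len: "\<And>x. x \<in> PConf n \<Longrightarrow> length (g (permute_list \<sigma> x)) = m"
      and hol: "\<And>i. i < m \<Longrightarrow> holomorphic_fun n (\<lambda>x. Q x i)"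
      and ne: "\<And>x. x \<in> PConf n \<Longrightarrow> Q x 1 \<noteq> Q x 0"
      and rat: "\<And>x i. x \<in> PConf n \<Longrightarrow> i < m \<Longrightarrow> gcr x a b c (L ! i) = (Q x i - Q x 0) / (Q x 1 - Q x 0)"
    for \<sigma> \<tau> g Q
  proof -
    let ?q = "permute_list \<tau> \<circ> g \<circ> permute_list \<sigma>"
    have m01: "0 < m" "1 < m" using m by auto
    have "\<exists>A. holomorphic_Aff n A \<and> (\<forall>x\<in>PConf n. h x = map (A x) (?q x))"
    proof (rule holomorphic_twist_exists[OF m h])
      show "length (?q x) = m" if "x \<in> PConf n" for x using len[OF that] by simp
      show "holomorphic_fun n (\<lambda>x. ?q x ! i)" if "i < m" for i
        using hol[OF that] holomorphic_fun_cong[of n "\<lambda>x. ?q x ! i" "\<lambda>x. Q x i"] Q that by blast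
      show "?q x ! 1 \<noteq> ?q x ! 0" if "x \<in> PConf n" for x
        using ne[OF that] Q[OF that m01(1)] Q[OF that m01(2)] by metis
      show "(h x ! i - h x ! 0) / (h x ! 1 - h x ! 0) = (?q x ! i - ?q x ! 0) / (?q x ! 1 - ?q x ! 0)"
        if "x \<in> PConf n" "i < m" for x i
        unfolding Q[OF that] Q[OF that(1) m01(1)] Q[OF that(1) m01(2)]
        using ratio[OF that] rat[OF that] by (simp add: L_def)
    qed
    then show ?thesis using \<sigma> \<tau> g unfolding affine_twist_def by blast
  qed
  consider (inf) "c = n" | (rec) "c < n" "n \<in> set L" | (fin) "c < n" "n \<notin> set L"
    using L by linarith
  then show ?thesis
  proof cases
    case inf
    have Ln: "set L \<subseteq> {..<n}"
    proof
      fix l assume "l \<in> set L"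
      then have "l \<le> n" "l \<noteq> n" using L(3,4) inf by auto
      then show "l \<in> {..<n}" by simp
    qed
    obtain \<sigma> where \<sigma>: "\<sigma> permutes {..<n}" and tk: "\<And>x :: complex list. length x = n \<Longrightarrow> take m (permute_list \<sigma> x) = map ((!) x) L"
      using permutation_extending_list[OF L(2) Ln] L(1) by metis
    have lt: "L ! i < n" if "i < m" for i using Ln L(1) that by (metis lessThan_iff nth_mem subsetD)
    have "m \<le> n" using card_mono[OF _ Ln] distinct_card[OF L(2)] L(1) by simp
    show ?thesis
    proof (rule finish[OF \<sigma> permutes_id, of "take m" "\<lambda>x i. x ! (L ! i)"])
      show "basic_composition n m (take m)"
        by (intro basic_composition.single basic_map.forget \<open>m \<le> n\<close>)
      show "(permute_list id \<circ> take m \<circ> permute_list \<sigma>) x ! i = x ! (L ! i)" if "x \<in> PConf n" "i < m" for x i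
        using tk[of x] that L(1) by (simp add: PConf_def)
      show "length (take m (permute_list \<sigma> x)) = m" if "x \<in> PConf n" for x
        using tk[of x] that L(1) by (simp add: PConf_def)
      show "holomorphic_fun n (\<lambda>x. x ! (L ! i))" if "i < m" for i
        by (rule holomorphic_fun_nth[OF lt[OF that]])
      show "x ! (L ! 1) \<noteq> x ! (L ! 0)" if "x \<in> PConf n" for x
        using that L lt[of 0] lt[of 1] m unfolding L01 by (simp add: PConf_def nth_eq_iff_index_eq)
      show "gcr x a b c (L ! i) = (x ! (L ! i) - x ! (L ! 0)) / (x ! (L ! 1) - x ! (L ! 0))"
        if "x \<in> PConf n" "i < m" for x i
        using gcr_infinity[OF that(1), of a b "L ! i"] lt[OF that(2)] lt[of 0] lt[of 1] m inf
        unfolding L01 by simp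
    qed
  next
    case rec
    then obtain r where r: "r < m" "L ! r = n" using L(1) by (metis in_set_conv_nth)
    \<comment> \<open>\<open>NI\<close> puts infinity first, whereas it is at position \<open>r\<close> in \<open>L\<close>\<close>
    define \<tau> where "\<tau> = Transposition.transpose 0 r"
    have \<tau>: "\<tau> permutes {..<m}" unfolding \<tau>_def using r m by (intro permutes_swap_id) auto
    define K where "K = L[r := L ! 0, 0 := c]"
    have lenK: "length K = m" by (simp add: K_def L)
    have Knth: "K ! i = (if i = 0 then c else L ! (\<tau> i))" if "i < m" for i
      using that r L(1) by (auto simp: K_def nth_list_update \<tau>_def Transposition.transpose_def)
    have Lr: "L ! i = n \<longleftrightarrow> i = r" if "i < m" for i
      using nth_eq_iff_index_eq[OF L(2), of i r] r that L(1) by simp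
    have \<tau>m: "\<tau> i < m" "\<tau> i = r \<longleftrightarrow> i = 0" "\<tau> i = 0 \<longleftrightarrow> i = r" "\<tau> (\<tau> i) = i" if "i < m" for i
      using that r m by (auto simp: \<tau>_def Transposition.transpose_def)
    have Kn: "set K \<subseteq> {..<n}"
    proof
      fix k assume "k \<in> set K"
      then obtain i where i: "i < m" "k = K ! i" using lenK by (metis in_set_conv_nth)
      show "k \<in> {..<n}"
      proof (cases "i = 0")
        case False
        then have "\<tau> i < m" "\<tau> i \<noteq> r" using \<tau>m i by auto
        then have "L ! (\<tau> i) \<noteq> n" "L ! (\<tau> i) \<le> n" using Lr Lle by auto
        then show ?thesis using i False Knth by simp
      qed (use i Knth rec in simp)
    qed
    have "distinct K"
      unfolding distinct_conv_nth lenK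
    proof (intro allI impI)
      fix i j assume "i < m" "j < m" "i \<noteq> j"
      moreover from this have "L ! \<tau> i \<noteq> L ! \<tau> j"
        using nth_eq_iff_index_eq[OF L(2), of "\<tau> i" "\<tau> j"] \<tau>m L(1) by metis
      ultimately show "K ! i \<noteq> K ! j"
        using Knth Lle(2)[of "\<tau> i"] Lle(2)[of "\<tau> j"] \<tau>m by auto
    qed
    obtain \<sigma> where \<sigma>: "\<sigma> permutes {..<n}" and tk: "\<And>x :: complex list. length x = n \<Longrightarrow> take m (permute_list \<sigma> x) = map ((!) x) K"
      using permutation_extending_list[OF \<open>distinct K\<close> Kn] lenK by metis
    have "m \<le> n" using card_mono[OF _ Kn] distinct_card[OF \<open>distinct K\<close>] lenK by simp
    define \<Psi> where "\<Psi> = (\<lambda>(x :: complex list) l. if l = n then 0 else 1 / (x ! l - x ! c))"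
    have ni: "length (NI (map ((!) x) K)) = m" "\<And>i. i < m \<Longrightarrow> NI (map ((!) x) K) ! i = \<Psi> x (L ! (\<tau> i))"
      if x: "x \<in> PConf n" for x
    proof -
      show "length (NI (map ((!) x) K)) = m" using lenK m by (simp add: NI_def)
      fix i assume i: "i < m"
      show "NI (map ((!) x) K) ! i = \<Psi> x (L ! (\<tau> i))"
      proof (cases i)
        case 0
        then show ?thesis using \<tau>m(2)[OF i] r by (simp add: NI_def \<Psi>_def)
      next
        case (Suc j)
        then have "\<tau> i \<noteq> r" "\<tau> i < m" using \<tau>m i by auto
        then have "L ! (\<tau> i) \<noteq> n" using Lr by simp
        then show ?thesis using Suc i lenK Knth[of i] Knth[of 0] by (simp add: NI_def \<Psi>_def)
      qed
    qed
    show ?thesis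
    proof (rule finish[OF \<sigma> \<tau>, of "NI \<circ> take m" "\<lambda>x i. \<Psi> x (L ! i)"])
      show "basic_composition n m (NI \<circ> take m)"
        using m \<open>m \<le> n\<close>
        by (intro basic_composition.comp[of n m] basic_composition.single basic_map.forget basic_map.NI) auto
      show "length ((NI \<circ> take m) (permute_list \<sigma> x)) = m" if "x \<in> PConf n" for x
        using tk[of x] ni(1)[OF that] that by (simp add: PConf_def)
      show "(permute_list \<tau> \<circ> (NI \<circ> take m) \<circ> permute_list \<sigma>) x ! i = \<Psi> x (L ! i)"
        if x: "x \<in> PConf n" and i: "i < m" for x i
      proof -
        have "(permute_list \<tau> \<circ> (NI \<circ> take m) \<circ> permute_list \<sigma>) x ! i = NI (map ((!) x) K) ! (\<tau> i)"
          using tk[of x] ni(1)[OF x] x i \<tau> by (simp add: PConf_def permute_list_nth)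
        then show ?thesis using ni(2)[OF x \<tau>m(1)[OF i]] \<tau>m(4)[OF i] by simp
      qed
      show "holomorphic_fun n (\<lambda>x. \<Psi> x (L ! i))" if i: "i < m" for i
      proof (cases "L ! i = n")
        case True
        then show ?thesis by (simp add: \<Psi>_def holomorphic_fun_const)
      next
        case False
        then have "L ! i < n" "L ! i \<noteq> c" using Lle[OF i] by auto
        then show ?thesis
          unfolding \<Psi>_def using False rec
          by (simp, intro holomorphic_fun_divide holomorphic_fun_const holomorphic_fun_diff holomorphic_fun_nth)
            (auto simp: PConf_def nth_eq_iff_index_eq)
      qed
      show "\<Psi> x (L ! 1) \<noteq> \<Psi> x (L ! 0)" if "x \<in> PConf n" for x
        using gcr_reciprocal(2)[OF that _ rec(1), of a b a] L unfolding L01 \<Psi>_def by simp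
      show "gcr x a b c (L ! i) = (\<Psi> x (L ! i) - \<Psi> x (L ! 0)) / (\<Psi> x (L ! 1) - \<Psi> x (L ! 0))"
        if "x \<in> PConf n" "i < m" for x i
        using gcr_reciprocal(1)[OF that(1) _ rec(1), of a b "L ! i"] L Lle[OF that(2)]
        unfolding L01 \<Psi>_def by simp
    qed
  next
    case fin
    define K where "K = a # b # c # M"
    have K: "length K = m + 1" "distinct K" "set K \<subseteq> {..<n}"
    proof -
      show "length K = m + 1" using Lab m by (simp add: K_def)
      show "distinct K" using Lab by (auto simp: K_def)
      have "k < n" if "k \<in> set L" for k
        using L(4) fin(2) that by (metis atMost_iff le_neq_implies_less subsetD)
      then show "set K \<subseteq> {..<n}" using fin(1) by (auto simp: K_def L_def)
    qed
    obtain \<sigma> where \<sigma>: "\<sigma> permutes {..<n}" and tk: "\<And>x :: complex list. length x = n \<Longrightarrow> take (m + 1) (permute_list \<sigma> x) = map ((!) x) K"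
      using permutation_extending_list[OF K(2,3)] K(1) by metis
    have "m + 1 \<le> n" using card_mono[OF _ K(3)] distinct_card[OF K(2)] K(1) by simp
    have rq: "length (RQ (map ((!) x) K)) = m" "\<And>i. i < m \<Longrightarrow> RQ (map ((!) x) K) ! i = gcr x a b c (L ! i)"
      if x: "x \<in> PConf n" for x
    proof -
      have RQ: "RQ (map ((!) x) K) = 0 # 1 # map (\<lambda>l. cr (x ! a) (x ! b) (x ! c) (x ! l)) M"
        by (simp add: RQ_def K_def o_def)
      then show "length (RQ (map ((!) x) K)) = m" using Lab m by simp
      fix i assume i: "i < m"
      show "RQ (map ((!) x) K) ! i = gcr x a b c (L ! i)"
      proof (cases "i < 2")
        case True
        then have "i = 0 \<or> i = 1" by auto
        then show ?thesis
          using bracket_nonzero[OF x, of b a] bracket_nonzero[OF x, of b c] L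
          unfolding RQ by (auto simp: gcr_def L_def bracket_def)
      next
        case False
        then obtain j where j: "i = Suc (Suc j)" by (metis One_nat_def Suc_1 Suc_le_D not_less Suc_le_mono)
        then have "j < length M" using i Lab by simp
        then have "M ! j \<in> set K" by (simp add: K_def)
        then have "M ! j < n" using K(3) by blast
        then show ?thesis
          using gcr_finite[OF x, of a b c "M ! j"] K(3) j \<open>j < length M\<close> unfolding RQ by (simp add: L_def K_def)
      qed
    qed
    show ?thesis
    proof (rule finish[OF \<sigma> permutes_id, of "RQ \<circ> take (m + 1)" "\<lambda>x i. gcr x a b c (L ! i)"])
      have "basic_map (m + 1) m RQ"
        using basic_map.RQ[of "m + 1"] m by simp
      then show "basic_composition n m (RQ \<circ> take (m + 1))"
        using \<open>m + 1 \<le> n\<close> by (intro basic_composition.comp[of n "m + 1"] basic_composition.single basic_map.forget)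
      show "length ((RQ \<circ> take (m + 1)) (permute_list \<sigma> x)) = m" if "x \<in> PConf n" for x
        using tk[of x] rq(1)[OF that] that by (simp add: PConf_def)
      show "(permute_list id \<circ> (RQ \<circ> take (m + 1)) \<circ> permute_list \<sigma>) x ! i = gcr x a b c (L ! i)"
        if x: "x \<in> PConf n" and i: "i < m" for x i
        using tk[of x] rq(2)[OF x i] x by (simp add: PConf_def)
      have hne: "h x ! 1 - h x ! 0 \<noteq> 0" if "x \<in> PConf n" for x
        using hx[OF that] m by (simp add: nth_eq_iff_index_eq)
      have hh: "holomorphic_fun n (\<lambda>x. h x ! i)" if "i < m" for i
        using h that by (simp add: holomorphic_map_def)
      show "holomorphic_fun n (\<lambda>x. gcr x a b c (L ! i))" if i: "i < m" for i
      proof -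
        have "holomorphic_fun n (\<lambda>x. (h x ! i - h x ! 0) / (h x ! 1 - h x ! 0))"
          using i m hne by (intro holomorphic_fun_divide holomorphic_fun_diff hh) auto
        then show ?thesis
          using holomorphic_fun_cong[of n "\<lambda>x. (h x ! i - h x ! 0) / (h x ! 1 - h x ! 0)" "\<lambda>x. gcr x a b c (L ! i)"]
            ratio[OF _ i] by (simp add: L_def)
      qed
      have g01: "gcr x a b c (L ! 0) = 0" "gcr x a b c (L ! 1) = 1" if "x \<in> PConf n" for x
        using bracket_nonzero[OF that, of b a] bracket_nonzero[OF that, of b c] L
        unfolding L01 by (auto simp: gcr_def bracket_def)
      show "gcr x a b c (L ! 1) \<noteq> gcr x a b c (L ! 0)" if "x \<in> PConf n" for x
        using g01[OF that] by simp
      show "gcr x a b c (L ! i) = (gcr x a b c (L ! i) - gcr x a b c (L ! 0)) / (gcr x a b c (L ! 1) - gcr x a b c (L ! 0))"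
        if "x \<in> PConf n" "i < m" for x i
        using g01[OF that(1)] by simp
    qed
  qed
qed

theorem theorem4p3:
  fixes n m :: nat and h :: "complex list \<Rightarrow> complex list"
  assumes "m \<ge> 2"
    and "holomorphic_map n m h"
  shows "\<exists>\<sigma> \<tau> A g.
           \<sigma> permutes {..<n} \<and> \<tau> permutes {..<m} \<and>
           holomorphic_Aff n A \<and> basic_composition n m g \<and>
           (\<forall>x\<in>PConf n. h x = affine_twist A (permute_list \<tau> \<circ> g \<circ> permute_list \<sigma>) x)"
proof -
  note m = assms(1) and h = assms(2)
  have hx: "length (h x) = m" "distinct (h x)" if "x \<in> PConf n" for x
    using h that by (auto simp: holomorphic_map_def PConf_def Pi_iff)
  have hneq: "h x ! i \<noteq> h x ! j" if "x \<in> PConf n" "i < m" "j < m" "i \<noteq> j" for x i j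
    using hx[OF that(1)] that by (simp add: nth_eq_iff_index_eq)
  have hh: "holomorphic_fun n (\<lambda>x. h x ! i)" if "i < m" for i
    using h that by (simp add: holomorphic_map_def)
  define f where "f = (\<lambda>i x. (h x ! i - h x ! 0) / (h x ! 1 - h x ! 0))"
  have den: "h x ! 1 - h x ! 0 \<noteq> 0" if "x \<in> PConf n" for x
    using hneq[OF that, of 1 0] m by simp
  have fhol: "holomorphic_fun n (f i)" if "i < m" for i
    unfolding f_def using that m den by (intro holomorphic_fun_divide holomorphic_fun_diff hh) auto
  have fneq: "f i x \<noteq> f j x" if "x \<in> PConf n" "i < m" "j < m" "i \<noteq> j" for x i j
    using hneq[OF that] den[OF that(1)] by (simp add: f_def)
  have f01: "f 0 x = 0" "f 1 x = 1" if "x \<in> PConf n" for x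
    using den[OF that] by (simp_all add: f_def)
  obtain x0 where x0: "x0 \<in> PConf n"
    using ex_distinct_avoiding[of "{}" n] by auto
  have omit: "f i x \<noteq> 0 \<and> f i x \<noteq> 1" if "x \<in> PConf n" "i < m" "i \<ge> 2" for x i
    using fneq[OF that(1,2), of 0] fneq[OF that(1,2), of 1] f01[OF that(1)] that m by auto
  show ?thesis
  proof (cases "\<forall>i\<in>{2..<m}. \<exists>k. \<forall>x\<in>PConf n. f i x = k")
    case True
    have const: "f i x = f i x0" if "i < m" "x \<in> PConf n" for i x
    proof -
      consider "i = 0" | "i = 1" | "i \<in> {2..<m}" using \<open>i < m\<close> by fastforce
      then show ?thesis
      proof cases
        case 3
        then obtain k where "\<forall>x\<in>PConf n. f i x = k" using True by blast
        then show ?thesis using that(2) x0 by simp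
      qed (use f01 that(2) x0 in simp_all)
    qed
    define p where "p = map (\<lambda>i. f i x0) [0..<m]"
    have p: "p \<in> PConf m"
      using fneq[OF x0] by (auto simp: p_def PConf_def distinct_conv_nth)
    have p01: "p ! 0 = 0" "p ! 1 = 1" using f01[OF x0] m by (simp_all add: p_def)
    have "\<exists>A. holomorphic_Aff n A \<and> (\<forall>x\<in>PConf n. h x = map (A x) p)"
    proof (rule holomorphic_twist_exists[OF m h])
      show "(h x ! i - h x ! 0) / (h x ! 1 - h x ! 0) = (p ! i - p ! 0) / (p ! 1 - p ! 0)"
        if "x \<in> PConf n" "i < m" for x i
        using const[OF that(2,1)] that unfolding p01 by (simp add: f_def p_def)
    qed (use p01 in \<open>auto simp: holomorphic_fun_const p_def\<close>)
    then obtain A where A: "holomorphic_Aff n A" "\<And>x. x \<in> PConf n \<Longrightarrow> h x = map (A x) p" by blast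
    show ?thesis
    proof (intro exI conjI ballI)
      show "id permutes {..<n}" "id permutes {..<m}" by (rule permutes_id)+
      show "basic_composition n m (\<lambda>_. p)"
        by (intro basic_composition.single basic_map.const p)
      show "h x = affine_twist A (permute_list id \<circ> (\<lambda>_. p) \<circ> permute_list id) x" if "x \<in> PConf n" for x
        using A(2)[OF that] by (simp add: affine_twist_def)
    qed (rule A)
  next
    case False
    define good where "good = (\<lambda>i a b c d. distinct [a, b, c, d] \<and> {a, b, c, d} \<subseteq> {..n} \<and>
      (\<forall>x\<in>PConf n. f i x = gcr x a b c d))"
    have dich: "(\<exists>k. \<forall>x\<in>PConf n. f i x = k) \<or> (\<exists>a b c d. good i a b c d)" if "i \<in> {2..<m}" for i
      unfolding good_def using holomorphic_omits_0_1_imp_cross_ratio[OF fhol[of i]] omit that by auto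
    obtain i0 where i0J: "i0 \<in> {2..<m}" "\<not> (\<exists>k. \<forall>x\<in>PConf n. f i0 x = k)"
      using False by blast
    then obtain a0 b0 c0 d0 where i0: "i0 \<in> {2..<m}" "good i0 a0 b0 c0 d0"
      using dich[OF i0J(1)] by blast
    have G: "distinct [a0, b0, c0, d0]" "{a0, b0, c0, d0} \<subseteq> {..n}" "\<And>x. x \<in> PConf n \<Longrightarrow> f i0 x = gcr x a0 b0 c0 d0"
      using i0(2) unfolding good_def by simp_all
    \<comment> \<open>if \<open>f i\<close> were a constant \<open>k\<close>, the cross-ratio \<open>f i0\<close> would take the value \<open>k\<close> somewhere\<close>
    have all: "\<exists>a b c d. good i a b c d" if i: "i \<in> {2..<m}" for i
    proof (rule ccontr)
      assume no: "\<not> ?thesis"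
      then obtain k where k: "\<And>x. x \<in> PConf n \<Longrightarrow> f i x = k" using dich[OF i] by blast
      have "i \<noteq> i0" using no i0 by auto
      have "k \<noteq> 0" "k \<noteq> 1" using omit[OF x0, of i] k[OF x0] i by auto
      then obtain w where w: "inj_on w {..n}" "crw w a0 b0 c0 d0 = k"
        using cross_ratio_takes_all_values[OF G(1,2)] by blast
      then obtain x where x: "x \<in> PConf n" "gcr x a0 b0 c0 d0 = k"
        using PConf_of_finite_points[OF w(1)] G(2) by auto
      then have "f i0 x = f i x" using G(3) k by simp
      then show False using fneq[OF x(1), of i0 i] i i0(1) \<open>i \<noteq> i0\<close> by auto
    qed
    then obtain a' b' c' d' where abcd: "\<And>i. i \<in> {2..<m} \<Longrightarrow> good i (a' i) (b' i) (c' i) (d' i)"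
      by metis
    have T: "distinct [a' j, b' j, c' j, d' j] \<and> {a' j, b' j, c' j, d' j} \<subseteq> {..n}" if "j \<in> {2..<m}" for j
      using abcd[OF that] unfolding good_def by blast
    have av: "crw w (a' j) (b' j) (c' j) (d' j) \<noteq> crw w (a' k) (b' k) (c' k) (d' k)"
      if "j \<in> {2..<m}" "k \<in> {2..<m}" "j \<noteq> k" "inj_on w {..n}" for j k w
    proof -
      obtain x where x: "x \<in> PConf n" "\<forall>a\<le>n. \<forall>b\<le>n. \<forall>c\<le>n. \<forall>d\<le>n. gcr x a b c d = crw w a b c d"
        using PConf_of_finite_points[OF \<open>inj_on w _\<close>] by blast
      have "f i x = crw w (a' i) (b' i) (c' i) (d' i)" if "i \<in> {2..<m}" for i
        using abcd[OF that] x unfolding good_def by simp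
      then show ?thesis using fneq[OF x(1), of j k] that by auto
    qed
    have ex: "\<exists>a b c e. \<forall>j\<in>{2..<m}. distinct [a, b, c, e j] \<and> {a, b, c, e j} \<subseteq> {..n} \<and>
        (\<forall>w. inj_on w {..n} \<longrightarrow> crw w (a' j) (b' j) (c' j) (d' j) = crw w a b c (e j))"
      by (rule cross_ratio_family[where J = "{2..<m}" and p = a' and q = b' and r = c' and s = d', OF _ _ i0(1)])
        (fact T, fact av)
    from ex show ?thesis
    proof (elim exE)
      fix a b c :: nat and e :: "nat \<Rightarrow> nat"
      assume fam0: "\<forall>j\<in>{2..<m}. distinct [a, b, c, e j] \<and> {a, b, c, e j} \<subseteq> {..n} \<and>
          (\<forall>w. inj_on w {..n} \<longrightarrow> crw w (a' j) (b' j) (c' j) (d' j) = crw w a b c (e j))"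
      note fam = fam0[rule_format, THEN conjunct1] fam0[rule_format, THEN conjunct2, THEN conjunct1]
        and fam_eq = fam0[rule_format, THEN conjunct2, THEN conjunct2, rule_format]
      have fe: "f j x = gcr x a b c (e j)" if "j \<in> {2..<m}" "x \<in> PConf n" for j x
      proof -
        have "gcr x (a' j) (b' j) (c' j) (d' j) = gcr x a b c (e j)"
        proof (rule gcr_eq_via_finite_points)
          show "crw w (a' j) (b' j) (c' j) (d' j) = crw w a b c (e j)" if "inj_on w {..n}" for w
            by (rule fam_eq) fact+
          show "{a' j, b' j, c' j, d' j} \<subseteq> {..n}" using T[OF that(1)] by (rule conjunct2)
          show "{a, b, c, e j} \<subseteq> {..n}" by (rule fam(2)[OF that(1)])
        qed (rule that(2))
        then show ?thesis using abcd[OF that(1)] that(2) unfolding good_def by simp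
      qed
      have inj: "inj_on e {2..<m}"
      proof (rule inj_onI, rule ccontr)
        fix j k assume jk: "j \<in> {2..<m}" "k \<in> {2..<m}" "e j = e k" "j \<noteq> k"
        then have "f j x0 = f k x0" using fe[OF _ x0] by simp
        then show False using fneq[OF x0, of j k] jk by auto
      qed
      define M where "M = map e [2..<m]"
      have setM: "set M = e ` {2..<m}" by (simp add: M_def)
      show ?thesis
      proof (rule realize_cross_ratio_family[OF m h, of c a b M])
        show "length M = m - 2" by (simp add: M_def)
        show "distinct (c # a # b # M)"
        proof -
          have "e j \<notin> {a, b, c}" if "j \<in> {2..<m}" for j using fam(1)[OF that] by auto
          then have "{a, b, c} \<inter> set M = {}" unfolding setM by blast
          moreover have "distinct M" using inj by (simp add: M_def distinct_map)
          ultimately show ?thesis using fam(1)[OF i0(1)] by auto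
        qed
        show "set (c # a # b # M) \<subseteq> {..n}"
        proof -
          have "e j \<in> {..n}" if "j \<in> {2..<m}" for j using fam(2)[OF that] by simp
          then have "set M \<subseteq> {..n}" unfolding setM by blast
          then show ?thesis using fam(2)[OF i0(1)] by auto
        qed
        show "(h x ! i - h x ! 0) / (h x ! 1 - h x ! 0) = gcr x a b c ((a # b # M) ! i)"
          if x: "x \<in> PConf n" and i: "i < m" for x i
        proof -
          have nz: "bracket x b a \<noteq> 0" "bracket x b c \<noteq> 0"
            using bracket_nonzero[OF x] fam(1)[OF i0(1)] fam(2)[OF i0(1)] by auto
          consider "i = 0" | "i = 1" | "i \<in> {2..<m}" using i by fastforce
          then have "f i x = gcr x a b c ((a # b # M) ! i)"
          proof cases
            case 1
            then show ?thesis using f01[OF x] by (simp add: gcr_def bracket_def)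
          next
            case 2
            then show ?thesis using f01[OF x] nz by (simp add: gcr_def)
          next
            case 3
            then obtain k where "i = Suc (Suc k)"
              by (metis atLeastLessThan_iff add_2_eq_Suc le_Suc_ex)
            then have "(a # b # M) ! i = e i"
              using 3 by (simp add: M_def)
            then show ?thesis using fe[OF 3 x] by simp
          qed
          then show ?thesis by (simp add: f_def)
        qed
      qed
    qed
  qed
qed

end
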